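(* Let $\mathfrak g=\mathfrak{sl}_n(\mathbb C)$ and let $\Pi=\{\alpha_1,\dots,\alpha_{n-1}\}$ be its set of simple roots. For any $\mathcal I\subseteq\Pi$, the closure of the Richardson orbital variety $\mathcal V_{\mathcal I}$ satisfies $$\overline{\mathcal V}_{\mathcal I}=\bigcup_{\tau(\mathcal V)\supseteq\mathcal I}\mathcal V,$$ where the union is over all orbital varieties $\mathcal V\subseteq\mathfrak n$ (associated to arbitrary nilpotent orbits of $\mathfrak g$) such that $\tau(\mathcal V)\supseteq\mathcal I$.
   Context: Let $\mathfrak g=\mathfrak{sl}_n(\mathbb C)$, $\mathbf G=SL_n(\mathbb C)$ acting on $\mathfrak g$ by conjugation, $\mathfrak n$ the strictly upper triangular matrices, $\mathfrak b$ the upper triangular traceless matrices, $\mathbf B\subset\mathbf G$ the upper triangular Borel subgroup. The positive roots are $\alpha_{i,j}=\alpha_i+\cdots+\alpha_{j-1}$, $1\le i<j\le n$, with root space $X_{\alpha_{i,j}}=\mathbb C e_{i,j}$; $X_{-\alpha_{i,j}}=\mathbb C e_{j,i}$. Closures are Zariski closures. Orbital varieties: for a nilpotent $\mathbf G$-orbit $\mathcal O$, the irreducible components of $\mathcal O\cap\mathfrak n$ are called the orbital varieties associated to $\mathcal O$. For $\alpha\in\Pi$ let $\mathbf P_\alpha$ be the standard parabolic subgroup with Lie algebra $\mathfrak b\oplus X_{-\alpha}$. For an orbital variety $\mathcal V$ put $\tau(\mathcal V)=\{\alpha\in\Pi : \mathbf P_\alpha(\mathcal V)=\mathcal V\}$,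 where $\mathbf P_\alpha(\mathcal V)=\{gXg^{-1}: g\in\mathbf P_\alpha, X\in\mathcal V\}$. For $\mathcal I\subseteq\Pi$ let $\mathbf P_{\mathcal I}$ be the standard parabolic subgroup generated by (the Borel subgroup and) the $\mathbf P_\alpha$, $\alpha\in\mathcal I$, and let $\mathfrak m_{\mathcal I}\subseteq\mathfrak n$ be the Lie algebra of its unipotent radical. There is a unique orbital variety $\mathcal V_{\mathcal I}$ whose closure is $\mathfrak m_{\mathcal I}$; it is called the Richardson orbital variety defined by $\mathcal I$. So $\overline{\mathcal V}_{\mathcal I}=\mathfrak m_{\mathcal I}$. *)

theory Defs
  imports
    "Jordan_Normal_Form.Determinant"
    "HOL-Algebra.Coset"
    "HOL-Algebra.Generated_Groups"
    "HOL-Analysis.Abstract_Topology"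
begin

section \<open>The Zariski topology on the space of \<open>n \<times> n\<close> matrices\<close>

text \<open>Polynomial functions in the \<open>n\<^sup>2\<close> matrix entries.\<close>

inductive poly_fun :: "nat \<Rightarrow> (complex mat \<Rightarrow> complex) \<Rightarrow> bool" for n :: nat where
  const: "poly_fun n (\<lambda>X. c)"
| coord: "i < n \<Longrightarrow> j < n \<Longrightarrow> poly_fun n (\<lambda>X. X $$ (i, j))"
| add: "poly_fun n f \<Longrightarrow> poly_fun n g \<Longrightarrow> poly_fun n (\<lambda>X. f X + g X)"
| mult: "poly_fun n f \<Longrightarrow> poly_fun n g \<Longrightarrow> poly_fun n (\<lambda>X. f X * g X)"

definition zero_locus :: "nat \<Rightarrow> (complex mat \<Rightarrow> complex) set \<Rightarrow> complex mat set" where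
  "zero_locus n F = {X \<in> carrier_mat n n. \<forall>f\<in>F. f X = 0}"

definition zariski :: "nat \<Rightarrow> complex mat topology" where
  "zariski n = topology (\<lambda>U. \<exists>F. F \<subseteq> Collect (poly_fun n) \<and> U = carrier_mat n n - zero_locus n F)"

lemma openin_zariski:
  "openin (zariski n) U \<longleftrightarrow>
     (\<exists>F. F \<subseteq> Collect (poly_fun n) \<and> U = carrier_mat n n - zero_locus n F)"
proof -
  let ?L = "\<lambda>U. \<exists>F. F \<subseteq> Collect (poly_fun n) \<and> U = carrier_mat n n - zero_locus n F"
  have inter: "?L (S \<inter> T)" if S: "?L S" and T: "?L T" for S T
  proof -
    obtain F G where F: "F \<subseteq> Collect (poly_fun n)" "S = carrier_mat n n - zero_locus n F"
      and G: "G \<subseteq> Collect (poly_fun n)" "T = carrier_mat n n - zero_locus n G"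
      using S T by blast
    let ?H = "{\<lambda>X. f X * g X | f g. f \<in> F \<and> g \<in> G}"
    have "?H \<subseteq> Collect (poly_fun n)"
      using F(1) G(1) by (auto intro: poly_fun.mult)
    moreover have "S \<inter> T = carrier_mat n n - zero_locus n ?H"
      unfolding F(2) G(2) zero_locus_def by (fastforce simp: mult_eq_0_iff)
    ultimately show ?thesis by blast
  qed
  have union: "?L (\<Union>K)" if K: "\<forall>S\<in>K. ?L S" for K
  proof -
    obtain F where F: "\<forall>S\<in>K. F S \<subseteq> Collect (poly_fun n) \<and> S = carrier_mat n n - zero_locus n (F S)"
      using bchoice[OF K] by blast
    have "(\<Union>S\<in>K. F S) \<subseteq> Collect (poly_fun n)"
      using F by blast
    moreover have "\<Union>K = (\<Union>S\<in>K. carrier_mat n n - zero_locus n (F S))"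
      using F by auto
    hence "\<Union>K = carrier_mat n n - zero_locus n (\<Union>S\<in>K. F S)"
      unfolding zero_locus_def by auto
    ultimately show ?thesis by blast
  qed
  have "istopology ?L"
    unfolding istopology_def using inter union by blast
  thus ?thesis
    unfolding zariski_def by simp
qed

lemma topspace_zariski: "topspace (zariski n) = carrier_mat n n"
proof
  show "topspace (zariski n) \<subseteq> carrier_mat n n"
    unfolding topspace_def openin_zariski by blast
  have "carrier_mat n n = carrier_mat n n - zero_locus n {\<lambda>X. 1}"
    by (auto simp: zero_locus_def)
  moreover have "{\<lambda>X. 1} \<subseteq> Collect (poly_fun n)"
    by (auto intro: poly_fun.const)
  ultimately have "openin (zariski n) (carrier_mat n n)"
    unfolding openin_zariski by blast
  thus "carrier_mat n n \<subseteq> topspace (zariski n)"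
    by (rule openin_subset)
qed

lemma closedin_zariski:
  "closedin (zariski n) C \<longleftrightarrow> (\<exists>F. F \<subseteq> Collect (poly_fun n) \<and> C = zero_locus n F)"
proof -
  have sub: "zero_locus n F \<subseteq> carrier_mat n n" for F
    by (auto simp: zero_locus_def)
  show ?thesis
    unfolding closedin_def topspace_zariski openin_zariski
    by (metis Diff_Diff_Int Int_absorb1 sub)
qed

definition irreducible_in :: "'a topology \<Rightarrow> 'a set \<Rightarrow> bool" where
  "irreducible_in T S \<longleftrightarrow> S \<subseteq> topspace T \<and> S \<noteq> {} \<and>
     (\<forall>C D. closedin T C \<and> closedin T D \<and> S \<subseteq> C \<union> D \<longrightarrow> S \<subseteq> C \<or> S \<subseteq> D)"

definition irreducible_component :: "'a topology \<Rightarrow> 'a set \<Rightarrow> 'a set \<Rightarrow> bool" where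
  "irreducible_component T Y V \<longleftrightarrow> V \<subseteq> Y \<and> irreducible_in T V \<and>
     (\<forall>W. W \<subseteq> Y \<and> irreducible_in T W \<and> V \<subseteq> W \<longrightarrow> W = V)"

section \<open>The group \<open>SL\<^sub>n\<close> and its Lie algebra\<close>

text \<open>
  Matrix entries are indexed from 0, while roots keep the usual numbering from 1:
  \<open>e\<^sub>i\<^sub>,\<^sub>j\<close> is \<open>unit_mat n i j\<close> for \<open>1 \<le> i, j \<le> n\<close>, with its entry 1 in position
  \<open>(i - 1, j - 1)\<close>. The simple root \<open>\<alpha>\<^sub>i\<close> is represented by its index
  \<open>i \<in> simple_roots n\<close>.
\<close>

definition SL :: "nat \<Rightarrow> complex mat monoid" where
  "SL n = \<lparr>carrier = {g \<in> carrier_mat n n. det g = 1}, mult = (*), one = 1\<^sub>m n\<rparr>"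

definition trace :: "complex mat \<Rightarrow> complex" where
  "trace X = (\<Sum>i<dim_row X. X $$ (i, i))"

definition sl :: "nat \<Rightarrow> complex mat set" where
  "sl n = {X \<in> carrier_mat n n. trace X = 0}"

definition borel_algebra :: "nat \<Rightarrow> complex mat set" where
  "borel_algebra n = {X \<in> sl n. upper_triangular X}"

definition nilradical :: "nat \<Rightarrow> complex mat set" where
  "nilradical n = {X \<in> carrier_mat n n. \<forall>i<n. \<forall>j\<le>i. X $$ (i, j) = 0}"

definition unit_mat :: "nat \<Rightarrow> nat \<Rightarrow> nat \<Rightarrow> complex mat" where
  "unit_mat n i j = mat n n (\<lambda>(k, l). if k = i - 1 \<and> l = j - 1 then 1 else 0)"

definition simple_roots :: "nat \<Rightarrow> nat set" where
  "simple_roots n = {1..<n}"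

definition neg_root_space :: "nat \<Rightarrow> nat \<Rightarrow> complex mat set" where
  "neg_root_space n i = {c \<cdot>\<^sub>m unit_mat n (i + 1) i | c. True}"

definition conj_by :: "nat \<Rightarrow> complex mat \<Rightarrow> complex mat \<Rightarrow> complex mat" where
  "conj_by n g X = g * X * inv\<^bsub>SL n\<^esub> g"

definition sweep :: "nat \<Rightarrow> complex mat set \<Rightarrow> complex mat set \<Rightarrow> complex mat set" where
  "sweep n H V = {conj_by n g X | g X. g \<in> H \<and> X \<in> V}"

definition nilpotent_mat :: "nat \<Rightarrow> complex mat \<Rightarrow> bool" where
  "nilpotent_mat n X \<longleftrightarrow> X \<in> carrier_mat n n \<and> (\<exists>k. X ^\<^sub>m k = 0\<^sub>m n n)"

definition unipotent_mat :: "nat \<Rightarrow> complex mat \<Rightarrow> bool" where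
  "unipotent_mat n g \<longleftrightarrow> g \<in> carrier_mat n n \<and> nilpotent_mat n (g - 1\<^sub>m n)"

text \<open>
  The Lie algebra of a Zariski closed subgroup \<open>H\<close> is its tangent space at the identity:
  all directions in which every polynomial function vanishing on \<open>H\<close> has derivative zero.
\<close>

definition lie_algebra :: "nat \<Rightarrow> complex mat set \<Rightarrow> complex mat set" where
  "lie_algebra n H = {X \<in> carrier_mat n n. \<forall>f. poly_fun n f \<and> (\<forall>h\<in>H. f h = 0) \<longrightarrow>
     ((\<lambda>t. f (1\<^sub>m n + t \<cdot>\<^sub>m X)) has_field_derivative 0) (at 0)}"

section \<open>Standard parabolic subgroups\<close>

definition borel_group :: "nat \<Rightarrow> complex mat set" where
  "borel_group n = {g \<in> carrier (SL n). upper_triangular g}"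

text \<open>
  A standard parabolic subgroup is a closed subgroup containing the Borel subgroup;
  the one attached to \<open>\<alpha>\<^sub>i\<close> is singled out by its Lie algebra \<open>\<bb> \<oplus> X\<^bsub>-\<alpha>\<^sub>i\<^esub>\<close>.
\<close>

definition standard_parabolic :: "nat \<Rightarrow> complex mat set \<Rightarrow> bool" where
  "standard_parabolic n P \<longleftrightarrow>
     subgroup P (SL n) \<and> closedin (zariski n) P \<and> borel_group n \<subseteq> P"

definition min_parabolic :: "nat \<Rightarrow> nat \<Rightarrow> complex mat set" where
  "min_parabolic n i = (THE P. standard_parabolic n P \<and>
     lie_algebra n P = {X + Y | X Y. X \<in> borel_algebra n \<and> Y \<in> neg_root_space n i})"

definition parabolic :: "nat \<Rightarrow> nat set \<Rightarrow> complex mat set" where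
  "parabolic n I = generate (SL n) (borel_group n \<union> (\<Union>i\<in>I. min_parabolic n i))"

text \<open>The unipotent radical is the largest closed connected normal unipotent subgroup.\<close>

definition unipotent_radical :: "nat \<Rightarrow> complex mat set \<Rightarrow> complex mat set" where
  "unipotent_radical n H = (GREATEST U. U \<lhd> (SL n)\<lparr>carrier := H\<rparr> \<and>
     closedin (zariski n) U \<and> connectedin (zariski n) U \<and> (\<forall>g\<in>U. unipotent_mat n g))"

definition parabolic_nilradical :: "nat \<Rightarrow> nat set \<Rightarrow> complex mat set" where
  "parabolic_nilradical n I = lie_algebra n (unipotent_radical n (parabolic n I))"

section \<open>Orbital varieties\<close>

definition nilpotent_orbit :: "nat \<Rightarrow> complex mat set \<Rightarrow> bool" where
  "nilpotent_orbit n Orb \<longleftrightarrow>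
     (\<exists>X \<in> sl n. nilpotent_mat n X \<and> Orb = sweep n (carrier (SL n)) {X})"

definition orbital_variety :: "nat \<Rightarrow> complex mat set \<Rightarrow> bool" where
  "orbital_variety n V \<longleftrightarrow>
     (\<exists>Orb. nilpotent_orbit n Orb \<and> irreducible_component (zariski n) (Orb \<inter> nilradical n) V)"

definition tau :: "nat \<Rightarrow> complex mat set \<Rightarrow> nat set" where
  "tau n V = {i \<in> simple_roots n. sweep n (min_parabolic n i) V = V}"

definition richardson :: "nat \<Rightarrow> nat set \<Rightarrow> complex mat set" where
  "richardson n I =
     (THE V. orbital_variety n V \<and> zariski n closure_of V = parabolic_nilradical n I)"

end

theory Submission
  imports Defs
    "Jordan_Normal_Form.Jordan_Normal_Form_Existence"
    "Jordan_Normal_Form.Jordan_Normal_Form_Uniqueness"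
begin

text \<open>
  Conjugation by the parabolic \<open>P\<^sub>\<I>\<close> moves any matrix of the nilradical \<open>\<mm>\<^sub>\<I>\<close> to one whose
  kernel filtration \<open>ker N \<subseteq> ker N\<^sup>2 \<subseteq> \<dots>\<close> consists of coordinate subspaces, described by a colouring
  \<open>\<kappa>\<close> of the coordinates that decreases along the blocks of \<open>P\<^sub>\<I>\<close>. For a fixed colouring, the strictly
  upper triangular matrices with this kernel filtration up to a unitriangular base change form the
  image of an affine space of dimension \<open>#{i < j. \<kappa> i \<noteq> \<kappa> j}\<close>. This number depends only on the
  orbit; so the finitely many images covering \<open>\<O> \<inter> \<nn>\<close> have parameter spaces of the same dimension, and
  the image through the given matrix is not contained in the closure of another one, because its
  parametrization has injective differential at the given matrix and hence loses no dimension.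
  Its intersection with the orbit is therefore dense in a component of \<open>\<O> \<inter> \<nn>\<close>; as
  \<open>\<kappa>\<close> decreases along the blocks, this component lies in \<open>\<mm>\<^sub>\<I>\<close> and is stable under \<open>P\<^sub>\<I>\<close>. Conversely a
  variety in \<open>\<nn>\<close> stable under the \<open>P\<^sub>\<alpha>\<close>, \<open>\<alpha> \<in> \<I>\<close>, lies in \<open>\<mm>\<^sub>\<I>\<close>.
\<close>

section \<open>Linear algebra\<close>

text \<open>Generic matrices are not enough: through every X of m_I there must pass a whole
  component of its orbit that stays in m_I. An irreducible set through X could be contained in a
  larger component that leaves m_I; equality of dimensions excludes this. If c_k coordinates have
  colour k, then c_k = dim ker N^k - dim ker N^(k-1), and the number of pairs with distinct colours
  is half of n^2 minus the sum of the c_k^2, that is, half the dimension of the orbit. Dimensions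
  are compared through algebraic relations: more functions than parameters are dependent, functions
  with independent differentials are not. Kernel filtrations serve better than Jordan bases because
  they are intrinsic, a unitriangular matrix adapts them to the coordinate flag, and bounding their
  dimensions is an open polynomial condition. The groups and varieties of the statement are given as
  unique or greatest objects, so each has to be matched with explicit block matrices. The Richardson
  variety comes from the same components: m_I is irreducible and covered by finitely many of their
  closures.\<close>

lemma exists_nontrivial_solution:
  fixes A :: "'k \<Rightarrow> 'j \<Rightarrow> complex"
  assumes "finite K" "finite J" "card K < card J"
  shows "\<exists>c. (\<exists>j\<in>J. c j \<noteq> 0) \<and> (\<forall>k\<in>K. (\<Sum>j\<in>J. A k j * c j) = 0)"
  using assms
proof (induction K arbitrary: J A rule: finite_induct)
  case empty
  then have "J \<noteq> {}" by auto
  then show ?case by (intro exI[of _ "\<lambda>_. 1"]) auto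
next
  case (insert k0 K)
  show ?case
  proof (cases "\<forall>j\<in>J. A k0 j = 0")
    case True
    obtain c where "\<exists>j\<in>J. c j \<noteq> 0" "\<forall>k\<in>K. (\<Sum>j\<in>J. A k j * c j) = 0"
      using insert.IH[of J A] insert.prems insert.hyps by auto
    with True show ?thesis by (intro exI[of _ c]) auto
  next
    case False
    then obtain j0 where j0: "j0 \<in> J" "A k0 j0 \<noteq> 0" by auto
    define J' where "J' = J - {j0}"
    have J': "finite J'" "card K < card J'" "j0 \<notin> J'"
      using insert.prems insert.hyps j0 by (auto simp: J'_def)
    have J: "J = insert j0 J'" using j0 by (auto simp: J'_def)
    \<comment> \<open>Equation \<open>k0\<close> is solved for the unknown \<open>j0\<close>;
      \<open>A'\<close> is the coefficient matrix of the other equations after substitution.\<close>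
    define A' where "A' k j = A k j - A k j0 * A k0 j / A k0 j0" for k j
    obtain c where c: "\<exists>j\<in>J'. c j \<noteq> 0" "\<forall>k\<in>K. (\<Sum>j\<in>J'. A' k j * c j) = 0"
      using insert.IH[of J' A'] J' by auto
    define s where "s = (\<Sum>j\<in>J'. A k0 j * c j)"
    define c' where "c' = c(j0 := - s / A k0 j0)"
    have c'_eq: "(\<Sum>j\<in>J. A k j * c' j) = (\<Sum>j\<in>J'. A k j * c j) - A k j0 * s / A k0 j0" for k
    proof -
      have "(\<Sum>j\<in>J'. A k j * c' j) = (\<Sum>j\<in>J'. A k j * c j)"
        by (rule sum.cong) (use J' in \<open>auto simp: c'_def\<close>)
      then show ?thesis unfolding J using J' by (simp add: c'_def)
    qed
    have "(\<Sum>j\<in>J. A k j * c' j) = 0" if "k \<in> K" for k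
    proof -
      have "0 = (\<Sum>j\<in>J'. A' k j * c j)" using c that by simp
      also have "\<dots> = (\<Sum>j\<in>J'. A k j * c j) - A k j0 * s / A k0 j0"
        by (simp add: A'_def s_def algebra_simps sum_subtractf sum_distrib_left sum_divide_distrib)
      finally show ?thesis using c'_eq by simp
    qed
    moreover have "(\<Sum>j\<in>J. A k0 j * c' j) = 0"
      using c'_eq[of k0] j0 by (simp add: s_def)
    moreover have "\<exists>j\<in>J. c' j \<noteq> 0" using c J' by (auto simp: J c'_def)
    ultimately show ?thesis by blast
  qed
qed

text \<open>Columns are added one at a time. Injectivity leaves the new column with a nonzero
  residue modulo the span of the old ones, and one entry of that residue supplies the new row of the
  inverse. The rows found before are corrected so that they kill the new column.\<close>

lemma exists_left_inverse:
  fixes A :: "'k \<Rightarrow> 'j \<Rightarrow> complex"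
  assumes "finite K" "finite J"
    and inj: "\<And>c. \<forall>k\<in>K. (\<Sum>j\<in>J. A k j * c j) = 0 \<Longrightarrow> \<forall>j\<in>J. c j = 0"
  shows "\<exists>L. \<forall>j\<in>J. \<forall>j'\<in>J. (\<Sum>k\<in>K. L j k * A k j') = (if j = j' then 1 else 0)"
  using assms(2) inj
proof (induction J rule: finite_induct)
  case empty
  then show ?case by auto
next
  case (insert j0 J)
  have "\<forall>j\<in>J. c j = 0" if c: "\<forall>k\<in>K. (\<Sum>j\<in>J. A k j * c j) = 0" for c
  proof -
    have "\<forall>j\<in>insert j0 J. (c(j0 := 0)) j = 0"
    proof (rule insert.prems, rule)
      fix k assume "k \<in> K"
      have "(\<Sum>j\<in>J. A k j * (c(j0 := 0)) j) = (\<Sum>j\<in>J. A k j * c j)"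
        by (rule sum.cong) (use insert.hyps in auto)
      then show "(\<Sum>j\<in>insert j0 J. A k j * (c(j0 := 0)) j) = 0"
        using insert.hyps c \<open>k \<in> K\<close> by simp
    qed
    then show ?thesis using insert.hyps by (auto split: if_splits)
  qed
  from insert.IH[OF this]
  obtain L where L: "\<forall>j\<in>J. \<forall>j'\<in>J. (\<Sum>k\<in>K. L j k * A k j') = (if j = j' then 1 else 0)"
    by blast
  define La where "La j = (\<Sum>k\<in>K. L j k * A k j0)" for j
  define r where "r k = A k j0 - (\<Sum>j\<in>J. A k j * La j)" for k
  have "\<exists>k\<in>K. r k \<noteq> 0"
  proof (rule ccontr)
    assume "\<not> ?thesis"
    then have *: "\<forall>k\<in>K. (\<Sum>j\<in>J. A k j * La j) = A k j0" by (auto simp: r_def)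
    have "\<forall>j\<in>insert j0 J. ((\<lambda>j. - La j)(j0 := 1)) j = 0"
    proof (rule insert.prems, rule)
      fix k assume "k \<in> K"
      have "(\<Sum>j\<in>J. A k j * ((\<lambda>j. - La j)(j0 := 1)) j) = (\<Sum>j\<in>J. - (A k j * La j))"
        by (rule sum.cong) (use insert.hyps in auto)
      then show "(\<Sum>j\<in>insert j0 J. A k j * ((\<lambda>j. - La j)(j0 := 1)) j) = 0"
        using insert.hyps * \<open>k \<in> K\<close> by (simp add: sum_negf)
    qed
    then show False by auto
  qed
  then obtain k0 where k0: "k0 \<in> K" "r k0 \<noteq> 0" by auto
  \<comment> \<open>\<open>\<rho>\<close> takes entry \<open>k0\<close> of the residue of a vector
    modulo the old columns, divided by that of column \<open>j0\<close>; so it is 0 on the old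
    columns and 1 on the new one.\<close>
  define \<rho> where "\<rho> k = ((if k = k0 then 1 else 0) - (\<Sum>j\<in>J. A k0 j * L j k)) / r k0" for k
  have \<rho>: "(\<Sum>k\<in>K. \<rho> k * w k) = (w k0 - (\<Sum>j\<in>J. A k0 j * (\<Sum>k\<in>K. L j k * w k))) / r k0" for w
  proof -
    have "(\<Sum>k\<in>K. (\<Sum>j\<in>J. A k0 j * L j k) * w k) = (\<Sum>j\<in>J. A k0 j * (\<Sum>k\<in>K. L j k * w k))"
      by (simp add: sum_distrib_left sum_distrib_right mult.assoc) (rule sum.swap)
    moreover have "(\<Sum>k\<in>K. (if k = k0 then 1 else 0) * w k) = w k0"
      using k0 assms(1) by (simp add: if_distrib[of "\<lambda>x. x * _"] cong: if_cong)
    ultimately show ?thesis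
      by (simp add: \<rho>_def left_diff_distrib sum_subtractf diff_divide_distrib
          flip: sum_divide_distrib)
  qed
  have \<rho>0: "(\<Sum>k\<in>K. \<rho> k * A k j0) = 1"
    unfolding \<rho> using k0 by (simp add: r_def La_def)
  have \<rho>J: "(\<Sum>k\<in>K. \<rho> k * A k j') = 0" if "j' \<in> J" for j'
  proof -
    have "(\<Sum>j\<in>J. A k0 j * (\<Sum>k\<in>K. L j k * A k j')) = (\<Sum>j\<in>J. if j = j' then A k0 j else 0)"
      by (rule sum.cong) (use L that in auto)
    then show ?thesis unfolding \<rho> using that insert.hyps by simp
  qed
  define L' where "L' j k = (if j = j0 then \<rho> k else L j k - La j * \<rho> k)" for j k
  show ?case
  proof (intro exI[of _ L'] ballI)
    fix j j' assume j: "j \<in> insert j0 J" and j': "j' \<in> insert j0 J"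
    show "(\<Sum>k\<in>K. L' j k * A k j') = (if j = j' then 1 else 0)"
    proof (cases "j = j0")
      case True
      then show ?thesis using j' \<rho>0 \<rho>J insert.hyps by (auto simp: L'_def)
    next
      case False
      have "(\<Sum>k\<in>K. L' j k * A k j') = (\<Sum>k\<in>K. L j k * A k j') - La j * (\<Sum>k\<in>K. \<rho> k * A k j')"
        using False by (simp add: L'_def left_diff_distrib sum_subtractf sum_distrib_left mult.assoc)
      then show ?thesis using False j j' L \<rho>0 \<rho>J insert.hyps by (auto simp: La_def)
    qed
  qed
qed

subsection \<open>Similarity of nilpotent matrices\<close>

lemma similar_mat_four_block_swap:
  fixes A D :: "'a :: comm_ring_1 mat"
  assumes A: "A \<in> carrier_mat n n" and D: "D \<in> carrier_mat m m"
  shows "similar_mat (four_block_mat A (0\<^sub>m n m) (0\<^sub>m m n) D) (four_block_mat D (0\<^sub>m m n) (0\<^sub>m n m) A)"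
proof -
  let ?P = "four_block_mat (0\<^sub>m n m) (1\<^sub>m n) (1\<^sub>m m) (0\<^sub>m m n) :: 'a mat"
  let ?Q = "four_block_mat (0\<^sub>m m n) (1\<^sub>m m) (1\<^sub>m n) (0\<^sub>m n m) :: 'a mat"
  let ?X = "four_block_mat A (0\<^sub>m n m) (0\<^sub>m m n) D"
  let ?Y = "four_block_mat D (0\<^sub>m m n) (0\<^sub>m n m) A"
  note M = mult_four_block_mat[where ?nr1.0 = n and ?n1.0 = m and ?n2.0 = n and ?nr2.0 = m]
  have PQ: "?P * ?Q = 1\<^sub>m (n + m)"
    by (subst M[where ?nc1.0 = n and ?nc2.0 = m]) (auto simp: four_block_one_mat)
  have QP: "?Q * ?P = 1\<^sub>m (n + m)"
    by (subst mult_four_block_mat[where ?nr1.0 = m and ?n1.0 = n and ?n2.0 = m and ?nr2.0 = n and ?nc1.0 = m and ?nc2.0 = n])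
      (auto simp: four_block_one_mat add.commute)
  have PY: "?P * ?Y = four_block_mat (0\<^sub>m n m) A D (0\<^sub>m m n)"
    by (subst M[where ?nc1.0 = m and ?nc2.0 = n]) (use A D in auto)
  have "?P * ?Y * ?Q = ?X"
    unfolding PY by (subst M[where ?nc1.0 = n and ?nc2.0 = m]) (use A D in auto)
  then show ?thesis
    by (intro similar_matI[of _ _ ?P ?Q "n + m"]) (use A D PQ QP in \<open>auto simp: add.commute[of m n]\<close>)
qed

lemma jordan_matrix_append:
  "jordan_matrix (xs @ ys) = four_block_mat (jordan_matrix xs)
     (0\<^sub>m (sum_list (map fst xs)) (sum_list (map fst ys)))
     (0\<^sub>m (sum_list (map fst ys)) (sum_list (map fst xs))) (jordan_matrix ys)"
  unfolding jordan_matrix_def map_append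
  by (subst diag_block_mat_append) (simp add: Let_def flip: jordan_matrix_def)

text \<open>Jordan normal forms are lists, while kernel dimensions determine only the multiset of
  blocks; this lemma bridges the difference.\<close>

lemma similar_jordan_matrix_permute:
  fixes xs ys :: "(nat \<times> 'a :: comm_ring_1) list"
  assumes "mset xs = mset ys"
  shows "similar_mat (jordan_matrix xs) (jordan_matrix ys)"
  using assms
proof (induction xs arbitrary: ys)
  case Nil
  then show ?case by (simp add: similar_mat_refl[of _ 0] carrier_matI)
next
  case (Cons x xs)
  have "x \<in> set ys" using Cons.prems by (metis list.set_intros(1) set_mset_mset)
  then obtain us vs where ys: "ys = us @ x # vs" by (meson split_list)
  have *: "mset xs = mset (us @ vs)" using Cons.prems by (simp add: ys)
  have cong: "similar_mat (jordan_matrix (as @ cs)) (jordan_matrix (bs @ ds))"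
    if "similar_mat (jordan_matrix as) (jordan_matrix bs)" "similar_mat (jordan_matrix cs) (jordan_matrix ds)"
    for as bs cs ds :: "(nat \<times> 'a) list"
  proof -
    have "diag_block_mat [jordan_matrix as, jordan_matrix cs] = jordan_matrix (as @ cs)" for as cs :: "(nat \<times> 'a) list"
      using jordan_matrix_concat_diag_block_mat[of "[as, cs]"] by simp
    then show ?thesis
      using similar_diag_mat_block_mat[of "[(jordan_matrix as, jordan_matrix bs), (jordan_matrix cs, jordan_matrix ds)]"] that
      by auto
  qed
  have refl: "similar_mat (jordan_matrix as) (jordan_matrix as)" for as :: "(nat \<times> 'a) list"
    by (rule similar_mat_refl[OF jordan_matrix_carrier])
  have swap: "similar_mat (jordan_matrix (as @ bs)) (jordan_matrix (bs @ as))" for as bs :: "(nat \<times> 'a) list"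
    unfolding jordan_matrix_append by (rule similar_mat_four_block_swap) auto
  have "similar_mat (jordan_matrix (x # xs)) (jordan_matrix ([x] @ (us @ vs)))"
    using cong[OF refl[of "[x]"] Cons.IH[OF *]] by simp
  moreover have "similar_mat (jordan_matrix ([x] @ (us @ vs))) (jordan_matrix ys)"
    using cong[OF swap[of "[x]" us] refl[of vs]] by (simp add: ys)
  ultimately show ?case by (rule similar_mat_trans)
qed

lemma nilpotent_jordan_nf:
  fixes A :: "complex mat"
  assumes A: "A \<in> carrier_mat n n" and nil: "A ^\<^sub>m k = 0\<^sub>m n n"
  obtains js where "jordan_nf A js" "\<forall>(m, a) \<in> set js. a = 0" "sum_list (map fst js) = n"
proof -
  obtain as where "char_poly A = (\<Prod>a\<leftarrow>as. [:- a, 1:])" using char_poly_factorized[OF A] by auto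
  then obtain js where js: "jordan_nf A js" using jordan_nf_exists[OF A] by auto
  have "a = 0" if "(m, a) \<in> set js" for m a
  proof -
    have "poly (char_poly A) a = 0"
      unfolding jordan_nf_char_poly[OF js] using that js
      by (force simp: poly_prod_list prod_list_zero_iff jordan_nf_def)
    then have "eigenvalue A a" using eigenvalue_root_char_poly[OF A] by simp
    then obtain v where v: "eigenvector A v a" unfolding eigenvalue_def by auto
    then have "A ^\<^sub>m k *\<^sub>v v = a ^ k \<cdot>\<^sub>v v" using eigenvector_pow[OF A] by auto
    moreover have vc: "v \<in> carrier_vec n" "v \<noteq> 0\<^sub>v n" using v A unfolding eigenvector_def by auto
    moreover have "0\<^sub>m n n *\<^sub>v v = 0\<^sub>v n" using vc by (auto intro!: eq_vecI)
    ultimately have z: "a ^ k \<cdot>\<^sub>v v = 0\<^sub>v n" using nil by simp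
    obtain i where i: "i < n" "v $ i \<noteq> 0" using vc by (metis carrier_vecD eq_vecI index_zero_vec)
    have "a ^ k * v $ i = 0" using arg_cong[OF z, of "\<lambda>w. w $ i"] i vc by auto
    then show "a = 0" using i by simp
  qed
  moreover have "sum_list (map fst js) = n"
  proof -
    obtain m P Q where "{A, jordan_matrix js, P, Q} \<subseteq> carrier_mat m m"
      using js similar_matD unfolding jordan_nf_def by metis
    then have "A \<in> carrier_mat m m" "jordan_matrix js \<in> carrier_mat m m" by auto
    then show ?thesis using A by (metis carrier_matD(1) jordan_matrix_dim(1))
  qed
  ultimately show thesis using that[OF js] by auto
qed

text \<open>The kernel dimensions of the powers determine the number of Jordan blocks of each size
  for the eigenvalue 0, and a nilpotent matrix has no other blocks. So the two Jordan forms have the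
  same multiset of blocks.\<close>

lemma nilpotent_similar_if_kernels_eq:
  fixes A B :: "complex mat"
  assumes A: "A \<in> carrier_mat n n" and B: "B \<in> carrier_mat n n"
    and nA: "A ^\<^sub>m k = 0\<^sub>m n n" and nB: "B ^\<^sub>m l = 0\<^sub>m n n"
    and ker: "\<And>m. mat_kernel (A ^\<^sub>m m) = mat_kernel (B ^\<^sub>m m)"
  shows "similar_mat A B"
proof -
  obtain js where js: "jordan_nf A js" "\<forall>(m, a) \<in> set js. a = 0"
    by (rule nilpotent_jordan_nf[OF A nA])
  obtain js' where js': "jordan_nf B js'" "\<forall>(m, a) \<in> set js'. a = 0"
    by (rule nilpotent_jordan_nf[OF B nB])
  have c0: "char_matrix C 0 = C" if "C \<in> carrier_mat n n" for C :: "complex mat"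
    using that by (auto simp: char_matrix_def intro!: eq_matI)
  have "dim_gen_eigenspace A 0 m = dim_gen_eigenspace B 0 m" for m
    unfolding dim_gen_eigenspace_def c0[OF A] c0[OF B] kernel_dim_def ker
      carrier_matD(2)[OF pow_carrier_mat[OF A]] carrier_matD(2)[OF pow_carrier_mat[OF B]] ..
  then have nr: "compute_nr_of_jordan_blocks A 0 m = compute_nr_of_jordan_blocks B 0 m" for m
    unfolding compute_nr_of_jordan_blocks_def by simp
  have "count (mset js) p = count (mset js') p" for p
  proof (cases "snd p = 0 \<and> fst p \<noteq> 0")
    case True
    then obtain m where m: "p = (m, 0)" "m \<noteq> 0" by (metis prod.collapse)
    have "count (mset js) p = length (filter ((=) p) js)"
      by (simp add: count_mset count_list_eq_length_filter)
    also have "\<dots> = length (filter ((=) p) js')"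
      using compute_nr_of_jordan_blocks[OF js(1) m(2), of 0]
        compute_nr_of_jordan_blocks[OF js'(1) m(2), of 0] nr m by simp
    finally show ?thesis
      by (simp add: count_mset count_list_eq_length_filter)
  next
    case False
    then have "p \<notin> set js" "p \<notin> set js'"
      using js js' unfolding jordan_nf_def by (force simp: case_prod_beta)+
    then show ?thesis by (metis count_eq_zero_iff set_mset_mset)
  qed
  then have "mset js = mset js'" by (rule multiset_eqI)
  then have "similar_mat (jordan_matrix js) (jordan_matrix js')"
    by (rule similar_jordan_matrix_permute)
  then show ?thesis using js(1) js'(1) unfolding jordan_nf_def
    by (meson similar_mat_sym similar_mat_trans)
qed

section \<open>Polynomial maps and irreducible sets\<close>

text \<open>\<^const>\<open>poly_fun\<close> fixes a function also outside \<open>carrier_mat n n\<close>, where matrix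
  operations have junk values; hence the following version up to equality on the carrier.\<close>

definition pfun :: "nat \<Rightarrow> (complex mat \<Rightarrow> complex) \<Rightarrow> bool" where
  "pfun n f \<longleftrightarrow> (\<exists>g. poly_fun n g \<and> (\<forall>X\<in>carrier_mat n n. f X = g X))"

definition pmap :: "nat \<Rightarrow> (complex mat \<Rightarrow> complex mat) \<Rightarrow> bool" where
  "pmap n F \<longleftrightarrow> (\<forall>X\<in>carrier_mat n n. F X \<in> carrier_mat n n) \<and>
     (\<forall>i<n. \<forall>j<n. pfun n (\<lambda>X. F X $$ (i, j)))"

lemma pfunE:
  assumes "pfun n f" obtains g where "poly_fun n g" "\<forall>X\<in>carrier_mat n n. f X = g X"
  using assms unfolding pfun_def by (elim exE conjE) simp

lemma pfun_poly_fun: "poly_fun n f \<Longrightarrow> pfun n f"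
  unfolding pfun_def by blast

lemma pfun_cong:
  assumes "\<And>X. X \<in> carrier_mat n n \<Longrightarrow> f X = g X" shows "pfun n f \<longleftrightarrow> pfun n g"
  unfolding pfun_def using assms by auto

lemma pfun_const: "pfun n (\<lambda>X. c)"
  by (rule pfun_poly_fun, rule poly_fun.const)

lemma pfun_coord: "i < n \<Longrightarrow> j < n \<Longrightarrow> pfun n (\<lambda>X. X $$ (i, j))"
  by (rule pfun_poly_fun, rule poly_fun.coord)

lemma pfun_add:
  assumes "pfun n f" "pfun n g" shows "pfun n (\<lambda>X. f X + g X)"
proof -
  obtain f' where f: "poly_fun n f'" "\<forall>X\<in>carrier_mat n n. f X = f' X"
    using assms(1) by (rule pfunE)
  obtain g' where g: "poly_fun n g'" "\<forall>X\<in>carrier_mat n n. g X = g' X"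
    using assms(2) by (rule pfunE)
  show ?thesis
    unfolding pfun_def by (rule exI[of _ "\<lambda>X. f' X + g' X"]) (simp add: f(2) g(2) poly_fun.add[OF f(1) g(1)])
qed

lemma pfun_mult:
  assumes "pfun n f" "pfun n g" shows "pfun n (\<lambda>X. f X * g X)"
proof -
  obtain f' where f: "poly_fun n f'" "\<forall>X\<in>carrier_mat n n. f X = f' X"
    using assms(1) by (rule pfunE)
  obtain g' where g: "poly_fun n g'" "\<forall>X\<in>carrier_mat n n. g X = g' X"
    using assms(2) by (rule pfunE)
  show ?thesis
    unfolding pfun_def by (rule exI[of _ "\<lambda>X. f' X * g' X"]) (simp add: f(2) g(2) poly_fun.mult[OF f(1) g(1)])
qed

lemma pfun_diff: assumes "pfun n f" "pfun n g" shows "pfun n (\<lambda>X. f X - g X)"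
  using pfun_add[OF assms(1) pfun_mult[OF pfun_const[of n "-1"] assms(2)]] by simp

lemma pfun_sum: "(\<And>a. a \<in> A \<Longrightarrow> pfun n (f a)) \<Longrightarrow> pfun n (\<lambda>X. \<Sum>a\<in>A. f a X)"
  by (induction A rule: infinite_finite_induct) (auto intro: pfun_const pfun_add)

lemma pfun_prod: "(\<And>a. a \<in> A \<Longrightarrow> pfun n (f a)) \<Longrightarrow> pfun n (\<lambda>X. \<Prod>a\<in>A. f a X)"
  by (induction A rule: infinite_finite_induct) (auto intro: pfun_const pfun_mult)

lemma pfun_power: "pfun n f \<Longrightarrow> pfun n (\<lambda>X. f X ^ k)"
  by (induction k) (auto intro: pfun_const pfun_mult)

lemma pmapI:
  "(\<And>X. X \<in> carrier_mat n n \<Longrightarrow> F X \<in> carrier_mat n n) \<Longrightarrow>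
   (\<And>i j. i < n \<Longrightarrow> j < n \<Longrightarrow> pfun n (\<lambda>X. F X $$ (i, j))) \<Longrightarrow> pmap n F"
  unfolding pmap_def by auto

lemma pmap_carrier: "pmap n F \<Longrightarrow> X \<in> carrier_mat n n \<Longrightarrow> F X \<in> carrier_mat n n"
  unfolding pmap_def by auto

lemma pmap_entry: "pmap n F \<Longrightarrow> i < n \<Longrightarrow> j < n \<Longrightarrow> pfun n (\<lambda>X. F X $$ (i, j))"
  unfolding pmap_def by auto

lemma pfun_comp:
  assumes "pfun n f" "pmap n F" shows "pfun n (\<lambda>X. f (F X))"
proof -
  obtain g where g: "poly_fun n g" "\<forall>X\<in>carrier_mat n n. f X = g X" using assms(1) by (rule pfunE)
  from g(1) have "pfun n (\<lambda>X. g (F X))"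
  proof (induction rule: poly_fun.induct)
    case (add f g)
    show ?case by (rule pfun_add[OF add.IH])
  next
    case (mult f g)
    show ?case by (rule pfun_mult[OF mult.IH])
  qed (simp_all add: pfun_const pmap_entry[OF assms(2)])
  then show ?thesis
    using g pmap_carrier[OF assms(2)] by (simp cong: pfun_cong)
qed

lemma pmap_comp: "pmap n F \<Longrightarrow> pmap n G \<Longrightarrow> pmap n (\<lambda>X. F (G X))"
  by (rule pmapI) (simp_all add: pmap_carrier pfun_comp[OF pmap_entry])

lemma pmap_id: "pmap n (\<lambda>X. X)"
  by (rule pmapI) (simp_all add: pfun_coord)

lemma pmap_const: "A \<in> carrier_mat n n \<Longrightarrow> pmap n (\<lambda>X. A)"
  by (rule pmapI) (simp_all add: pfun_const)

lemma index_mult_sum: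
  "A \<in> carrier_mat n m \<Longrightarrow> B \<in> carrier_mat m l \<Longrightarrow> i < n \<Longrightarrow> j < l \<Longrightarrow>
   (A * B) $$ (i, j) = (\<Sum>k<m. A $$ (i, k) * B $$ (k, j))"
  by (auto simp: scalar_prod_def atLeast0LessThan intro!: sum.cong)

lemma pmap_mult:
  assumes "pmap n F" "pmap n G" shows "pmap n (\<lambda>X. F X * G X)"
proof (rule pmapI)
  fix i j assume ij: "i < n" "j < n"
  have "pfun n (\<lambda>X. \<Sum>k<n. F X $$ (i, k) * G X $$ (k, j))"
    by (intro pfun_sum pfun_mult pmap_entry[OF assms(1)] pmap_entry[OF assms(2)]) (use ij in auto)
  then show "pfun n (\<lambda>X. (F X * G X) $$ (i, j))"
    using pfun_cong[OF index_mult_sum[OF pmap_carrier[OF assms(1)] pmap_carrier[OF assms(2)] ij]] by simp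
qed (rule mult_carrier_mat[OF pmap_carrier[OF assms(1)] pmap_carrier[OF assms(2)]])

lemma pmap_add:
  assumes "pmap n F" "pmap n G" shows "pmap n (\<lambda>X. F X + G X)"
proof (rule pmapI)
  fix i j assume ij: "i < n" "j < n"
  have "(F X + G X) $$ (i, j) = F X $$ (i, j) + G X $$ (i, j)" if "X \<in> carrier_mat n n" for X
    using pmap_carrier[OF assms(2) that] ij by simp
  then show "pfun n (\<lambda>X. (F X + G X) $$ (i, j))"
    using pfun_add[OF pmap_entry[OF assms(1) ij] pmap_entry[OF assms(2) ij]] by (simp cong: pfun_cong)
qed (rule add_carrier_mat[OF pmap_carrier[OF assms(2)]])

lemma pmap_pow:
  assumes "pmap n F" shows "pmap n (\<lambda>X. F X ^\<^sub>m k)"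
proof (induction k)
  case 0
  show ?case
  proof (rule pmapI)
    fix i j assume "i < n" "j < n"
    have "F X ^\<^sub>m 0 = 1\<^sub>m n" if "X \<in> carrier_mat n n" for X using pmap_carrier[OF assms that] by auto
    then show "pfun n (\<lambda>X. (F X ^\<^sub>m 0) $$ (i, j))"
      using pfun_const by (simp cong: pfun_cong)
  qed (use pmap_carrier[OF assms] in \<open>simp add: carrier_matD[OF pmap_carrier[OF assms]]\<close>)
next
  case (Suc k)
  then show ?case using pmap_mult[OF Suc assms] by simp
qed

lemma pfun_det:
  assumes "\<And>X. X \<in> carrier_mat n n \<Longrightarrow> G X \<in> carrier_mat m m"
    and "\<And>i j. i < m \<Longrightarrow> j < m \<Longrightarrow> pfun n (\<lambda>X. G X $$ (i, j))"
  shows "pfun n (\<lambda>X. det (G X))"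
proof -
  have "pfun n (\<lambda>X. \<Sum>p\<in>{p. p permutes {0..<m}}. signof p * (\<Prod>i = 0..<m. G X $$ (i, p i)))"
    by (intro pfun_sum pfun_mult pfun_const pfun_prod assms(2)) (auto dest: permutes_in_image)
  then show ?thesis
    using pfun_cong[OF det_def'[OF assms(1)]] by simp
qed

text \<open>On matrices of determinant 1 the adjugate is the inverse, so inversion there extends to
  a polynomial map on all matrices. This is why inverses in SL_n are rewritten with
  \<open>adj_mat\<close>.\<close>

lemma pmap_adj: "pmap n adj_mat"
proof (rule pmapI)
  fix i j assume ij: "i < n" "j < n"
  have "pfun n (\<lambda>X. (-1) ^ (j + i) * det (mat_delete X j i))"
  proof (intro pfun_mult pfun_const pfun_det)
    fix k l assume kl: "k < n - 1" "l < n - 1"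
    have "mat_delete X j i $$ (k, l) = X $$ (if k < j then k else Suc k, if l < i then l else Suc l)"
      if "X \<in> carrier_mat n n" for X :: "complex mat"
      using kl that by (simp add: mat_delete_def)
    then show "pfun n (\<lambda>X. mat_delete X j i $$ (k, l))"
      using kl by (simp add: pfun_coord cong: pfun_cong)
  qed (simp add: mat_delete_def)
  moreover have "adj_mat X $$ (i, j) = (-1) ^ (j + i) * det (mat_delete X j i)"
    if "X \<in> carrier_mat n n" for X :: "complex mat"
    using ij that by (simp add: adj_mat_def cofactor_def)
  ultimately show "pfun n (\<lambda>X. adj_mat X $$ (i, j))"
    by (simp cong: pfun_cong)
qed (rule adj_mat(1))

text \<open>Clearing denominators. Rational rather than polynomial curves are needed because curves
  inside SL_n are obtained below by dividing by a determinant.\<close>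

lemma poly_fun_rational_curve:
  assumes "poly_fun n f"
    and "\<And>t i j. poly q t \<noteq> 0 \<Longrightarrow> i < n \<Longrightarrow> j < n \<Longrightarrow> \<gamma> t $$ (i, j) * poly q t = poly (P i j) t"
  shows "\<exists>N p. \<forall>t. poly q t \<noteq> 0 \<longrightarrow> f (\<gamma> t) * poly q t ^ N = poly p t"
  using assms(1)
proof (induction rule: poly_fun.induct)
  case (const c)
  show ?case by (rule exI[of _ 0], rule exI[of _ "[:c:]"]) simp
next
  case (coord i j)
  show ?case by (rule exI[of _ 1], rule exI[of _ "P i j"]) (use coord assms(2) in auto)
next
  case (add f g)
  then obtain N p M r where
    f: "\<And>t. poly q t \<noteq> 0 \<Longrightarrow> f (\<gamma> t) * poly q t ^ N = poly p t" and
    g: "\<And>t. poly q t \<noteq> 0 \<Longrightarrow> g (\<gamma> t) * poly q t ^ M = poly r t" by auto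
  show ?case
  proof (rule exI[of _ "N + M"], rule exI[of _ "p * q ^ M + r * q ^ N"], intro allI impI)
    fix t assume t: "poly q t \<noteq> 0"
    show "(f (\<gamma> t) + g (\<gamma> t)) * poly q t ^ (N + M) = poly (p * q ^ M + r * q ^ N) t"
      using f[OF t, symmetric] g[OF t, symmetric] by (simp add: algebra_simps power_add)
  qed
next
  case (mult f g)
  then obtain N p M r where
    f: "\<And>t. poly q t \<noteq> 0 \<Longrightarrow> f (\<gamma> t) * poly q t ^ N = poly p t" and
    g: "\<And>t. poly q t \<noteq> 0 \<Longrightarrow> g (\<gamma> t) * poly q t ^ M = poly r t" by auto
  show ?case
  proof (rule exI[of _ "N + M"], rule exI[of _ "p * r"], intro allI impI)
    fix t assume t: "poly q t \<noteq> 0"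
    show "f (\<gamma> t) * g (\<gamma> t) * poly q t ^ (N + M) = poly (p * r) t"
      using f[OF t, symmetric] g[OF t, symmetric] by (simp add: algebra_simps power_add)
  qed
qed

section \<open>Irreducible sets in the Zariski topology\<close>

lemma irreducible_inD:
  assumes "irreducible_in T S" "closedin T C" "closedin T D" "S \<subseteq> C \<union> D"
  shows "S \<subseteq> C \<or> S \<subseteq> D"
  using assms unfolding irreducible_in_def by meson

text \<open>If C misses A and D misses B, some f vanishing on C is nonzero at A and some g vanishing
  on D is nonzero at B. Along a curve from A to B the numerators of f and g are nonzero polynomials
  in one variable, so some parameter avoids their zeros and those of the denominator; that point of
  S lies in neither C nor D.\<close>

lemma irreducible_in_if_rational_curves:
  assumes S: "S \<subseteq> carrier_mat n n" "S \<noteq> {}"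
    and curve: "\<And>A B. A \<in> S \<Longrightarrow> B \<in> S \<Longrightarrow> \<exists>\<gamma> q P. poly q 0 \<noteq> 0 \<and> poly q 1 \<noteq> 0 \<and> \<gamma> 0 = A \<and> \<gamma> 1 = B \<and>
      (\<forall>t. poly q t \<noteq> 0 \<longrightarrow> \<gamma> t \<in> S \<and> (\<forall>i<n. \<forall>j<n. \<gamma> t $$ (i, j) * poly q t = poly (P i j) t))"
  shows "irreducible_in (zariski n) S"
  unfolding irreducible_in_def
proof (intro conjI allI impI S)
  show "S \<subseteq> topspace (zariski n)" using S by (simp add: topspace_zariski)
  fix C D assume *: "closedin (zariski n) C \<and> closedin (zariski n) D \<and> S \<subseteq> C \<union> D"
  then obtain F G where F: "F \<subseteq> Collect (poly_fun n)" "C = zero_locus n F"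
    and G: "G \<subseteq> Collect (poly_fun n)" "D = zero_locus n G" unfolding closedin_zariski by auto
  show "S \<subseteq> C \<or> S \<subseteq> D"
  proof (rule ccontr)
    assume "\<not> ?thesis"
    then obtain A B where A: "A \<in> S" "A \<notin> C" and B: "B \<in> S" "B \<notin> D" by auto
    obtain f where f: "f \<in> F" "f A \<noteq> 0" using A S unfolding F zero_locus_def by auto
    obtain g where g: "g \<in> G" "g B \<noteq> 0" using B S unfolding G zero_locus_def by auto
    obtain \<gamma> q P where q: "poly q 0 \<noteq> 0" "poly q 1 \<noteq> 0" and \<gamma>: "\<gamma> 0 = A" "\<gamma> 1 = B"
      and \<gamma>S: "\<And>t. poly q t \<noteq> 0 \<Longrightarrow> \<gamma> t \<in> S"
      and P: "\<And>t i j. poly q t \<noteq> 0 \<Longrightarrow> i < n \<Longrightarrow> j < n \<Longrightarrow> \<gamma> t $$ (i, j) * poly q t = poly (P i j) t"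
      using curve[OF A(1) B(1)] by blast
    obtain N pf where pf: "\<And>t. poly q t \<noteq> 0 \<Longrightarrow> f (\<gamma> t) * poly q t ^ N = poly pf t"
      using poly_fun_rational_curve[of n f q \<gamma> P] f F P by auto
    obtain M pg where pg: "\<And>t. poly q t \<noteq> 0 \<Longrightarrow> g (\<gamma> t) * poly q t ^ M = poly pg t"
      using poly_fun_rational_curve[of n g q \<gamma> P] g G P by auto
    have "poly pf 0 \<noteq> 0" using pf[OF q(1)] \<gamma> f q by (metis mult_eq_0_iff power_eq_0_iff)
    moreover have "poly pg 1 \<noteq> 0" using pg[OF q(2)] \<gamma> g q by (metis mult_eq_0_iff power_eq_0_iff)
    ultimately have "pf * pg * q \<noteq> 0" using q by auto
    then have "finite {t. poly (pf * pg * q) t = 0}" by (rule poly_roots_finite)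
    then obtain t where t: "poly (pf * pg * q) t \<noteq> 0"
      using infinite_UNIV_char_0[where 'a=complex] by (metis (mono_tags, lifting) UNIV_eq_I mem_Collect_eq)
    then have "poly q t \<noteq> 0" "f (\<gamma> t) \<noteq> 0" "g (\<gamma> t) \<noteq> 0" using pf pg by force+
    then have "\<gamma> t \<in> S" "\<gamma> t \<notin> C" "\<gamma> t \<notin> D"
      using \<gamma>S f g by (auto simp: F G zero_locus_def)
    then show False using * by auto
  qed
qed

lemma zero_locus_pfun_closedin:
  assumes "\<And>f. f \<in> F \<Longrightarrow> pfun n f"
  shows "closedin (zariski n) (zero_locus n F)"
proof -
  obtain h where h: "\<And>f. f \<in> F \<Longrightarrow> poly_fun n (h f) \<and> (\<forall>X\<in>carrier_mat n n. f X = h f X)"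
    using assms unfolding pfun_def by metis
  have "zero_locus n F = zero_locus n (h ` F)" using h by (auto simp: zero_locus_def)
  then show ?thesis unfolding closedin_zariski using h by (intro exI[of _ "h ` F"]) auto
qed

lemma closedin_zariski_Int_vanishing:
  assumes "closedin (zariski n) C" "X \<in> carrier_mat n n" "X \<notin> C"
  obtains f where "pfun n f" "\<And>Y. Y \<in> C \<Longrightarrow> f Y = 0" "f X \<noteq> 0"
proof -
  obtain F where F: "F \<subseteq> Collect (poly_fun n)" "C = zero_locus n F" using assms unfolding closedin_zariski by auto
  then obtain f where "f \<in> F" "f X \<noteq> 0" using assms by (auto simp: zero_locus_def)
  then show thesis using that[of f] F by (auto simp: zero_locus_def pfun_poly_fun)
qed

lemma closure_of_zariski_vanish:
  assumes "X \<in> zariski n closure_of S" "S \<subseteq> carrier_mat n n" "pfun n f" "\<And>Y. Y \<in> S \<Longrightarrow> f Y = 0"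
  shows "f X = 0"
proof -
  have "zariski n closure_of S \<subseteq> zero_locus n {f}"
    by (rule closure_of_minimal) (use assms zero_locus_pfun_closedin[of "{f}"] in \<open>auto simp: zero_locus_def\<close>)
  then show ?thesis using assms(1) by (auto simp: zero_locus_def)
qed

lemma closedin_pmap_vimage:
  assumes "closedin (zariski n) C" "pmap n F"
  shows "closedin (zariski n) {X \<in> carrier_mat n n. F X \<in> C}"
proof -
  obtain G where G: "G \<subseteq> Collect (poly_fun n)" "C = zero_locus n G" using assms unfolding closedin_zariski by auto
  have "{X \<in> carrier_mat n n. F X \<in> C} = zero_locus n ((\<lambda>g X. g (F X)) ` G)"
    unfolding G zero_locus_def using pmap_carrier[OF assms(2)] by auto
  then show ?thesis using G
    by (auto intro!: zero_locus_pfun_closedin pfun_comp[OF pfun_poly_fun assms(2)])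
qed

lemma irreducible_in_pmap_image:
  assumes "irreducible_in (zariski n) S" "pmap n F"
  shows "irreducible_in (zariski n) (F ` S)"
  unfolding irreducible_in_def
proof (intro conjI allI impI)
  have S: "S \<subseteq> carrier_mat n n" "S \<noteq> {}" using assms(1) by (auto simp: irreducible_in_def topspace_zariski)
  show "F ` S \<subseteq> topspace (zariski n)" "F ` S \<noteq> {}"
    using S pmap_carrier[OF assms(2)] by (auto simp: topspace_zariski)
  fix C D assume *: "closedin (zariski n) C \<and> closedin (zariski n) D \<and> F ` S \<subseteq> C \<union> D"
  let ?v = "\<lambda>C. {X \<in> carrier_mat n n. F X \<in> C}"
  have "S \<subseteq> ?v C \<union> ?v D" using * S by auto
  then have "S \<subseteq> ?v C \<or> S \<subseteq> ?v D"
    using irreducible_inD[OF assms(1)] * closedin_pmap_vimage[OF _ assms(2)] by meson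
  then show "F ` S \<subseteq> C \<or> F ` S \<subseteq> D" unfolding image_subset_iff by (elim disjE) (simp_all add: subset_iff)
qed

lemma irreducible_in_between:
  assumes "irreducible_in T S" "S \<subseteq> W" "W \<subseteq> T closure_of S"
  shows "irreducible_in T W"
  unfolding irreducible_in_def
proof (intro conjI allI impI)
  show "W \<subseteq> topspace T" by (rule order_trans[OF assms(3) closure_of_subset_topspace])
  show "W \<noteq> {}" using assms(1,2) unfolding irreducible_in_def by auto
  fix C D assume *: "closedin T C \<and> closedin T D \<and> W \<subseteq> C \<union> D"
  then have "S \<subseteq> C \<or> S \<subseteq> D" using irreducible_inD[OF assms(1)] assms(2) by (meson order_trans)
  then show "W \<subseteq> C \<or> W \<subseteq> D" using * assms(3) by (meson closure_of_minimal order_trans)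
qed

lemma irreducible_in_finite_cover:
  assumes "finite \<A>" "irreducible_in T S" "\<And>C. C \<in> \<A> \<Longrightarrow> closedin T C" "S \<subseteq> \<Union>\<A>"
  shows "\<exists>C\<in>\<A>. S \<subseteq> C"
  using assms(1,3,4)
proof (induction \<A> rule: finite_induct)
  case empty
  then show ?case using assms(2) by (auto simp: irreducible_in_def)
next
  case (insert C \<A>)
  have "closedin T (\<Union>\<A>)" using insert by (intro closedin_Union) auto
  then have "S \<subseteq> C \<or> S \<subseteq> \<Union>\<A>" using irreducible_inD[OF assms(2)] insert.prems by simp
  then show ?case using insert by auto
qed

lemma irreducible_in_imp_connectedin:
  assumes "irreducible_in T S" shows "connectedin T S"
proof -
  have S: "S \<subseteq> topspace T" using assms by (auto simp: irreducible_in_def)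
  show ?thesis unfolding connectedin_closedin
  proof (intro conjI notI S)
    assume "\<exists>E1 E2. closedin T E1 \<and> closedin T E2 \<and> S \<subseteq> E1 \<union> E2 \<and> E1 \<inter> E2 \<inter> S = {} \<and> E1 \<inter> S \<noteq> {} \<and> E2 \<inter> S \<noteq> {}"
    then show False using irreducible_inD[OF assms] by blast
  qed
qed

text \<open>Zorn's lemma for the irreducible sets between S and Y. The union of a chain is
  irreducible: if one member is not contained in C and another not in D, the larger of the two is
  contained in neither.\<close>

lemma irreducible_component_exists:
  assumes "irreducible_in T S" "S \<subseteq> Y"
  shows "\<exists>V. irreducible_component T Y V \<and> S \<subseteq> V"
proof -
  define \<W> where "\<W> = {W. S \<subseteq> W \<and> W \<subseteq> Y \<and> irreducible_in T W}"
  have "\<exists>M\<in>\<W>. \<forall>W\<in>\<W>. M \<subseteq> W \<longrightarrow> W = M"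
  proof (rule subset_Zorn_nonempty)
    show "\<W> \<noteq> {}" using assms by (auto simp: \<W>_def)
    fix \<C> assume \<C>: "\<C> \<noteq> {}" "subset.chain \<W> \<C>"
    then have sub: "\<C> \<subseteq> \<W>" and lin: "\<And>A B. A \<in> \<C> \<Longrightarrow> B \<in> \<C> \<Longrightarrow> A \<subseteq> B \<or> B \<subseteq> A"
      by (auto simp: subset_chain_def)
    have "irreducible_in T (\<Union>\<C>)"
      unfolding irreducible_in_def
    proof (intro conjI allI impI)
      show "\<Union>\<C> \<subseteq> topspace T" using sub by (auto simp: \<W>_def irreducible_in_def)
      show "\<Union>\<C> \<noteq> {}" using sub \<C>(1) by (force simp: \<W>_def irreducible_in_def)
      fix C D assume *: "closedin T C \<and> closedin T D \<and> \<Union>\<C> \<subseteq> C \<union> D"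
      then have each: "A \<subseteq> C \<or> A \<subseteq> D" if "A \<in> \<C>" for A
        using that sub irreducible_inD[of T A C D] unfolding \<W>_def by blast
      show "\<Union>\<C> \<subseteq> C \<or> \<Union>\<C> \<subseteq> D"
      proof (rule ccontr)
        assume "\<not> ?thesis"
        then obtain A B where AB: "A \<in> \<C>" "\<not> A \<subseteq> C" "B \<in> \<C>" "\<not> B \<subseteq> D" by blast
        then show False using each[of A] each[of B] lin[of A B] by blast
      qed
    qed
    then show "\<Union>\<C> \<in> \<W>" using sub \<C>(1) by (fastforce simp: \<W>_def)
  qed
  then obtain M where "M \<in> \<W>" "\<forall>W\<in>\<W>. M \<subseteq> W \<longrightarrow> W = M" by (rule bexE)
  then have "irreducible_component T Y M \<and> S \<subseteq> M"
    unfolding irreducible_component_def \<W>_def by (simp add: order_trans[of S M])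
  then show ?thesis by (rule exI)
qed

text \<open>The two factors are treated in turn, since the product topology on pairs would be too
  coarse. For fixed g the image of V is irreducible, hence in C or in D. The g of each kind form a
  closed set, an intersection of preimages over all v, so irreducibility of P decides.\<close>

lemma irreducible_in_sweep:
  assumes P: "irreducible_in (zariski n) P" and V: "irreducible_in (zariski n) V"
    and "\<And>v. v \<in> V \<Longrightarrow> pmap n (\<lambda>g. f g v)" "\<And>g. g \<in> P \<Longrightarrow> pmap n (f g)"
  shows "irreducible_in (zariski n) {f g v | g v. g \<in> P \<and> v \<in> V}"
  unfolding irreducible_in_def
proof (intro conjI allI impI)
  have S: "V \<subseteq> carrier_mat n n" "V \<noteq> {}" "P \<subseteq> carrier_mat n n" "P \<noteq> {}"
    using P V by (auto simp: irreducible_in_def topspace_zariski)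
  show "{f g v | g v. g \<in> P \<and> v \<in> V} \<subseteq> topspace (zariski n)" "{f g v | g v. g \<in> P \<and> v \<in> V} \<noteq> {}"
    using S pmap_carrier[OF assms(4)] by (auto simp: topspace_zariski)
  fix C D assume *: "closedin (zariski n) C \<and> closedin (zariski n) D \<and> {f g v | g v. g \<in> P \<and> v \<in> V} \<subseteq> C \<union> D"
  define v where "v C = {g \<in> carrier_mat n n. \<forall>v\<in>V. f g v \<in> C}" for C
  have v: "closedin (zariski n) (v C)" if "closedin (zariski n) C" for C
  proof -
    have "v C = (\<Inter>x\<in>V. {g \<in> carrier_mat n n. f g x \<in> C})" using S by (auto simp: v_def)
    then show ?thesis using S that by (auto intro!: closedin_INT closedin_pmap_vimage assms(3))
  qed
  have "P \<subseteq> v C \<union> v D"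
  proof
    fix g assume g: "g \<in> P"
    have "irreducible_in (zariski n) (f g ` V)" by (rule irreducible_in_pmap_image[OF V assms(4)[OF g]])
    moreover have "f g ` V \<subseteq> C \<union> D" using * g by auto
    ultimately have "f g ` V \<subseteq> C \<or> f g ` V \<subseteq> D" using irreducible_inD * by meson
    then show "g \<in> v C \<union> v D" using g S by (auto simp: v_def)
  qed
  then have "P \<subseteq> v C \<or> P \<subseteq> v D" using irreducible_inD[OF P] * v by meson
  then show "{f g v | g v. g \<in> P \<and> v \<in> V} \<subseteq> C \<or> {f g v | g v. g \<in> P \<and> v \<in> V} \<subseteq> D"
    unfolding v_def by blast
qed

lemma irreducible_in_mult_zero:
  assumes "irreducible_in (zariski n) S" "pfun n f" "pfun n g" "\<And>X. X \<in> S \<Longrightarrow> f X * g X = 0"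
  shows "(\<forall>X\<in>S. f X = 0) \<or> (\<forall>X\<in>S. g X = 0)"
proof -
  have "S \<subseteq> carrier_mat n n" using assms(1) by (auto simp: irreducible_in_def topspace_zariski)
  then have "S \<subseteq> zero_locus n {f} \<union> zero_locus n {g}" using assms(4) by (auto simp: zero_locus_def)
  then have "S \<subseteq> zero_locus n {f} \<or> S \<subseteq> zero_locus n {g}"
    using irreducible_inD[OF assms(1)] zero_locus_pfun_closedin[of "{f}" n] zero_locus_pfun_closedin[of "{g}" n] assms(2,3)
    by auto
  then show ?thesis by (auto simp: zero_locus_def)
qed

section \<open>Block triangular matrices\<close>

lemma index_mult_vec_sum:
  "A \<in> carrier_mat n m \<Longrightarrow> v \<in> carrier_vec m \<Longrightarrow> i < n \<Longrightarrow> (A *\<^sub>v v) $ i = (\<Sum>k<m. A $$ (i, k) * v $ k)"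
  by (auto simp: scalar_prod_def atLeast0LessThan intro!: sum.cong)

lemma pow_mat_add:
  assumes "A \<in> carrier_mat n n" shows "A ^\<^sub>m (k + l) = A ^\<^sub>m k * A ^\<^sub>m l"
proof (induction l)
  case 0
  have "A ^\<^sub>m k * 1\<^sub>m n = A ^\<^sub>m k" by (rule right_mult_one_mat[OF pow_carrier_mat[OF assms]])
  then show ?case using assms by simp
next
  case (Suc l)
  have "A ^\<^sub>m k * A ^\<^sub>m l * A = A ^\<^sub>m k * (A ^\<^sub>m l * A)"
    by (rule assoc_mult_mat[OF pow_carrier_mat[OF assms] pow_carrier_mat[OF assms] assms])
  with Suc show ?case by simp
qed

section \<open>SL_n and its conjugation action\<close>

lemma SL_carrier: "g \<in> carrier (SL n) \<longleftrightarrow> g \<in> carrier_mat n n \<and> det g = 1"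
  by (simp add: SL_def)

lemma SL_mult [simp]: "g \<otimes>\<^bsub>SL n\<^esub> h = g * h" and SL_one [simp]: "\<one>\<^bsub>SL n\<^esub> = 1\<^sub>m n"
  by (simp_all add: SL_def)

lemma SL_adj:
  assumes "g \<in> carrier (SL n)"
  shows "g \<in> carrier_mat n n" "adj_mat g \<in> carrier_mat n n" "g * adj_mat g = 1\<^sub>m n" "adj_mat g * g = 1\<^sub>m n"
    "adj_mat g \<in> carrier (SL n)"
proof -
  show g: "g \<in> carrier_mat n n" using assms by (simp add: SL_carrier)
  have 1: "det g = 1" using assms by (simp add: SL_carrier)
  show a: "adj_mat g \<in> carrier_mat n n" by (rule adj_mat(1)[OF g])
  have id: "1 \<cdot>\<^sub>m 1\<^sub>m n = (1\<^sub>m n :: complex mat)" by (auto intro!: eq_matI)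
  show ga: "g * adj_mat g = 1\<^sub>m n" "adj_mat g * g = 1\<^sub>m n" using adj_mat(2,3)[OF g] 1 id by simp_all
  have "det g * det (adj_mat g) = 1" using det_mult[OF g a] ga by simp
  then show "adj_mat g \<in> carrier (SL n)" using 1 a by (simp add: SL_carrier)
qed

lemma group_SL: "group (SL n)"
proof (rule groupI)
  fix x assume x: "x \<in> carrier (SL n)"
  then show "\<exists>y\<in>carrier (SL n). y \<otimes>\<^bsub>SL n\<^esub> x = \<one>\<^bsub>SL n\<^esub>" using SL_adj[OF x] by auto
qed (auto simp: SL_carrier det_mult assoc_mult_mat[of _ n n _ n _ n])

lemma SL_inv: "g \<in> carrier (SL n) \<Longrightarrow> inv\<^bsub>SL n\<^esub> g = adj_mat g"
  by (rule group.inv_equality[OF group_SL]) (simp_all add: SL_adj)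

lemma conj_by_adj: "g \<in> carrier (SL n) \<Longrightarrow> conj_by n g X = g * X * adj_mat g"
  by (simp add: conj_by_def SL_inv)

lemma conj_by_eqI:
  assumes g: "g \<in> carrier (SL n)" and c: "X \<in> carrier_mat n n" "Y \<in> carrier_mat n n" and eq: "X * g = g * Y"
  shows "X = conj_by n g Y" "Y = adj_mat g * X * g"
proof -
  note a = SL_adj[OF g]
  have "X * g * adj_mat g = X * (g * adj_mat g)" by (rule assoc_mult_mat[OF c(1) a(1,2)])
  then show "X = conj_by n g Y" using eq c a by (simp add: conj_by_adj[OF g])
  have "adj_mat g * (g * Y) = adj_mat g * g * Y" by (rule assoc_mult_mat[symmetric, OF a(2,1) c(2)])
  moreover have "adj_mat g * (X * g) = adj_mat g * X * g" by (rule assoc_mult_mat[symmetric, OF a(2) c(1) a(1)])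
  ultimately show "Y = adj_mat g * X * g" using eq c a by simp
qed

lemma conj_by_carrier: "g \<in> carrier (SL n) \<Longrightarrow> X \<in> carrier_mat n n \<Longrightarrow> conj_by n g X \<in> carrier_mat n n"
  using SL_adj(1,2)[of g n] by (simp add: conj_by_adj mult_carrier_mat[of _ n n])

lemma conj_by_mult_eq: 
  assumes g: "g \<in> carrier (SL n)" and X: "X \<in> carrier_mat n n" shows "conj_by n g X * g = g * X"
proof -
  note a = SL_adj[OF g]
  have "g * X * adj_mat g * g = g * X * (adj_mat g * g)"
    by (rule assoc_mult_mat[OF mult_carrier_mat[OF a(1) X] a(2,1)])
  also have "\<dots> = g * X" unfolding a(4) by (rule right_mult_one_mat[OF mult_carrier_mat[OF a(1) X]])
  finally show ?thesis by (simp add: conj_by_adj[OF g])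
qed

lemma conj_by_conj_by:
  assumes g: "g \<in> carrier (SL n)" and h: "h \<in> carrier (SL n)" and X: "X \<in> carrier_mat n n"
  shows "conj_by n g (conj_by n h X) = conj_by n (g * h) X"
proof (rule conj_by_eqI(1))
  note ga = SL_adj(1)[OF g] SL_adj(1)[OF h]
  note hX = conj_by_carrier[OF h X] and ghX = conj_by_carrier[OF g conj_by_carrier[OF h X]]
  show "g * h \<in> carrier (SL n)" using g h by (auto simp: SL_carrier det_mult)
  show "conj_by n g (conj_by n h X) \<in> carrier_mat n n" by (rule ghX)
  have "conj_by n g (conj_by n h X) * (g * h) = conj_by n g (conj_by n h X) * g * h"
    by (rule assoc_mult_mat[symmetric, OF ghX ga])
  also have "\<dots> = g * conj_by n h X * h" by (simp add: conj_by_mult_eq[OF g hX])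
  also have "\<dots> = g * (conj_by n h X * h)" by (rule assoc_mult_mat[OF ga(1) hX ga(2)])
  also have "\<dots> = g * (h * X)" by (simp add: conj_by_mult_eq[OF h X])
  also have "\<dots> = g * h * X" by (rule assoc_mult_mat[symmetric, OF ga X])
  finally show "conj_by n g (conj_by n h X) * (g * h) = g * h * X" .
qed (rule X)

lemma conj_by_one: "X \<in> carrier_mat n n \<Longrightarrow> conj_by n (1\<^sub>m n) X = X"
  by (rule conj_by_eqI(1)[symmetric]) (simp_all add: SL_carrier)

lemma conj_by_adj_inverse:
  assumes g: "g \<in> carrier (SL n)" and X: "X \<in> carrier_mat n n"
  shows "conj_by n (adj_mat g) (conj_by n g X) = X" "conj_by n g (conj_by n (adj_mat g) X) = X"
  using conj_by_conj_by[OF SL_adj(5)[OF g] g X] conj_by_conj_by[OF g SL_adj(5)[OF g] X]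
  by (simp_all add: SL_adj[OF g] conj_by_one[OF X])

section \<open>Block upper triangular groups and their nilradicals\<close>

definition par :: "nat \<Rightarrow> (nat \<Rightarrow> nat) \<Rightarrow> complex mat set" where
  "par n \<beta> = {g \<in> carrier (SL n). \<forall>i<n. \<forall>j<n. \<beta> j < \<beta> i \<longrightarrow> g $$ (i, j) = 0}"

text \<open>Here \<beta> gives each coordinate the number of its block. The identity yields the
  Borel subgroup and \<open>nilradical n\<close>; the parabolic groups of the statement belong to
  the function \<open>blk\<close> defined later.\<close>

definition rad :: "nat \<Rightarrow> (nat \<Rightarrow> nat) \<Rightarrow> complex mat set" where
  "rad n \<beta> = {X \<in> carrier_mat n n. \<forall>i<n. \<forall>j<n. \<beta> j \<le> \<beta> i \<longrightarrow> X $$ (i, j) = 0}"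

lemma par_SL: "g \<in> par n \<beta> \<Longrightarrow> g \<in> carrier (SL n)" by (simp add: par_def)

lemma par_carrier: "g \<in> par n \<beta> \<Longrightarrow> g \<in> carrier_mat n n" by (simp add: par_def SL_carrier)

lemma rad_carrier: "X \<in> rad n \<beta> \<Longrightarrow> X \<in> carrier_mat n n" by (simp add: rad_def)

lemma nilradical_rad: "nilradical n = rad n (\<lambda>i. i)"
  by (auto simp: nilradical_def rad_def)

lemma par_one: "1\<^sub>m n \<in> par n \<beta>"
  by (auto simp: par_def SL_carrier)

lemma par_mult:
  assumes g: "g \<in> par n \<beta>" and h: "h \<in> par n \<beta>" shows "g * h \<in> par n \<beta>"
  unfolding par_def
proof (intro CollectI conjI allI impI)
  show "g * h \<in> carrier (SL n)" using par_SL[OF g] par_SL[OF h] by (auto simp: SL_carrier det_mult)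
  fix i j assume ij: "i < n" "j < n" "\<beta> j < \<beta> i"
  have "(g * h) $$ (i, j) = (\<Sum>k<n. g $$ (i, k) * h $$ (k, j))"
    by (rule index_mult_sum[OF par_carrier[OF g] par_carrier[OF h] ij(1,2)])
  also have "\<dots> = 0"
  proof (rule sum.neutral, rule ballI)
    fix k assume "k \<in> {..<n}"
    then show "g $$ (i, k) * h $$ (k, j) = 0"
      using g h ij by (cases "\<beta> k < \<beta> i") (auto simp: par_def)
  qed
  finally show "(g * h) $$ (i, j) = 0" .
qed

text \<open>An element of \<open>par\<close> maps the coordinate space of the blocks up to that of b
  injectively into itself, hence onto itself. So the preimage of the basis vector b, which is column
  b of the inverse, lies in that space.\<close>

lemma par_adj:
  assumes g: "g \<in> par n \<beta>" shows "adj_mat g \<in> par n \<beta>"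
  unfolding par_def
proof (intro CollectI conjI allI impI SL_adj(5) par_SL[OF g])
  note a = SL_adj[OF par_SL[OF g]]
  let ?h = "adj_mat g"
  fix a b assume ab: "a < n" "b < n" "\<beta> b < \<beta> a"
  define J where "J = {j. j < n \<and> \<beta> j \<le> \<beta> b}"
  have J: "finite J" "b \<in> J" "a \<notin> J" using ab by (auto simp: J_def)
  \<comment> \<open>The unknowns \<open>Some j\<close> are the coordinates of a vector v in that
    space, and \<open>None\<close> is the coefficient d in g v + d e_b = 0. This makes one unknown
    more than there are equations.\<close>
  define A where "A i j = (case j of None \<Rightarrow> (if i = b then 1 else 0) | Some j \<Rightarrow> g $$ (i, j))" for i j
  have "card J < card (insert None (Some ` J))" using J by (simp add: card_image)
  from exists_nontrivial_solution[OF J(1) _ this, of A] J(1) obtain c where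
    c: "\<exists>j\<in>insert None (Some ` J). c j \<noteq> 0" and
    c0: "\<forall>i\<in>J. (\<Sum>j\<in>insert None (Some ` J). A i j * c j) = 0" by auto
  define v where "v = vec n (\<lambda>j. if j \<in> J then c (Some j) else 0)"
  define d where "d = c None"
  have v: "v \<in> carrier_vec n" by (simp add: v_def)
  have gv: "g *\<^sub>v v = (- d) \<cdot>\<^sub>v unit_vec n b"
  proof (rule eq_vecI)
    fix i assume "i < dim_vec ((- d) \<cdot>\<^sub>v unit_vec n b)"
    then have i: "i < n" by simp
    have sub: "(\<Sum>k<n. g $$ (i, k) * v $ k) = (\<Sum>j\<in>J. g $$ (i, j) * c (Some j))"
      by (rule sum.mono_neutral_cong_right) (auto simp: J_def v_def)
    show "(g *\<^sub>v v) $ i = ((- d) \<cdot>\<^sub>v unit_vec n b) $ i"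
    proof (cases "i \<in> J")
      case True
      have "(\<Sum>j\<in>J. g $$ (i, j) * c (Some j)) + (if i = b then d else 0) = 0"
        using c0[rule_format, OF True] J(1) by (auto simp: A_def d_def sum.reindex add.commute)
      then show ?thesis using i ab unfolding index_mult_vec_sum[OF a(1) v i] sub
        by (auto simp: add_eq_0_iff)
    next
      case False
      then have "(\<Sum>j\<in>J. g $$ (i, j) * c (Some j)) = 0"
        using g i by (intro sum.neutral) (auto simp: J_def par_def)
      moreover have "i \<noteq> b" using False J by auto
      ultimately show ?thesis using i ab unfolding index_mult_vec_sum[OF a(1) v i] sub by simp
    qed
  qed (use a in simp)
  have "v = (?h * g) *\<^sub>v v" using v a by simp
  also have "\<dots> = ?h *\<^sub>v (g *\<^sub>v v)" by (rule assoc_mult_mat_vec[OF a(2,1) v])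
  also have "\<dots> = (- d) \<cdot>\<^sub>v (?h *\<^sub>v unit_vec n b)"
    unfolding gv by (rule mult_mat_vec[OF a(2)]) simp
  finally have vh: "v = (- d) \<cdot>\<^sub>v (?h *\<^sub>v unit_vec n b)" .
  have "(?h *\<^sub>v unit_vec n b) $ a = ?h $$ (a, b)"
    using ab a by (simp add: index_mult_vec_sum[OF a(2)] if_distrib cong: if_cong)
  moreover have "v $ a = 0" using ab J by (simp add: v_def)
  ultimately have "d * ?h $$ (a, b) = 0"
    using arg_cong[OF vh, of "\<lambda>v. v $ a"] ab a by simp
  moreover have "d \<noteq> 0"
  proof
    assume "d = 0"
    then have "v = 0\<^sub>v n" using vh a by (auto intro!: eq_vecI)
    then have "\<forall>j\<in>J. c (Some j) = 0" by (auto simp: v_def J_def vec_eq_iff)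
    then show False using c \<open>d = 0\<close> by (auto simp: d_def)
  qed
  ultimately show "?h $$ (a, b) = 0" by simp
qed

lemma rad_mult_left:
  assumes g: "g \<in> par n \<beta>" and X: "X \<in> rad n \<beta>" shows "g * X \<in> rad n \<beta>"
  unfolding rad_def
proof (intro CollectI conjI allI impI mult_carrier_mat[OF par_carrier[OF g] rad_carrier[OF X]])
  fix i j assume ij: "i < n" "j < n" "\<beta> j \<le> \<beta> i"
  have "(g * X) $$ (i, j) = (\<Sum>k<n. g $$ (i, k) * X $$ (k, j))"
    by (rule index_mult_sum[OF par_carrier[OF g] rad_carrier[OF X] ij(1,2)])
  also have "\<dots> = 0"
  proof (rule sum.neutral, rule ballI)
    fix k assume "k \<in> {..<n}"
    then show "g $$ (i, k) * X $$ (k, j) = 0"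
      using g X ij by (cases "\<beta> k < \<beta> i") (auto simp: par_def rad_def)
  qed
  finally show "(g * X) $$ (i, j) = 0" .
qed

lemma rad_mult_right:
  assumes g: "g \<in> par n \<beta>" and X: "X \<in> rad n \<beta>" shows "X * g \<in> rad n \<beta>"
  unfolding rad_def
proof (intro CollectI conjI allI impI mult_carrier_mat[OF rad_carrier[OF X] par_carrier[OF g]])
  fix i j assume ij: "i < n" "j < n" "\<beta> j \<le> \<beta> i"
  have "(X * g) $$ (i, j) = (\<Sum>k<n. X $$ (i, k) * g $$ (k, j))"
    by (rule index_mult_sum[OF rad_carrier[OF X] par_carrier[OF g] ij(1,2)])
  also have "\<dots> = 0"
  proof (rule sum.neutral, rule ballI)
    fix k assume "k \<in> {..<n}"
    then show "X $$ (i, k) * g $$ (k, j) = 0"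
      using g X ij by (cases "\<beta> j < \<beta> k") (auto simp: par_def rad_def)
  qed
  finally show "(X * g) $$ (i, j) = 0" .
qed

lemma rad_conj_by: "g \<in> par n \<beta> \<Longrightarrow> X \<in> rad n \<beta> \<Longrightarrow> conj_by n g X \<in> rad n \<beta>"
  by (simp add: conj_by_adj[OF par_SL] rad_mult_left rad_mult_right par_adj)

lemma subgroup_par: "subgroup (par n \<beta>) (SL n)"
  by (rule group.subgroupI[OF group_SL])
    (auto simp: par_SL par_mult SL_inv[OF par_SL] par_adj intro: par_one)

lemma closedin_entries_eq:
  assumes "\<And>i j. (i, j) \<in> A \<Longrightarrow> i < n \<and> j < n"
  shows "closedin (zariski n) {X \<in> carrier_mat n n. \<forall>(i, j)\<in>A. X $$ (i, j) = c i j}"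
proof -
  have "{X \<in> carrier_mat n n. \<forall>(i, j)\<in>A. X $$ (i, j) = c i j} =
    zero_locus n ((\<lambda>(i, j) X. X $$ (i, j) - c i j) ` A)"
    by (auto simp: zero_locus_def)
  also have "closedin (zariski n) \<dots>"
    using assms by (intro zero_locus_pfun_closedin) (auto intro!: pfun_diff pfun_coord pfun_const)
  finally show ?thesis .
qed

lemma closedin_SL: "closedin (zariski n) (carrier (SL n))"
proof -
  have "carrier (SL n) = zero_locus n {\<lambda>X. det X - 1}" by (auto simp: zero_locus_def SL_carrier)
  also have "closedin (zariski n) \<dots>"
    by (intro zero_locus_pfun_closedin) (auto intro!: pfun_diff pfun_const pfun_det pfun_coord)
  finally show ?thesis .
qed

lemma closedin_rad: "closedin (zariski n) (rad n \<beta>)"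
proof -
  have "rad n \<beta> = {X \<in> carrier_mat n n. \<forall>(i, j)\<in>{(i, j). i < n \<and> j < n \<and> \<beta> j \<le> \<beta> i}. X $$ (i, j) = 0}"
    by (auto simp: rad_def)
  then show ?thesis using closedin_entries_eq[of "{(i, j). i < n \<and> j < n \<and> \<beta> j \<le> \<beta> i}" n "\<lambda>_ _. 0"] by auto
qed

lemma closedin_par: "closedin (zariski n) (par n \<beta>)"
proof -
  have "par n \<beta> = carrier (SL n) \<inter>
      {X \<in> carrier_mat n n. \<forall>(i, j)\<in>{(i, j). i < n \<and> j < n \<and> \<beta> j < \<beta> i}. X $$ (i, j) = 0}"
    by (auto simp: par_def SL_carrier)
  then show ?thesis
    using closedin_entries_eq[of "{(i, j). i < n \<and> j < n \<and> \<beta> j < \<beta> i}" n "\<lambda>_ _. 0"] closedin_SL by auto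
qed

lemma borel_group_par: "borel_group n = par n (\<lambda>i. i)"
  by (auto simp: borel_group_def par_def SL_carrier upper_triangular_def)

lemma rad_mono_id:
  assumes "mono \<beta>" "X \<in> rad n \<beta>" shows "X \<in> rad n (\<lambda>i. i)"
  using assms by (auto simp: rad_def dest: monoD)

lemma par_mono_id:
  assumes "mono \<beta>" "g \<in> par n (\<lambda>i. i)" shows "g \<in> par n \<beta>"
  using assms unfolding par_def mono_def by (auto simp: not_le) (meson leD not_le_imp_less)

lemma rad_pow_entry:
  assumes X: "X \<in> rad n (\<lambda>i. i)" and ij: "i < n" "j < n" "j < i + k"
  shows "(X ^\<^sub>m k) $$ (i, j) = 0"
  using ij
proof (induction k arbitrary: j)
  case 0
  then show ?case using rad_carrier[OF X] by auto
next
  case (Suc k)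
  have "(X ^\<^sub>m k * X) $$ (i, j) = (\<Sum>l<n. (X ^\<^sub>m k) $$ (i, l) * X $$ (l, j))"
    by (rule index_mult_sum[OF pow_carrier_mat[OF rad_carrier[OF X]] rad_carrier[OF X] Suc.prems(1,2)])
  also have "\<dots> = 0"
  proof (rule sum.neutral, rule ballI)
    fix l assume l: "l \<in> {..<n}"
    show "(X ^\<^sub>m k) $$ (i, l) * X $$ (l, j) = 0"
    proof (cases "l < i + k")
      case True
      then show ?thesis using Suc.IH[of l] Suc.prems l by simp
    next
      case False
      then show ?thesis using X Suc.prems l by (simp add: rad_def)
    qed
  qed
  finally show ?case by simp
qed

lemma rad_pow_n: "X \<in> rad n (\<lambda>i. i) \<Longrightarrow> X ^\<^sub>m n = 0\<^sub>m n n"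
  using rad_pow_entry[of X n _ _ n] rad_carrier[of X n "\<lambda>i. i"] by (auto intro!: eq_matI)

section \<open>Normal form of a strictly upper triangular matrix\<close>

text \<open>The kernels of the powers of \<open>N\<close> are spanned by standard basis vectors, the
  \<open>j\<close>-th one appearing first in the kernel of the \<open>\<kappa> j\<close>-th power.\<close>

definition ker_pattern :: "nat \<Rightarrow> (nat \<Rightarrow> nat) \<Rightarrow> complex mat \<Rightarrow> bool" where
  "ker_pattern n \<kappa> N \<longleftrightarrow> N \<in> carrier_mat n n \<and>
     (\<forall>k. \<forall>v\<in>carrier_vec n. (N ^\<^sub>m k) *\<^sub>v v = 0\<^sub>v n \<longleftrightarrow> (\<forall>j<n. k < \<kappa> j \<longrightarrow> v $ j = 0))"

lemma ker_pattern_carrier: "ker_pattern n \<kappa> N \<Longrightarrow> N \<in> carrier_mat n n"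
  by (simp add: ker_pattern_def)

lemma ker_patternD:
  "ker_pattern n \<kappa> N \<Longrightarrow> v \<in> carrier_vec n \<Longrightarrow> (N ^\<^sub>m k) *\<^sub>v v = 0\<^sub>v n \<longleftrightarrow> (\<forall>j<n. k < \<kappa> j \<longrightarrow> v $ j = 0)"
  by (simp add: ker_pattern_def)

lemma ker_pattern_pos:
  assumes "ker_pattern n \<kappa> N" "j < n" shows "0 < \<kappa> j"
proof (rule ccontr)
  assume "\<not> 0 < \<kappa> j"
  then have "(N ^\<^sub>m 0) *\<^sub>v unit_vec n j = 0\<^sub>v n"
    using assms(2) by (subst ker_patternD[OF assms(1)]) auto
  then have "unit_vec n j = (0\<^sub>v n :: complex vec)" using ker_pattern_carrier[OF assms(1)] by simp
  then have "unit_vec n j $ j = (0\<^sub>v n :: complex vec) $ j" by simp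
  then show False using assms by simp
qed

text \<open>The basis vector j lies in the kernel of the power \<open>\<kappa> j\<close>, so its
  image, which is column j of N, lies in the kernel of the preceding power, whose vectors are
  supported on smaller colours.\<close>

lemma ker_pattern_entry:
  assumes N: "ker_pattern n \<kappa> N" and ij: "i < n" "j < n" "N $$ (i, j) \<noteq> 0" shows "\<kappa> i < \<kappa> j"
proof -
  note c = ker_pattern_carrier[OF N]
  obtain m where m: "\<kappa> j = Suc m" using ker_pattern_pos[OF N ij(2)] by (cases "\<kappa> j") auto
  have "(N ^\<^sub>m Suc m) *\<^sub>v unit_vec n j = 0\<^sub>v n"
    using m ij(2) by (subst ker_patternD[OF N]) auto
  moreover have "(N ^\<^sub>m m * N) *\<^sub>v unit_vec n j = N ^\<^sub>m m *\<^sub>v (N *\<^sub>v unit_vec n j)"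
    by (rule assoc_mult_mat_vec[OF pow_carrier_mat[OF c] c]) simp
  ultimately have "N ^\<^sub>m m *\<^sub>v (N *\<^sub>v unit_vec n j) = 0\<^sub>v n" by simp
  then have *: "m < \<kappa> i \<longrightarrow> (N *\<^sub>v unit_vec n j) $ i = 0"
    using ker_patternD[OF N, of "N *\<^sub>v unit_vec n j" m] c ij by auto
  have "(N *\<^sub>v unit_vec n j) $ i = N $$ (i, j)"
    using ij c by (simp add: index_mult_vec_sum[OF c] if_distrib cong: if_cong)
  then show ?thesis using * ij m by auto
qed

lemma ker_pattern_le:
  assumes N: "ker_pattern n \<kappa> N" and nil: "N ^\<^sub>m n = 0\<^sub>m n n" and j: "j < n" shows "\<kappa> j \<le> n"
proof (rule ccontr)
  assume "\<not> \<kappa> j \<le> n"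
  moreover have "(N ^\<^sub>m n) *\<^sub>v unit_vec n j = 0\<^sub>v n" unfolding nil by (auto intro!: eq_vecI)
  ultimately have "unit_vec n j $ j = (0 :: complex)"
    using ker_patternD[OF N, of "unit_vec n j" n] j by auto
  then show False using j by simp
qed

lemma mult_mat_vec_zero:
  fixes A :: "complex mat"
  assumes A: "A \<in> carrier_mat n m" shows "A *\<^sub>v 0\<^sub>v m = 0\<^sub>v n"
proof (rule eq_vecI)
  fix i assume "i < dim_vec (0\<^sub>v n :: complex vec)"
  then show "(A *\<^sub>v 0\<^sub>v m) $ i = 0\<^sub>v n $ i" by (simp add: index_mult_vec_sum[OF A] del: index_mult_mat_vec)
qed (use A in simp)

lemma pow_kernel_mono:
  fixes Y :: "complex mat"
  assumes Y: "Y \<in> carrier_mat n n" and v: "v \<in> carrier_vec n" and "k \<le> l" "(Y ^\<^sub>m k) *\<^sub>v v = 0\<^sub>v n"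
  shows "(Y ^\<^sub>m l) *\<^sub>v v = 0\<^sub>v n"
proof -
  have "Y ^\<^sub>m l = Y ^\<^sub>m (l - k) * Y ^\<^sub>m k" using pow_mat_add[OF Y, of "l - k" k] assms(3) by simp
  then have "(Y ^\<^sub>m l) *\<^sub>v v = Y ^\<^sub>m (l - k) *\<^sub>v (Y ^\<^sub>m k *\<^sub>v v)"
    using assoc_mult_mat_vec[OF pow_carrier_mat[OF Y] pow_carrier_mat[OF Y] v] by simp
  also have "\<dots> = 0\<^sub>v n" unfolding assms(4) by (rule mult_mat_vec_zero[OF pow_carrier_mat[OF Y]])
  finally show ?thesis .
qed

lemma mult_mat_vec_diff_smult:
  fixes A :: "complex mat"
  assumes "A \<in> carrier_mat n n" "v \<in> carrier_vec n" "w \<in> carrier_vec n"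
  shows "A *\<^sub>v (v + c \<cdot>\<^sub>v w) = A *\<^sub>v v + c \<cdot>\<^sub>v (A *\<^sub>v w)"
  using assms by (simp add: mult_add_distrib_mat_vec[of _ n n] mult_mat_vec[of _ n n])

lemma intertwine_pow:
  fixes b :: "complex mat"
  assumes c: "Y \<in> carrier_mat n n" "b \<in> carrier_mat n n" "N \<in> carrier_mat n n" and eq: "Y * b = b * N"
  shows "Y ^\<^sub>m k * b = b * N ^\<^sub>m k"
proof (induction k)
  case 0
  then show ?case using c by simp
next
  case (Suc k)
  note p = pow_carrier_mat[OF c(1), of k] pow_carrier_mat[OF c(3), of k]
  have "Y ^\<^sub>m k * Y * b = Y ^\<^sub>m k * (Y * b)" by (rule assoc_mult_mat[OF p(1) c(1,2)])
  also have "\<dots> = Y ^\<^sub>m k * b * N" unfolding eq by (rule assoc_mult_mat[symmetric, OF p(1) c(2,3)])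
  also have "\<dots> = b * (N ^\<^sub>m k * N)" unfolding Suc by (rule assoc_mult_mat[OF c(2) p(2) c(3)])
  finally show ?case by simp
qed

lemma invertible_mult_vec_zero:
  fixes b :: "complex mat"
  assumes "b \<in> carrier_mat n n" "det b \<noteq> 0" "v \<in> carrier_vec n" "b *\<^sub>v v = 0\<^sub>v n" shows "v = 0\<^sub>v n"
  using det_0_iff_vec_prod_zero_field[OF assms(1)] assms by auto

lemma intertwine_kernel:
  fixes b :: "complex mat"
  assumes c: "Y \<in> carrier_mat n n" "b \<in> carrier_mat n n" "N \<in> carrier_mat n n" and eq: "Y * b = b * N"
    and det: "det b \<noteq> 0" and v: "v \<in> carrier_vec n"
  shows "(N ^\<^sub>m k) *\<^sub>v v = 0\<^sub>v n \<longleftrightarrow> (Y ^\<^sub>m k) *\<^sub>v (b *\<^sub>v v) = 0\<^sub>v n"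
proof -
  note p = pow_carrier_mat[OF c(1), of k] pow_carrier_mat[OF c(3), of k]
  have "Y ^\<^sub>m k *\<^sub>v (b *\<^sub>v v) = (Y ^\<^sub>m k * b) *\<^sub>v v" by (rule assoc_mult_mat_vec[symmetric, OF p(1) c(2) v])
  also have "\<dots> = b *\<^sub>v (N ^\<^sub>m k *\<^sub>v v)"
    unfolding intertwine_pow[OF c eq] by (rule assoc_mult_mat_vec[OF c(2) p(2) v])
  finally have *: "Y ^\<^sub>m k *\<^sub>v (b *\<^sub>v v) = b *\<^sub>v (N ^\<^sub>m k *\<^sub>v v)" .
  have "b *\<^sub>v 0\<^sub>v n = 0\<^sub>v n" using c by (auto intro!: eq_vecI)
  then show ?thesis unfolding *
    using invertible_mult_vec_zero[OF c(2) det mult_mat_vec_carrier[OF p(2) v]] by auto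
qed

text \<open>A reduced echelon form for all kernels at once. Call the last nonzero position of a
  vector its pivot; \<open>\<kappa> j\<close> is the first power whose kernel contains a vector with
  pivot j. Column j of \<open>b\<close> is such a vector, normalized and cleared at the positions i
  < j with \<open>\<kappa> i \<le> \<kappa> j\<close>. Comparing pivots shows that the columns with
  \<open>\<kappa> j \<le> k\<close> span the kernel of the k-th power.\<close>

lemma adapted_basis_exists:
  fixes Y :: "complex mat"
  assumes Y: "Y \<in> rad n (\<lambda>i. i)"
  obtains \<kappa> b where "b \<in> carrier_mat n n" "\<forall>i<n. b $$ (i, i) = 1"
    "\<forall>i<n. \<forall>j<n. i \<noteq> j \<longrightarrow> b $$ (i, j) \<noteq> 0 \<longrightarrow> i < j \<and> \<kappa> j < \<kappa> i"
    "\<forall>k. \<forall>v\<in>carrier_vec n. (Y ^\<^sub>m k) *\<^sub>v (b *\<^sub>v v) = 0\<^sub>v n \<longleftrightarrow> (\<forall>j<n. k < \<kappa> j \<longrightarrow> v $ j = 0)"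
proof -
  note Yc = rad_carrier[OF Y]
  define P where "P j k \<longleftrightarrow> (\<exists>v\<in>carrier_vec n. (Y ^\<^sub>m k) *\<^sub>v v = 0\<^sub>v n \<and> v $ j = 1 \<and> (\<forall>i<n. j < i \<longrightarrow> v $ i = 0))" for j k
  define \<kappa> where "\<kappa> j = (LEAST k. P j k)" for j
  have Pn: "P j n" if "j < n" for j
    unfolding P_def using that rad_pow_n[OF Y]
    by (intro bexI[of _ "unit_vec n j"]) (auto intro!: eq_vecI)
  have P\<kappa>: "P j (\<kappa> j)" if "j < n" for j unfolding \<kappa>_def using Pn[OF that] by (rule LeastI)
  have \<kappa>_le: "\<kappa> j \<le> k" if "P j k" for j k unfolding \<kappa>_def using that by (rule Least_le)
  \<comment> \<open>Clearing proceeds downwards from position j - 1: a kernel vector with pivot m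
    vanishes beyond m, so subtracting a multiple of it destroys no zero obtained before, and for
    \<open>\<kappa> m \<le> \<kappa> j\<close> the result stays in the kernel.\<close>
  have red: "\<exists>v\<in>carrier_vec n. (Y ^\<^sub>m \<kappa> j) *\<^sub>v v = 0\<^sub>v n \<and> v $ j = 1 \<and> (\<forall>i<n. j < i \<longrightarrow> v $ i = 0) \<and>
      (\<forall>i. m \<le> i \<longrightarrow> i < j \<longrightarrow> \<kappa> i \<le> \<kappa> j \<longrightarrow> v $ i = 0)" if j: "j < n" and "m \<le> j" for j m
    using that(2)
  proof (induction rule: inc_induct)
    case base
    then show ?case using P\<kappa>[OF j] unfolding P_def by (auto intro!: bexI)
  next
    case (step m)
    then obtain v where v: "v \<in> carrier_vec n" "(Y ^\<^sub>m \<kappa> j) *\<^sub>v v = 0\<^sub>v n" "v $ j = 1" "\<forall>i<n. j < i \<longrightarrow> v $ i = 0"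
      "\<forall>i. Suc m \<le> i \<longrightarrow> i < j \<longrightarrow> \<kappa> i \<le> \<kappa> j \<longrightarrow> v $ i = 0" by auto
    have m: "m < n" using step j by simp
    show ?case
    proof (cases "\<kappa> m \<le> \<kappa> j")
      case False
      have "v $ i = 0" if "m \<le> i" "i < j" "\<kappa> i \<le> \<kappa> j" for i
        using v(5) that False by (cases "i = m") auto
      then show ?thesis using v by (intro bexI[of _ v]) auto
    next
      case True
      obtain w where w: "w \<in> carrier_vec n" "(Y ^\<^sub>m \<kappa> m) *\<^sub>v w = 0\<^sub>v n" "w $ m = 1" "\<forall>i<n. m < i \<longrightarrow> w $ i = 0"
        using P\<kappa>[OF m] unfolding P_def by auto
      note wj = pow_kernel_mono[OF Yc w(1) True w(2)]
      define u where "u = v + (- (v $ m)) \<cdot>\<^sub>v w"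
      have u: "u \<in> carrier_vec n" using v w by (simp add: u_def)
      have ui: "u $ i = v $ i - v $ m * w $ i" if "i < n" for i using that v w by (simp add: u_def)
      have "(Y ^\<^sub>m \<kappa> j) *\<^sub>v u = 0\<^sub>v n"
        unfolding u_def mult_mat_vec_diff_smult[OF pow_carrier_mat[OF Yc] v(1) w(1)] v(2) wj by auto
      moreover have "u $ j = 1" using ui[OF j] v w step j by auto
      moreover have "\<forall>i<n. j < i \<longrightarrow> u $ i = 0" using ui v w step by auto
      moreover have "u $ i = 0" if "m \<le> i" "i < j" "\<kappa> i \<le> \<kappa> j" for i
      proof (cases "i = m")
        case True
        then show ?thesis using ui[OF m] w by simp
      next
        case False
        then show ?thesis using ui[of i] that v w j by auto
      qed
      ultimately show ?thesis using u by blast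
    qed
  qed
  have "\<forall>j\<in>{..<n}. \<exists>v. v \<in> carrier_vec n \<and> (Y ^\<^sub>m \<kappa> j) *\<^sub>v v = 0\<^sub>v n \<and> v $ j = 1 \<and> (\<forall>i<n. j < i \<longrightarrow> v $ i = 0) \<and>
      (\<forall>i. 0 \<le> i \<longrightarrow> i < j \<longrightarrow> \<kappa> i \<le> \<kappa> j \<longrightarrow> v $ i = 0)"
    using red[of _ 0] by (simp add: Bex_def)
  from bchoice[OF this] obtain w where w_all:
    "\<forall>j\<in>{..<n}. w j \<in> carrier_vec n \<and> (Y ^\<^sub>m \<kappa> j) *\<^sub>v w j = 0\<^sub>v n \<and> w j $ j = 1 \<and> (\<forall>i<n. j < i \<longrightarrow> w j $ i = 0) \<and>
      (\<forall>i. 0 \<le> i \<longrightarrow> i < j \<longrightarrow> \<kappa> i \<le> \<kappa> j \<longrightarrow> w j $ i = 0)"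
    by (elim exE)
  then have
    w: "\<And>j. j < n \<Longrightarrow> w j \<in> carrier_vec n" "\<And>j. j < n \<Longrightarrow> (Y ^\<^sub>m \<kappa> j) *\<^sub>v w j = 0\<^sub>v n" "\<And>j. j < n \<Longrightarrow> w j $ j = 1"
      "\<And>i j. j < n \<Longrightarrow> i < n \<Longrightarrow> j < i \<Longrightarrow> w j $ i = 0"
      "\<And>i j. j < n \<Longrightarrow> i < j \<Longrightarrow> \<kappa> i \<le> \<kappa> j \<Longrightarrow> w j $ i = 0"
    by simp_all
  define b where "b = mat n n (\<lambda>(i, j). w j $ i)"
  have b: "b \<in> carrier_mat n n" by (simp add: b_def)
  have bij: "b $$ (i, j) = w j $ i" if "i < n" "j < n" for i j using that by (simp add: b_def)
  have zero: "(Y ^\<^sub>m k) *\<^sub>v (b *\<^sub>v v) = 0\<^sub>v n" if v: "v \<in> carrier_vec n" and z: "\<forall>j<n. k < \<kappa> j \<longrightarrow> v $ j = 0" for k v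
  proof -
    note p = pow_carrier_mat[OF Yc, of k]
    have col: "(Y ^\<^sub>m k * b) $$ (i, j) = 0" if i: "i < n" and j: "j < n" and "\<kappa> j \<le> k" for i j
    proof -
      have "(Y ^\<^sub>m k * b) $$ (i, j) = (\<Sum>l<n. (Y ^\<^sub>m k) $$ (i, l) * b $$ (l, j))"
        by (rule index_mult_sum[OF p b i j])
      also have "\<dots> = (Y ^\<^sub>m k *\<^sub>v w j) $ i"
        unfolding index_mult_vec_sum[OF p w(1)[OF j] i] by (rule sum.cong) (use bij j in auto)
      also have "\<dots> = 0" using pow_kernel_mono[OF Yc w(1)[OF j] that(3) w(2)[OF j]] i by simp
      finally show ?thesis .
    qed
    have "(Y ^\<^sub>m k) *\<^sub>v (b *\<^sub>v v) = (Y ^\<^sub>m k * b) *\<^sub>v v" by (rule assoc_mult_mat_vec[symmetric, OF p b v])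
    also have "\<dots> = 0\<^sub>v n"
    proof (rule eq_vecI)
      fix i assume "i < dim_vec (0\<^sub>v n :: complex vec)"
      then have i: "i < n" by simp
      have "((Y ^\<^sub>m k * b) *\<^sub>v v) $ i = (\<Sum>j<n. (Y ^\<^sub>m k * b) $$ (i, j) * v $ j)"
        by (rule index_mult_vec_sum[OF mult_carrier_mat[OF p b] v i])
      also have "\<dots> = 0"
      proof (rule sum.neutral, rule ballI)
        fix j assume "j \<in> {..<n}"
        then show "(Y ^\<^sub>m k * b) $$ (i, j) * v $ j = 0"
          using col[OF i, of j] z by (cases "\<kappa> j \<le> k") auto
      qed
      finally show "((Y ^\<^sub>m k * b) *\<^sub>v v) $ i = 0\<^sub>v n $ i" using i by simp
    qed (use Yc in simp)
    finally show ?thesis .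
  qed
  \<comment> \<open>Induction on a bound for the support of v. If its last possible entry
    \<open>v $ l\<close> is nonzero, then the image of v under b has pivot l, so
    \<open>\<kappa> l \<le> k\<close> by minimality and column l can be subtracted without leaving
    the kernel.\<close>
  have nonzero: "\<forall>j<n. k < \<kappa> j \<longrightarrow> v $ j = 0"
    if "v \<in> carrier_vec n" "\<forall>i<n. l \<le> i \<longrightarrow> v $ i = 0" "(Y ^\<^sub>m k) *\<^sub>v (b *\<^sub>v v) = 0\<^sub>v n" "l \<le> n" for k v l
    using that
  proof (induction l arbitrary: v)
    case 0
    then show ?case by auto
  next
    case (Suc l)
    have l: "l < n" using Suc.prems by simp
    note v = Suc.prems(1)
    show ?case
    proof (cases "v $ l = 0")
      case True
      have "\<forall>i<n. l \<le> i \<longrightarrow> v $ i = 0"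
      proof (intro allI impI)
        fix i assume "i < n" "l \<le> i"
        then show "v $ i = 0" using Suc.prems(2) True by (cases "i = l") auto
      qed
      then show ?thesis using Suc.IH[OF v] Suc.prems by auto
    next
      case False
      have bv: "b *\<^sub>v v \<in> carrier_vec n" using b v by simp
      have entry: "(b *\<^sub>v v) $ i = (\<Sum>j<n. w j $ i * v $ j)" if "i < n" for i
        unfolding index_mult_vec_sum[OF b v that] by (rule sum.cong) (use bij that in auto)
      have "(b *\<^sub>v v) $ l = (\<Sum>j<n. if j = l then v $ l else 0)"
        unfolding entry[OF l]
      proof (rule sum.cong)
        fix j assume "j \<in> {..<n}"
        then show "w j $ l * v $ j = (if j = l then v $ l else 0)"
          using w(3,4)[of j] l Suc.prems(2) by (cases j l rule: linorder_cases) auto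
      qed simp
      then have bvl: "(b *\<^sub>v v) $ l = v $ l" using l by simp
      have bvi: "(b *\<^sub>v v) $ i = 0" if i: "i < n" "l < i" for i
        unfolding entry[OF i(1)]
      proof (rule sum.neutral, rule ballI)
        fix j assume "j \<in> {..<n}"
        then show "w j $ i * v $ j = 0"
          using w(4)[of j i] i Suc.prems(2) by (cases "j \<le> l") auto
      qed
      have "P l k"
        unfolding P_def
      proof (intro bexI conjI allI impI)
        let ?u = "(1 / v $ l) \<cdot>\<^sub>v (b *\<^sub>v v)"
        show "?u \<in> carrier_vec n" using bv by simp
        show "Y ^\<^sub>m k *\<^sub>v ?u = 0\<^sub>v n"
          unfolding mult_mat_vec[OF pow_carrier_mat[OF Yc] bv] Suc.prems(3) by auto
        show "?u $ l = 1" using bvl False l b by (simp del: index_mult_mat_vec)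
        fix i assume "i < n" "l < i"
        then show "?u $ i = 0" using bvi b by (simp del: index_mult_mat_vec)
      qed
      then have \<kappa>l: "\<kappa> l \<le> k" by (rule \<kappa>_le)
      define u where "u = v + (- (v $ l)) \<cdot>\<^sub>v unit_vec n l"
      have u: "u \<in> carrier_vec n" using v by (simp add: u_def)
      have ui: "u $ i = (if i = l then 0 else v $ i)" if "i < n" for i using that v l by (auto simp: u_def)
      have "(Y ^\<^sub>m k) *\<^sub>v (b *\<^sub>v unit_vec n l) = 0\<^sub>v n" by (rule zero) (use \<kappa>l l in auto)
      then have "(Y ^\<^sub>m k) *\<^sub>v (b *\<^sub>v u) = 0\<^sub>v n"
        unfolding u_def mult_mat_vec_diff_smult[OF b v unit_vec_carrier]
        by (subst mult_mat_vec_diff_smult[OF pow_carrier_mat[OF Yc] bv]) (use b Suc.prems(3) in auto)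
      moreover have "\<forall>i<n. l \<le> i \<longrightarrow> u $ i = 0" using ui Suc.prems(2) by auto
      ultimately have "\<forall>j<n. k < \<kappa> j \<longrightarrow> u $ j = 0" using Suc.IH[OF u] l by auto
      then show ?thesis using ui \<kappa>l by (metis leD)
    qed
  qed
  show thesis
  proof (rule that[OF b]; intro allI ballI impI)
    show "b $$ (i, i) = 1" if "i < n" for i using w(3) bij that by simp
    show "i < j \<and> \<kappa> j < \<kappa> i" if "i < n" "j < n" "i \<noteq> j" "b $$ (i, j) \<noteq> 0" for i j
    proof -
      have "w j $ i \<noteq> 0" using that bij by simp
      then have "\<not> j < i" "i < j \<longrightarrow> \<not> \<kappa> i \<le> \<kappa> j" using w(4)[of j i] w(5)[of j i] that(1,2) by blast+
      then show ?thesis using that(3) by linarith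
    qed
    show "(Y ^\<^sub>m k) *\<^sub>v (b *\<^sub>v v) = 0\<^sub>v n \<longleftrightarrow> (\<forall>j<n. k < \<kappa> j \<longrightarrow> v $ j = 0)" if "v \<in> carrier_vec n" for k v
      using nonzero[OF that, of n k] zero[OF that, of k] by auto
  qed
qed

lemma unitriangular_det:
  fixes b :: "complex mat"
  assumes "b \<in> carrier_mat n n" "\<And>i. i < n \<Longrightarrow> b $$ (i, i) = 1"
    "\<And>i j. i < n \<Longrightarrow> j < i \<Longrightarrow> b $$ (i, j) = 0"
  shows "det b = 1"
proof -
  have "det b = prod_list (diag_mat b)"
    by (rule det_upper_triangular[OF _ assms(1)]) (use assms in \<open>auto simp: upper_triangular_def\<close>)
  also have "diag_mat b = map (\<lambda>_. 1) [0..<n]" unfolding diag_mat_def using assms by auto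
  finally show ?thesis by (simp add: map_replicate_const)
qed

lemma normal_form:
  assumes Y: "Y \<in> rad n (\<lambda>i. i)"
  obtains \<kappa> b N where "b \<in> par n (\<lambda>i. i)" "\<forall>i<n. b $$ (i, i) = 1"
    "\<forall>i<n. \<forall>j<n. i \<noteq> j \<longrightarrow> b $$ (i, j) \<noteq> 0 \<longrightarrow> i < j \<and> \<kappa> j < \<kappa> i"
    "ker_pattern n \<kappa> N" "N \<in> rad n (\<lambda>i. i)" "Y = conj_by n b N" "Y * b = b * N"
proof -
  note Yc = rad_carrier[OF Y]
  obtain \<kappa> b where b: "b \<in> carrier_mat n n" "\<forall>i<n. b $$ (i, i) = 1"
    "\<forall>i<n. \<forall>j<n. i \<noteq> j \<longrightarrow> b $$ (i, j) \<noteq> 0 \<longrightarrow> i < j \<and> \<kappa> j < \<kappa> i"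
    and ker: "\<forall>k. \<forall>v\<in>carrier_vec n. (Y ^\<^sub>m k) *\<^sub>v (b *\<^sub>v v) = 0\<^sub>v n \<longleftrightarrow> (\<forall>j<n. k < \<kappa> j \<longrightarrow> v $ j = 0)"
    by (rule adapted_basis_exists[OF Y])
  have upper: "b $$ (i, j) = 0" if "i < n" "j < i" for i j
    using b(3)[rule_format, of i j] that by fastforce
  have det: "det b = 1" using unitriangular_det[OF b(1)] b(2) upper by auto
  have bp: "b \<in> par n (\<lambda>i. i)" using b(1) det upper by (auto simp: par_def SL_carrier)
  define N where "N = adj_mat b * Y * b"
  have N: "N \<in> rad n (\<lambda>i. i)"
    unfolding N_def by (intro rad_mult_right rad_mult_left par_adj bp Y)
  note a = SL_adj[OF par_SL[OF bp]]
  have "b * N = b * (adj_mat b * (Y * b))"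
    unfolding N_def using a Yc by (simp add: assoc_mult_mat[of _ n n _ n _ n])
  also have "\<dots> = b * adj_mat b * (Y * b)"
    by (rule assoc_mult_mat[symmetric, OF a(1,2)]) (use a Yc in auto)
  also have "\<dots> = Y * b" unfolding a(3) by (rule left_mult_one_mat) (use a Yc in auto)
  finally have eq: "Y * b = b * N" by simp
  have "ker_pattern n \<kappa> N"
    unfolding ker_pattern_def
    using intertwine_kernel[OF Yc b(1) rad_carrier[OF N] eq] det ker rad_carrier[OF N] by auto
  then show thesis using that[OF bp b(2,3) _ N conj_by_eqI(1)[OF par_SL[OF bp] Yc rad_carrier[OF N] eq] eq] by auto
qed

section \<open>Sorting the colours inside blocks\<close>

lemma sort_within_blocks:
  fixes \<kappa> \<beta> :: "nat \<Rightarrow> nat"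
  assumes \<beta>: "mono \<beta>" and \<kappa>: "\<forall>j<n. \<kappa> j \<le> n"
  obtains \<sigma> where "bij_betw \<sigma> {..<n} {..<n}" "\<forall>i<n. \<beta> (\<sigma> i) = \<beta> i"
    "\<forall>i j. i < j \<longrightarrow> j < n \<longrightarrow> \<beta> i = \<beta> j \<longrightarrow> \<kappa> (\<sigma> j) \<le> \<kappa> (\<sigma> i)"
proof -
  \<comment> \<open>A lexicographic key: block first, then colour in decreasing order. Since n -
    \<kappa> x is at most n, division by n + 1 recovers the block.\<close>
  define key where "key x = \<beta> x * (n + 1) + (n - \<kappa> x)" for x
  define l where "l = sort_key key [0..<n]"
  have l: "set l = {..<n}" "distinct l" "length l = n" "mset l = mset [0..<n]" "sorted (map key l)"
    by (auto simp: l_def atLeast0LessThan)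
  have key_div: "key x div (n + 1) = \<beta> x" for x
    unfolding key_def by (subst div_mult_self3) (auto simp: div_less)
  have "sorted (map \<beta> l)"
  proof (rule sorted_iff_nth_mono_less[THEN iffD2], intro allI impI)
    fix i j assume ij: "i < j" "j < length (map \<beta> l)"
    then have "key (l ! i) \<le> key (l ! j)" using l(5) by (simp add: sorted_iff_nth_mono_less)
    from div_le_mono[OF this, of "n + 1"] show "map \<beta> l ! i \<le> map \<beta> l ! j" using ij by (simp add: key_div del: One_nat_def add_Suc_right)
  qed
  moreover have "sorted (map \<beta> [0..<n])"
    using \<beta> by (simp add: sorted_iff_nth_mono_less mono_def)
  moreover have "mset (map \<beta> l) = mset (map \<beta> [0..<n])" using l(4) by (metis mset_map)
  \<comment> \<open>A sorted list is determined by its multiset, and \<beta> is already sorted; so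
    sorting changes no block number.\<close>
  ultimately have eq: "map \<beta> l = map \<beta> [0..<n]" by (metis properties_for_sort)
  have blk: "\<beta> (l ! i) = \<beta> i" if "i < n" for i
    using arg_cong[OF eq, of "\<lambda>xs. xs ! i"] that l(3) by simp
  show thesis
  proof (rule that[of "\<lambda>i. l ! i"]; (intro allI impI)?)
    show "bij_betw ((!) l) {..<n} {..<n}" using bij_betw_nth[OF l(2)] l(1,3) by auto
    show "\<beta> (l ! i) = \<beta> i" if "i < n" for i by (rule blk[OF that])
    fix i j assume ij: "i < j" "j < n" "\<beta> i = \<beta> j"
    then have "key (l ! i) \<le> key (l ! j)" using l(3,5) by (simp add: sorted_iff_nth_mono_less)
    then have "n - \<kappa> (l ! i) \<le> n - \<kappa> (l ! j)" using blk[of i] blk[of j] ij by (simp add: key_def)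
    moreover have "l ! i < n" "l ! j < n" using l(1,3) ij by (metis lessThan_iff nth_mem order.strict_trans)+
    then have "\<kappa> (l ! i) \<le> n" "\<kappa> (l ! j) \<le> n" using \<kappa> by auto
    ultimately show "\<kappa> (l ! j) \<le> \<kappa> (l ! i)" by linarith
  qed
qed

lemma complex_root_exists:
  assumes "n \<ge> 1" "d \<noteq> (0 :: complex)" shows "\<exists>c. c ^ n * d = 1"
proof -
  define r where "r = cmod (inverse d)"
  have "r \<ge> 0" by (simp add: r_def)
  have "rcis (root n r) (Arg (inverse d) / n) ^ n = rcis r (Arg (inverse d))"
    using assms(1) \<open>r \<ge> 0\<close> by (simp add: DeMoivre2 real_root_pow_pos2)
  also have "\<dots> = inverse d" by (simp add: r_def rcis_cmod_Arg)
  finally show ?thesis using assms(2) by (metis left_inverse)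
qed

text \<open>Scalars do not affect conjugation, so this turns conjugation by an invertible matrix
  into conjugation by an element of SL_n.\<close>

lemma scale_to_det_one:
  fixes g :: "complex mat"
  assumes "n \<ge> 1" "g \<in> carrier_mat n n" "det g \<noteq> 0"
  obtains c where "det (c \<cdot>\<^sub>m g) = 1"
  using complex_root_exists[OF assms(1,3)] assms(2) that by auto

lemma intertwine_smult:
  fixes g :: "complex mat"
  assumes "X \<in> carrier_mat n n" "N \<in> carrier_mat n n" "g \<in> carrier_mat n n" "X * g = g * N"
  shows "X * (c \<cdot>\<^sub>m g) = (c \<cdot>\<^sub>m g) * N"
  using assms by (simp add: mult_smult_distrib[of _ n n _ n] mult_smult_assoc_mat[of _ n n _ n])

lemma permute_ker_pattern:
  assumes N: "ker_pattern n \<kappa> N" and \<sigma>: "bij_betw \<sigma> {..<n} {..<n}"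
  obtains P N' where "P = mat n n (\<lambda>(i, j). if i = \<sigma> j then 1 else (0 :: complex))" "det P \<noteq> 0"
    "ker_pattern n (\<lambda>j. \<kappa> (\<sigma> j)) N'" "N * P = P * N'" "N' = mat n n (\<lambda>(i, j). N $$ (\<sigma> i, \<sigma> j))"
proof -
  define P where "P = mat n n (\<lambda>(i, j). if i = \<sigma> j then 1 else (0 :: complex))"
  define Q where "Q = mat n n (\<lambda>(i, j). if j = \<sigma> i then 1 else (0 :: complex))"
  define N' where "N' = mat n n (\<lambda>(i, j). N $$ (\<sigma> i, \<sigma> j))"
  have c: "P \<in> carrier_mat n n" "Q \<in> carrier_mat n n" "N' \<in> carrier_mat n n" "N \<in> carrier_mat n n"
    using ker_pattern_carrier[OF N] by (simp_all add: P_def Q_def N'_def)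
  have \<sigma>n: "\<sigma> i < n" if "i < n" for i using bij_betwE[OF \<sigma>] that by auto
  have \<sigma>inj: "\<sigma> i = \<sigma> j \<longleftrightarrow> i = j" if "i < n" "j < n" for i j
    using bij_betw_imp_inj_on[OF \<sigma>] that by (auto simp: inj_on_def)
  have "Q * P = 1\<^sub>m n"
  proof (rule eq_matI)
    fix i j assume "i < dim_row (1\<^sub>m n :: complex mat)" "j < dim_col (1\<^sub>m n :: complex mat)"
    then have ij: "i < n" "j < n" by auto
    have "(Q * P) $$ (i, j) = (\<Sum>k<n. (if k = \<sigma> i then (if \<sigma> i = \<sigma> j then 1 else 0) else 0))"
      unfolding index_mult_sum[OF c(2,1) ij] by (rule sum.cong) (use ij in \<open>auto simp: P_def Q_def\<close>)
    also have "\<dots> = 1\<^sub>m n $$ (i, j)" using \<sigma>n[OF ij(1)] \<sigma>inj[OF ij] ij by simp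
    finally show "(Q * P) $$ (i, j) = 1\<^sub>m n $$ (i, j)" .
  qed (use c in auto)
  then have "det Q * det P = 1" using det_mult[OF c(2,1)] by simp
  then have det: "det P \<noteq> 0" by auto
  have eq: "N * P = P * N'"
  proof (rule eq_matI)
    fix i j assume "i < dim_row (P * N')" "j < dim_col (P * N')"
    then have ij: "i < n" "j < n" using c by auto
    obtain i' where i': "i' < n" "i = \<sigma> i'" using \<sigma> ij by (metis bij_betw_iff_bijections lessThan_iff)
    have "(N * P) $$ (i, j) = (\<Sum>k<n. if k = \<sigma> j then N $$ (i, \<sigma> j) else 0)"
      unfolding index_mult_sum[OF c(4,1) ij] by (rule sum.cong) (use ij in \<open>auto simp: P_def\<close>)
    also have "\<dots> = (\<Sum>k<n. if k = i' then N $$ (\<sigma> i', \<sigma> j) else 0)" using i' \<sigma>n[OF ij(2)] by simp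
    also have "\<dots> = (P * N') $$ (i, j)"
      unfolding index_mult_sum[OF c(1,3) ij]
      by (rule sum.cong) (use ij i' \<sigma>inj[OF i'(1)] in \<open>auto simp: P_def N'_def\<close>)
    finally show "(N * P) $$ (i, j) = (P * N') $$ (i, j)" .
  qed (use c in auto)
  have Pv: "(P *\<^sub>v v) $ \<sigma> j = v $ j" if v: "v \<in> carrier_vec n" and j: "j < n" for v j
  proof -
    have "(P *\<^sub>v v) $ \<sigma> j = (\<Sum>k<n. if k = j then v $ j else 0)"
      unfolding index_mult_vec_sum[OF c(1) v \<sigma>n[OF j]]
      by (rule sum.cong) (use \<sigma>inj[OF j] \<sigma>n[OF j] in \<open>auto simp: P_def\<close>)
    then show ?thesis using j by simp
  qed
  have all_\<sigma>: "(\<forall>j<n. Q j) \<longleftrightarrow> (\<forall>j<n. Q (\<sigma> j))" for Q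
  proof -
    have "(\<forall>j<n. Q j) \<longleftrightarrow> (\<forall>j\<in>\<sigma> ` {..<n}. Q j)"
      unfolding bij_betw_imp_surj_on[OF \<sigma>] by blast
    also have "\<dots> \<longleftrightarrow> (\<forall>j<n. Q (\<sigma> j))" by blast
    finally show ?thesis .
  qed
  have "ker_pattern n (\<lambda>j. \<kappa> (\<sigma> j)) N'"
    unfolding ker_pattern_def
  proof (intro conjI c allI ballI)
    fix k and v :: "complex vec" assume v: "v \<in> carrier_vec n"
    have "(N' ^\<^sub>m k) *\<^sub>v v = 0\<^sub>v n \<longleftrightarrow> (N ^\<^sub>m k) *\<^sub>v (P *\<^sub>v v) = 0\<^sub>v n"
      by (rule intertwine_kernel[OF c(4,1,3) eq det v])
    also have "\<dots> \<longleftrightarrow> (\<forall>j<n. k < \<kappa> j \<longrightarrow> (P *\<^sub>v v) $ j = 0)"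
      by (rule ker_patternD[OF N]) (use c v in auto)
    also have "\<dots> \<longleftrightarrow> (\<forall>j<n. k < \<kappa> (\<sigma> j) \<longrightarrow> (P *\<^sub>v v) $ \<sigma> j = 0)"
      by (rule all_\<sigma>)
    also have "\<dots> \<longleftrightarrow> (\<forall>j<n. k < \<kappa> (\<sigma> j) \<longrightarrow> v $ j = 0)" using Pv[OF v] by auto
    finally show "(N' ^\<^sub>m k) *\<^sub>v v = 0\<^sub>v n \<longleftrightarrow> (\<forall>j<n. k < \<kappa> (\<sigma> j) \<longrightarrow> v $ j = 0)" .
  qed
  from that[OF P_def det this eq N'_def] show thesis .
qed

text \<open>\<open>normal_form\<close> knows nothing of the blocks. A block-preserving permutation
  \<sigma> sorts the colours; \<open>b * P\<close> stays block upper triangular because its column j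
  is column \<sigma> j of \<open>b\<close>, and \<sigma> j lies in the block of j. The new normal
  form is in \<open>rad n \<beta>\<close> because it is conjugate to X under
  \<open>par n \<beta>\<close>.\<close>

lemma block_normal_form:
  assumes n: "n \<ge> 1" and \<beta>: "mono \<beta>" and X: "X \<in> rad n \<beta>"
  obtains g \<kappa> N where "g \<in> par n \<beta>" "ker_pattern n \<kappa> N" "N \<in> rad n \<beta>" "X = conj_by n g N"
    "\<forall>i j. i < j \<longrightarrow> j < n \<longrightarrow> \<beta> i = \<beta> j \<longrightarrow> \<kappa> j \<le> \<kappa> i"
proof -
  note X' = rad_mono_id[OF \<beta> X] and Xc = rad_carrier[OF X]
  obtain \<kappa> b N where b: "b \<in> par n (\<lambda>i. i)" and N: "ker_pattern n \<kappa> N" "N \<in> rad n (\<lambda>i. i)"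
    and eq: "X * b = b * N"
    by (rule normal_form[OF X'])
  have "\<forall>j<n. \<kappa> j \<le> n" using ker_pattern_le[OF N(1) rad_pow_n[OF N(2)]] by auto
  then obtain \<sigma> where \<sigma>: "bij_betw \<sigma> {..<n} {..<n}" "\<forall>i<n. \<beta> (\<sigma> i) = \<beta> i"
    "\<forall>i j. i < j \<longrightarrow> j < n \<longrightarrow> \<beta> i = \<beta> j \<longrightarrow> \<kappa> (\<sigma> j) \<le> \<kappa> (\<sigma> i)"
    by (rule sort_within_blocks[OF \<beta>])
  obtain P N' where P: "P = mat n n (\<lambda>(i, j). if i = \<sigma> j then 1 else (0 :: complex))" "det P \<noteq> 0"
    and N': "ker_pattern n (\<lambda>j. \<kappa> (\<sigma> j)) N'" and eqP: "N * P = P * N'"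
    by (rule permute_ker_pattern[OF N(1) \<sigma>(1)])
  have c: "P \<in> carrier_mat n n" "N' \<in> carrier_mat n n" "N \<in> carrier_mat n n" "b \<in> carrier_mat n n"
    using P(1) ker_pattern_carrier[OF N'] ker_pattern_carrier[OF N(1)] par_carrier[OF b] by auto
  have "X * (b * P) = X * b * P" by (rule assoc_mult_mat[symmetric, OF Xc c(4,1)])
  also have "\<dots> = b * (N * P)" unfolding eq by (rule assoc_mult_mat[OF c(4,3,1)])
  also have "\<dots> = b * P * N'" unfolding eqP by (rule assoc_mult_mat[symmetric, OF c(4,1,2)])
  finally have eq': "X * (b * P) = b * P * N'" .
  have bP: "b * P \<in> carrier_mat n n" using c by auto
  have "det (b * P) \<noteq> 0" using P(2) par_SL[OF b] by (simp add: det_mult[OF c(4,1)] SL_carrier)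
  then obtain e where e: "det (e \<cdot>\<^sub>m (b * P)) = 1" by (rule scale_to_det_one[OF n bP])
  define g where "g = e \<cdot>\<^sub>m (b * P)"
  have entry: "(b * P) $$ (i, j) = b $$ (i, \<sigma> j)" if ij: "i < n" "j < n" for i j
  proof -
    have "\<sigma> j < n" using \<sigma>(1) ij(2) by (meson bij_betwE lessThan_iff)
    have "(b * P) $$ (i, j) = (\<Sum>k<n. if k = \<sigma> j then b $$ (i, \<sigma> j) else 0)"
      unfolding index_mult_sum[OF c(4,1) ij] by (rule sum.cong) (use ij in \<open>auto simp: P(1)\<close>)
    then show ?thesis using \<open>\<sigma> j < n\<close> by simp
  qed
  have "g $$ (i, j) = 0" if ij: "i < n" "j < n" "\<beta> j < \<beta> i" for i j
  proof -
    have "\<sigma> j < n" using \<sigma>(1) ij(2) by (meson bij_betwE lessThan_iff)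
    moreover have "\<beta> (\<sigma> j) < \<beta> i" using \<sigma>(2) ij by simp
    then have "\<sigma> j < i" using \<beta> by (meson leD monoD not_le)
    ultimately have "b $$ (i, \<sigma> j) = 0" using b ij by (simp add: par_def)
    then show ?thesis using entry[OF ij(1,2)] ij by (simp add: g_def carrier_matD[OF c(4)] carrier_matD[OF c(1)])
  qed
  then have g: "g \<in> par n \<beta>" using e bP by (auto simp: par_def SL_carrier g_def)
  have eqg: "X * g = g * N'" unfolding g_def by (rule intertwine_smult[OF Xc c(2) bP eq'])
  note X_eq = conj_by_eqI[OF par_SL[OF g] Xc c(2) eqg]
  have "N' \<in> rad n \<beta>" unfolding X_eq(2) by (intro rad_mult_right rad_mult_left par_adj g X)
  from that[OF g N' this X_eq(1) \<sigma>(3)] show thesis .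
qed

section \<open>Algebraic dependence\<close>

text \<open>The affine space with coordinates in \<open>E\<close>, kept inside the matrices so that
  \<open>zariski n\<close>, \<open>pfun\<close> and \<open>pmap\<close> apply to it.\<close>

definition supp_mat :: "nat \<Rightarrow> (nat \<times> nat) set \<Rightarrow> complex mat set" where
  "supp_mat n E = {X \<in> carrier_mat n n. \<forall>i<n. \<forall>j<n. (i, j) \<notin> E \<longrightarrow> X $$ (i, j) = 0}"

text \<open>Bounding each exponent separately, rather than the total degree, makes the number of
  monomials exactly \<open>(d + 1) ^ card E\<close>.\<close>

definition mono_span :: "nat \<Rightarrow> (nat \<times> nat) set \<Rightarrow> nat \<Rightarrow> (complex mat \<Rightarrow> complex) \<Rightarrow> bool" where
  "mono_span n E d f \<longleftrightarrow> (\<exists>c. \<forall>X\<in>supp_mat n E.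
     f X = (\<Sum>m\<in>PiE E (\<lambda>_. {..d}). c m * (\<Prod>e\<in>E. X $$ e ^ m e)))"

lemma mono_spanI:
  "(\<And>X. X \<in> supp_mat n E \<Longrightarrow> f X = (\<Sum>m\<in>PiE E (\<lambda>_. {..d}). c m * (\<Prod>e\<in>E. X $$ e ^ m e))) \<Longrightarrow> mono_span n E d f"
  unfolding mono_span_def by (rule exI[of _ c]) simp

lemma mono_spanE:
  assumes "mono_span n E d f"
  obtains c where "\<forall>X\<in>supp_mat n E. f X = (\<Sum>m\<in>PiE E (\<lambda>_. {..d}). c m * (\<Prod>e\<in>E. X $$ e ^ m e))"
  using assms unfolding mono_span_def by (elim exE) (rule that)

lemma mono_span_monomial:
  assumes E: "finite E" and m0: "m0 \<in> PiE E (\<lambda>_. {..d})"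
    and f: "\<And>X. X \<in> supp_mat n E \<Longrightarrow> f X = a * (\<Prod>e\<in>E. X $$ e ^ m0 e)"
  shows "mono_span n E d f"
proof (rule mono_spanI[where c = "\<lambda>m. if m = m0 then a else 0"])
  fix X assume X: "X \<in> supp_mat n E"
  have "(\<Sum>m\<in>PiE E (\<lambda>_. {..d}). (if m = m0 then a else 0) * (\<Prod>e\<in>E. X $$ e ^ m e)) =
    (\<Sum>m\<in>PiE E (\<lambda>_. {..d}). if m = m0 then a * (\<Prod>e\<in>E. X $$ e ^ m0 e) else 0)"
    by (rule sum.cong) auto
  then show "f X = (\<Sum>m\<in>PiE E (\<lambda>_. {..d}). (if m = m0 then a else 0) * (\<Prod>e\<in>E. X $$ e ^ m e))"
    using m0 E f[OF X] by (simp add: finite_PiE)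
qed

lemma mono_span_const: assumes "finite E" shows "mono_span n E d (\<lambda>X. a)"
proof (rule mono_span_monomial[OF assms, of "\<lambda>e\<in>E. 0"])
  fix X :: "complex mat"
  have "(\<Prod>e\<in>E. X $$ e ^ (\<lambda>e\<in>E. 0) e) = 1" by (rule prod.neutral) auto
  then show "a = a * (\<Prod>e\<in>E. X $$ e ^ (\<lambda>e\<in>E. 0) e)" by simp
qed auto

lemma mono_span_coord:
  assumes E: "finite E" and ij: "i < n" "j < n" shows "mono_span n E 1 (\<lambda>X. X $$ (i, j))"
proof (cases "(i, j) \<in> E")
  case True
  show ?thesis
  proof (rule mono_span_monomial[OF E, of "\<lambda>e\<in>E. if e = (i, j) then 1 else 0" 1 _ _ 1])
    fix X :: "complex mat"
    have "(\<Prod>e\<in>E. X $$ e ^ (\<lambda>e\<in>E. if e = (i, j) then 1 else 0) e) = (\<Prod>e\<in>E. if e = (i, j) then X $$ (i, j) else 1)"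
      by (rule prod.cong) auto
    then show "X $$ (i, j) = 1 * (\<Prod>e\<in>E. X $$ e ^ (\<lambda>e\<in>E. if e = (i, j) then 1 else 0) e)"
      using True E by simp
  qed auto
next
  case False
  show ?thesis
    by (rule mono_spanI[where c = "\<lambda>_. 0"]) (use False ij in \<open>auto simp: supp_mat_def\<close>)
qed

lemma mono_span_mono:
  assumes E: "finite E" and f: "mono_span n E d f" and le: "d \<le> d'" shows "mono_span n E d' f"
proof -
  obtain c where c: "\<forall>X\<in>supp_mat n E. f X = (\<Sum>m\<in>PiE E (\<lambda>_. {..d}). c m * (\<Prod>e\<in>E. X $$ e ^ m e))"
    using f by (rule mono_spanE)
  have sub: "PiE E (\<lambda>_. {..d}) \<subseteq> PiE E (\<lambda>_. {..d'})" by (rule PiE_mono) (use le in auto)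
  show ?thesis
  proof (rule mono_spanI[where c = "\<lambda>m. if m \<in> PiE E (\<lambda>_. {..d}) then c m else 0"])
    fix X assume "X \<in> supp_mat n E"
    then have "f X = (\<Sum>m\<in>PiE E (\<lambda>_. {..d}). c m * (\<Prod>e\<in>E. X $$ e ^ m e))" using c by blast
    also have "\<dots> = (\<Sum>m\<in>PiE E (\<lambda>_. {..d'}). (if m \<in> PiE E (\<lambda>_. {..d}) then c m else 0) * (\<Prod>e\<in>E. X $$ e ^ m e))"
      by (rule sum.mono_neutral_cong_left) (use E sub in \<open>auto simp: finite_PiE\<close>)
    finally show "f X = (\<Sum>m\<in>PiE E (\<lambda>_. {..d'}). (if m \<in> PiE E (\<lambda>_. {..d}) then c m else 0) * (\<Prod>e\<in>E. X $$ e ^ m e))" .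
  qed
qed

lemma mono_span_add:
  assumes f: "mono_span n E d f" and g: "mono_span n E d g" shows "mono_span n E d (\<lambda>X. f X + g X)"
proof -
  obtain c where c: "\<forall>X\<in>supp_mat n E. f X = (\<Sum>m\<in>PiE E (\<lambda>_. {..d}). c m * (\<Prod>e\<in>E. X $$ e ^ m e))"
    using f by (rule mono_spanE)
  obtain c' where c': "\<forall>X\<in>supp_mat n E. g X = (\<Sum>m\<in>PiE E (\<lambda>_. {..d}). c' m * (\<Prod>e\<in>E. X $$ e ^ m e))"
    using g by (rule mono_spanE)
  show ?thesis
    by (rule mono_spanI[where c = "\<lambda>m. c m + c' m"]) (simp add: c c' distrib_right sum.distrib)
qed

lemma mono_span_mult:
  assumes E: "finite E" and f: "mono_span n E d f" and g: "mono_span n E d' g"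
  shows "mono_span n E (d + d') (\<lambda>X. f X * g X)"
proof -
  let ?S = "PiE E (\<lambda>_. {..d})" and ?S' = "PiE E (\<lambda>_. {..d'})" and ?T = "PiE E (\<lambda>_. {..d + d'})"
  let ?mon = "\<lambda>X :: complex mat. \<lambda>m. \<Prod>e\<in>E. X $$ e ^ m e"
  obtain c where c: "\<forall>X\<in>supp_mat n E. f X = (\<Sum>m\<in>?S. c m * ?mon X m)"
    using f by (rule mono_spanE)
  obtain c' where c': "\<forall>X\<in>supp_mat n E. g X = (\<Sum>m\<in>?S'. c' m * ?mon X m)"
    using g by (rule mono_spanE)
  define plus where "plus = (\<lambda>(m, m'). \<lambda>e\<in>E. (m e :: nat) + m' e)"
  have fin: "finite (?S \<times> ?S')" "finite ?T" using E by (auto simp: finite_PiE)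
  have im: "plus ` (?S \<times> ?S') \<subseteq> ?T"
  proof
    fix l assume "l \<in> plus ` (?S \<times> ?S')"
    then obtain m m' where m: "m \<in> ?S" "m' \<in> ?S'" "l = plus (m, m')" by auto
    have "m e + m' e \<le> d + d'" if "e \<in> E" for e
      using PiE_mem[OF m(1) that] PiE_mem[OF m(2) that] by simp
    then show "l \<in> ?T" unfolding m(3) plus_def by auto
  qed
  show ?thesis
  proof (rule mono_spanI[where c = "\<lambda>l. \<Sum>p\<in>{p \<in> ?S \<times> ?S'. plus p = l}. c (fst p) * c' (snd p)"])
    fix X assume X: "X \<in> supp_mat n E"
    have mon: "?mon X (plus (m, m')) = ?mon X m * ?mon X m'" for m m'
      unfolding prod.distrib[symmetric] by (rule prod.cong) (auto simp: plus_def power_add)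
    have "f X * g X = (\<Sum>m\<in>?S. \<Sum>m'\<in>?S'. (c m * ?mon X m) * (c' m' * ?mon X m'))"
      using c c' X by (simp add: sum_product)
    also have "\<dots> = (\<Sum>p\<in>?S \<times> ?S'. c (fst p) * c' (snd p) * ?mon X (plus p))"
      unfolding sum.cartesian_product
      by (rule sum.cong) (auto simp: mon)
    also have "\<dots> = (\<Sum>l\<in>?T. \<Sum>p\<in>{p \<in> ?S \<times> ?S'. plus p = l}. c (fst p) * c' (snd p) * ?mon X (plus p))"
      by (rule sum.group[symmetric, OF fin im])
    also have "\<dots> = (\<Sum>l\<in>?T. (\<Sum>p\<in>{p \<in> ?S \<times> ?S'. plus p = l}. c (fst p) * c' (snd p)) * ?mon X l)"
      unfolding sum_distrib_right by (intro sum.cong refl) auto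
    finally show "f X * g X = (\<Sum>l\<in>?T. (\<Sum>p\<in>{p \<in> ?S \<times> ?S'. plus p = l}. c (fst p) * c' (snd p)) * ?mon X l)" .
  qed
qed

lemma mono_span_power:
  assumes "finite E" "mono_span n E d f" "k * d \<le> d'" shows "mono_span n E d' (\<lambda>X. f X ^ k)"
proof -
  have "mono_span n E (k * d) (\<lambda>X. f X ^ k)"
    by (induction k) (use mono_span_const[OF assms(1)] mono_span_mult[OF assms(1,2)] in auto)
  then show ?thesis using assms by (blast intro: mono_span_mono)
qed

lemma mono_span_prod:
  assumes "finite E" "finite A" "\<And>a. a \<in> A \<Longrightarrow> mono_span n E d (f a)"
  shows "mono_span n E (card A * d) (\<lambda>X. \<Prod>a\<in>A. f a X)"
  using assms(2,3)
proof (induction A rule: finite_induct)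
  case empty
  then show ?case using mono_span_const[OF assms(1)] by simp
next
  case (insert a A)
  then show ?case using mono_span_mult[OF assms(1), of n d "f a" "card A * d" "\<lambda>X. \<Prod>a\<in>A. f a X"] by simp
qed

lemma pfun_mono_span:
  assumes E: "finite E" and f: "pfun n f" shows "\<exists>d. mono_span n E d f"
proof -
  obtain g where g: "poly_fun n g" "\<forall>X\<in>carrier_mat n n. f X = g X" using f by (rule pfunE)
  have "\<exists>d. mono_span n E d g"
    using g(1)
  proof (induction rule: poly_fun.induct)
    case (const c)
    then show ?case using mono_span_const[OF E] by blast
  next
    case (coord i j)
    then show ?case using mono_span_coord[OF E] by blast
  next
    case (add f g)
    then obtain d d' where "mono_span n E d f" "mono_span n E d' g" by blast
    then have "mono_span n E (d + d') f" "mono_span n E (d + d') g" using mono_span_mono[OF E] by simp_all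
    then show ?case using mono_span_add by blast
  next
    case (mult f g)
    then show ?case using mono_span_mult[OF E] by blast
  qed
  then obtain d where "mono_span n E d g" by blast
  then obtain c where "\<forall>X\<in>supp_mat n E. g X = (\<Sum>m\<in>PiE E (\<lambda>_. {..d}). c m * (\<Prod>e\<in>E. X $$ e ^ m e))"
    by (rule mono_spanE)
  then have "mono_span n E d f"
    using g(2) by (intro mono_spanI[where c = c]) (auto simp: supp_mat_def)
  then show ?thesis by blast
qed

text \<open>A count: the products of the \<open>g a\<close> with exponents at most d number
  \<open>(d + 1) ^ card A\<close>, and they expand in \<open>(M + 1) ^ card E\<close> monomials with
  \<open>M\<close> linear in d. As \<open>card E < card A\<close>, the products outnumber the
  monomials for large d.\<close>

lemma algebraically_dependent:
  assumes E: "finite E" and A: "finite A" "card E < card A" and g: "\<And>a. a \<in> A \<Longrightarrow> pfun n (g a)"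
  obtains d c where "\<exists>k\<in>PiE A (\<lambda>_. {..d}). c k \<noteq> (0 :: complex)"
    "\<forall>X\<in>supp_mat n E. (\<Sum>k\<in>PiE A (\<lambda>_. {..d}). c k * (\<Prod>a\<in>A. g a X ^ k a)) = 0"
proof -
  obtain dg where dg: "\<And>a. a \<in> A \<Longrightarrow> mono_span n E (dg a) (g a)"
    using pfun_mono_span[OF E g] by metis
  define e where "e = (\<Sum>a\<in>A. dg a)"
  have e: "mono_span n E e (g a)" if "a \<in> A" for a
    by (rule mono_span_mono[OF E dg[OF that]]) (use A that in \<open>auto simp: e_def intro: member_le_sum\<close>)
  \<comment> \<open>This d makes the count explicit: \<open>(M + 1) ^ D \<le> (card A * e + 1) ^ D *
    (d + 1) ^ D = d * (d + 1) ^ D < (d + 1) ^ (D + 1)\<close>.\<close>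
  define D d where "D = card E" and "d = (card A * e + 1) ^ D"
  define M where "M = card A * (d * e)"
  let ?K = "PiE A (\<lambda>_. {..d})" and ?T = "PiE E (\<lambda>_. {..M})"
  have "mono_span n E M (\<lambda>X. \<Prod>a\<in>A. g a X ^ k a)" if k: "k \<in> ?K" for k
    unfolding M_def
  proof (rule mono_span_prod[OF E A(1)])
    fix a assume a: "a \<in> A"
    then have "k a \<le> d" using PiE_mem[OF k a] by simp
    then show "mono_span n E (d * e) (\<lambda>X. g a X ^ k a)" by (intro mono_span_power[OF E e[OF a]]) simp
  qed
  then have "\<forall>k\<in>?K. \<exists>c. \<forall>X\<in>supp_mat n E. (\<Prod>a\<in>A. g a X ^ k a) = (\<Sum>m\<in>?T. c m * (\<Prod>e\<in>E. X $$ e ^ m e))"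
    unfolding mono_span_def by blast
  from bchoice[OF this] obtain C where
    C: "\<forall>k\<in>?K. \<forall>X\<in>supp_mat n E. (\<Prod>a\<in>A. g a X ^ k a) = (\<Sum>m\<in>?T. C k m * (\<Prod>e\<in>E. X $$ e ^ m e))" by (elim exE)
  have fin: "finite ?T" "finite ?K" using E A by (simp_all add: finite_PiE)
  have "M + 1 \<le> (card A * e + 1) * (d + 1)" by (simp add: M_def algebra_simps)
  then have "(M + 1) ^ D \<le> ((card A * e + 1) * (d + 1)) ^ D" by (rule power_mono) simp
  also have "\<dots> = d * (d + 1) ^ D" by (simp only: power_mult_distrib d_def)
  also have "\<dots> < (d + 1) ^ (D + 1)" by simp
  also have "\<dots> \<le> (d + 1) ^ card A" by (rule power_increasing) (use A in \<open>auto simp: D_def\<close>)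
  finally have "card ?T < card ?K" using E A by (simp add: card_PiE D_def)
  from exists_nontrivial_solution[OF fin this, of "\<lambda>m k. C k m"] obtain c where
    c: "\<exists>k\<in>?K. c k \<noteq> 0" and c0: "\<forall>m\<in>?T. (\<Sum>k\<in>?K. C k m * c k) = 0" by blast
  have "(\<Sum>k\<in>?K. c k * (\<Prod>a\<in>A. g a X ^ k a)) = 0" if X: "X \<in> supp_mat n E" for X
  proof -
    have "(\<Sum>k\<in>?K. c k * (\<Prod>a\<in>A. g a X ^ k a)) = (\<Sum>k\<in>?K. \<Sum>m\<in>?T. C k m * c k * (\<Prod>e\<in>E. X $$ e ^ m e))"
      by (rule sum.cong) (use C X in \<open>simp_all add: sum_distrib_left mult_ac\<close>)
    also have "\<dots> = (\<Sum>m\<in>?T. (\<Sum>k\<in>?K. C k m * c k) * (\<Prod>e\<in>E. X $$ e ^ m e))"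
      by (subst sum.swap) (simp add: sum_distrib_right)
    also have "\<dots> = 0" using c0 by (intro sum.neutral) simp
    finally show ?thesis .
  qed
  then show thesis using that[OF c] by blast
qed

text \<open>With the other variables fixed, a polynomial in one variable that vanishes identically
  has zero coefficients, and these coefficients are relations in one variable fewer.\<close>

lemma monomials_independent:
  fixes c :: "('a \<Rightarrow> nat) \<Rightarrow> complex"
  assumes "finite A" "\<And>y :: 'a \<Rightarrow> complex. (\<Sum>k\<in>PiE A (\<lambda>_. {..d}). c k * (\<Prod>a\<in>A. y a ^ k a)) = 0"
    and "k \<in> PiE A (\<lambda>_. {..d})"
  shows "c k = 0"
  using assms
proof (induction A arbitrary: c k rule: finite_induct)
  case empty
  then show ?case by simp
next
  case (insert b A)
  let ?S = "PiE A (\<lambda>_. {..d})"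
  have split: "(\<Sum>k\<in>PiE (insert b A) (\<lambda>_. {..d}). F k) = (\<Sum>i\<le>d. \<Sum>k\<in>?S. F (k(b := i)))" for F :: "('a \<Rightarrow> nat) \<Rightarrow> complex"
  proof -
    have "inj_on (\<lambda>p. (snd p)(b := fst p)) ({..d} \<times> ?S)"
      using inj_combinator[OF insert.hyps(2), of "\<lambda>_. {..d}"] by (simp add: case_prod_beta')
    then show ?thesis
      unfolding PiE_insert_eq by (simp add: sum.reindex sum.cartesian_product case_prod_beta')
  qed
  have coeff: "(\<Sum>k\<in>?S. c (k(b := i)) * (\<Prod>a\<in>A. y a ^ k a)) = 0" if i: "i \<le> d" for y :: "'a \<Rightarrow> complex" and i
  proof -
    have "(\<Sum>i\<le>d. (\<Sum>k\<in>?S. c (k(b := i)) * (\<Prod>a\<in>A. y a ^ k a)) * t ^ i) = 0" for t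
    proof -
      have "(\<Prod>a\<in>insert b A. (y(b := t)) a ^ (k(b := i)) a) = (\<Prod>a\<in>A. y a ^ k a) * t ^ i" for k i
      proof -
        have "(\<Prod>a\<in>A. (y(b := t)) a ^ (k(b := i)) a) = (\<Prod>a\<in>A. y a ^ k a)"
          by (rule prod.cong) (use insert.hyps in auto)
        then show ?thesis using insert.hyps by simp
      qed
      then show ?thesis using insert.prems(1)[of "y(b := t)"]
        unfolding split by (simp add: sum_distrib_right mult.assoc)
    qed
    then show ?thesis using polyfun_eq_0[of "\<lambda>i. \<Sum>k\<in>?S. c (k(b := i)) * (\<Prod>a\<in>A. y a ^ k a)" d] i by blast
  qed
  obtain i k' where k': "k = k'(b := i)" "i \<le> d" "k' \<in> ?S"
    using insert.prems(2) unfolding PiE_insert_eq by auto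
  show ?case unfolding k'(1) by (rule insert.IH[OF coeff[OF k'(2)] k'(3)])
qed

text \<open>Functions whose linear parts can be prescribed freely satisfy no polynomial relation:
  rescaling by \<open>t\<close>, the lowest homogeneous part of the relation survives as \<open>t\<close> tends to 0.\<close>

lemma no_relation_if_free_tangents:
  fixes c :: "('a \<Rightarrow> nat) \<Rightarrow> complex"
  assumes A: "finite A"
    and curve: "\<And>y. \<exists>u. (\<forall>a\<in>A. u a 0 = 0 \<and> (u a has_field_derivative y a) (at 0)) \<and>
      (\<forall>t. (\<Sum>k\<in>PiE A (\<lambda>_. {..d}). c k * (\<Prod>a\<in>A. u a t ^ k a)) = 0)"
    and k: "k \<in> PiE A (\<lambda>_. {..d})"
  shows "c k = 0"
proof (rule ccontr)
  assume nz: "c k \<noteq> 0"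
  let ?K = "PiE A (\<lambda>_. {..d})"
  define deg where "deg k = (\<Sum>a\<in>A. k a)" for k :: "'a \<Rightarrow> nat"
  define s where "s = (LEAST s. \<exists>k\<in>?K. c k \<noteq> 0 \<and> deg k = s)"
  have "\<exists>k\<in>?K. c k \<noteq> 0 \<and> deg k = s" unfolding s_def by (rule LeastI[of _ "deg k"]) (use k nz in blast)
  then obtain k0 where k0: "k0 \<in> ?K" "c k0 \<noteq> 0" "deg k0 = s" by blast
  have s_le: "s \<le> deg k" if "k \<in> ?K" "c k \<noteq> 0" for k
    unfolding s_def by (rule Least_le) (use that in blast)
  define c' where "c' k = (if deg k = s then c k else 0)" for k
  have "(\<Sum>k\<in>?K. c' k * (\<Prod>a\<in>A. y a ^ k a)) = 0" for y
  proof -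
    obtain u where u: "\<And>a. a \<in> A \<Longrightarrow> u a 0 = 0" "\<And>a. a \<in> A \<Longrightarrow> (u a has_field_derivative y a) (at 0)"
      and rel: "\<And>t. (\<Sum>k\<in>?K. c k * (\<Prod>a\<in>A. u a t ^ k a)) = 0" using curve[of y] by blast
    have lim: "((\<lambda>t. u a t / t) \<longlongrightarrow> y a) (at 0)" if "a \<in> A" for a
      using u(2)[OF that] u(1)[OF that] by (simp add: DERIV_def)
    \<comment> \<open>The relation divided by \<open>t ^ s\<close>. Terms of degree below
      \<open>s\<close> have coefficient 0, so the truncated subtraction is harmless, and in the
      limit exactly the terms of degree \<open>s\<close> survive.\<close>
    define F where "F t = (\<Sum>k\<in>?K. c k * ((\<Prod>a\<in>A. (u a t / t) ^ k a) * t ^ (deg k - s)))" for t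
    have "(F \<longlongrightarrow> (\<Sum>k\<in>?K. c k * ((\<Prod>a\<in>A. y a ^ k a) * 0 ^ (deg k - s)))) (at 0)"
      unfolding F_def
      by (intro tendsto_sum tendsto_mult tendsto_const tendsto_prod tendsto_power lim tendsto_ident_at)
    moreover have "F t = 0" if "t \<noteq> 0" for t
    proof -
      have "F t * t ^ s = (\<Sum>k\<in>?K. c k * (\<Prod>a\<in>A. u a t ^ k a))"
        unfolding F_def sum_distrib_right
      proof (rule sum.cong[OF refl])
        fix k assume k: "k \<in> ?K"
        show "c k * ((\<Prod>a\<in>A. (u a t / t) ^ k a) * t ^ (deg k - s)) * t ^ s = c k * (\<Prod>a\<in>A. u a t ^ k a)"
        proof (cases "c k = 0")
          case False
          have "t ^ (deg k - s) * t ^ s = t ^ deg k" using s_le[OF k False] by (simp flip: power_add)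
          also have "\<dots> = (\<Prod>a\<in>A. t ^ k a)" unfolding deg_def by (simp add: power_sum)
          finally have "(\<Prod>a\<in>A. (u a t / t) ^ k a) * t ^ (deg k - s) * t ^ s = (\<Prod>a\<in>A. (u a t / t) ^ k a * t ^ k a)"
            by (simp add: prod.distrib mult.assoc)
          also have "\<dots> = (\<Prod>a\<in>A. u a t ^ k a)"
            by (rule prod.cong) (use that in \<open>simp_all flip: power_mult_distrib\<close>)
          finally show ?thesis by (simp add: mult.assoc)
        qed simp
      qed
      then show ?thesis using rel that by simp
    qed
    then have "(F \<longlongrightarrow> 0) (at 0)"
      by (intro tendsto_eventually) (auto simp: eventually_at_filter)
    ultimately have "(\<Sum>k\<in>?K. c k * ((\<Prod>a\<in>A. y a ^ k a) * 0 ^ (deg k - s))) = 0"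
      by (rule tendsto_unique[OF at_neq_bot])
    moreover have "c k * ((\<Prod>a\<in>A. y a ^ k a) * 0 ^ (deg k - s)) = c' k * (\<Prod>a\<in>A. y a ^ k a)" if "k \<in> ?K" for k
      using s_le[OF that] by (cases "c k = 0"; cases "deg k = s") (auto simp: c'_def)
    ultimately show ?thesis by simp
  qed
  then have "c' k0 = 0" by (rule monomials_independent[OF A _ k0(1)])
  then show False using k0 by (simp add: c'_def)
qed

section \<open>Curves of matrices\<close>

definition mat_deriv :: "nat \<Rightarrow> (complex \<Rightarrow> complex mat) \<Rightarrow> complex mat \<Rightarrow> bool" where
  "mat_deriv n \<gamma> G \<longleftrightarrow> (\<forall>t. \<gamma> t \<in> carrier_mat n n) \<and> G \<in> carrier_mat n n \<and>
     (\<forall>i<n. \<forall>j<n. ((\<lambda>t. \<gamma> t $$ (i, j)) has_field_derivative G $$ (i, j)) (at 0))"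

lemma mat_derivD:
  assumes "mat_deriv n \<gamma> G"
  shows "\<gamma> t \<in> carrier_mat n n" "G \<in> carrier_mat n n"
    "i < n \<Longrightarrow> j < n \<Longrightarrow> ((\<lambda>t. \<gamma> t $$ (i, j)) has_field_derivative G $$ (i, j)) (at 0)"
  using assms by (auto simp: mat_deriv_def)

lemma mat_deriv_const: "A \<in> carrier_mat n n \<Longrightarrow> mat_deriv n (\<lambda>t. A) (0\<^sub>m n n)"
  by (simp add: mat_deriv_def)

lemma mat_deriv_line:
  assumes "A \<in> carrier_mat n n" "B \<in> carrier_mat n n" shows "mat_deriv n (\<lambda>t. A + t \<cdot>\<^sub>m B) B"
  unfolding mat_deriv_def
proof (intro conjI allI impI)
  fix i j assume ij: "i < n" "j < n"
  have "((\<lambda>t. A $$ (i, j) + t * B $$ (i, j)) has_field_derivative B $$ (i, j)) (at 0)"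
    by (auto intro!: derivative_eq_intros)
  then show "((\<lambda>t. (A + t \<cdot>\<^sub>m B) $$ (i, j)) has_field_derivative B $$ (i, j)) (at 0)"
    using assms ij by simp
qed (use assms in auto)

lemma mat_deriv_mult:
  assumes \<gamma>: "mat_deriv n \<gamma> G" and \<delta>: "mat_deriv n \<delta> H"
  shows "mat_deriv n (\<lambda>t. \<gamma> t * \<delta> t) (G * \<delta> 0 + \<gamma> 0 * H)"
  unfolding mat_deriv_def
proof (intro conjI allI impI)
  note c = mat_derivD(1,2)[OF \<gamma>] mat_derivD(1,2)[OF \<delta>]
  show "\<gamma> t * \<delta> t \<in> carrier_mat n n" "G * \<delta> 0 + \<gamma> 0 * H \<in> carrier_mat n n" for t
    using c by (auto intro!: mult_carrier_mat add_carrier_mat)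
  fix i j assume ij: "i < n" "j < n"
  have "((\<lambda>t. \<Sum>k<n. \<gamma> t $$ (i, k) * \<delta> t $$ (k, j)) has_field_derivative
      (\<Sum>k<n. G $$ (i, k) * \<delta> 0 $$ (k, j) + \<gamma> 0 $$ (i, k) * H $$ (k, j))) (at 0)"
    by (rule DERIV_sum)
      (use mat_derivD(3)[OF \<gamma>] mat_derivD(3)[OF \<delta>] ij in \<open>auto intro!: derivative_eq_intros\<close>)
  moreover have "(\<Sum>k<n. G $$ (i, k) * \<delta> 0 $$ (k, j) + \<gamma> 0 $$ (i, k) * H $$ (k, j)) = (G * \<delta> 0 + \<gamma> 0 * H) $$ (i, j)"
  proof -
    have "(G * \<delta> 0 + \<gamma> 0 * H) $$ (i, j) = (G * \<delta> 0) $$ (i, j) + (\<gamma> 0 * H) $$ (i, j)"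
      by (rule index_add_mat(1)) (use ij in \<open>simp_all add: carrier_matD[OF c(1)] carrier_matD[OF c(4)]\<close>)
    then show ?thesis
      unfolding index_mult_sum[OF c(2,3) ij] index_mult_sum[OF c(1,4) ij] by (simp add: sum.distrib)
  qed
  ultimately show "((\<lambda>t. (\<gamma> t * \<delta> t) $$ (i, j)) has_field_derivative (G * \<delta> 0 + \<gamma> 0 * H) $$ (i, j)) (at 0)"
    unfolding index_mult_sum[OF c(1,3) ij] by simp
qed

text \<open>The order of the quantifiers matters: one d serves all curves with the same point and
  velocity, so a curve inside a group may be exchanged for its tangent line.\<close>

lemma pfun_deriv_along_curve:
  assumes "pfun n f"
  obtains d where "\<forall>\<gamma>. mat_deriv n \<gamma> G \<longrightarrow> \<gamma> 0 = A \<longrightarrow> ((\<lambda>t. f (\<gamma> t)) has_field_derivative d) (at 0)"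
proof -
  obtain g where g: "poly_fun n g" "\<forall>X\<in>carrier_mat n n. f X = g X" using assms by (rule pfunE)
  have "\<exists>d. \<forall>\<gamma>. mat_deriv n \<gamma> G \<longrightarrow> \<gamma> 0 = A \<longrightarrow> ((\<lambda>t. g (\<gamma> t)) has_field_derivative d) (at 0)"
    using g(1)
  proof (induction rule: poly_fun.induct)
    case (const c)
    show ?case by (rule exI[of _ 0]) simp
  next
    case (coord i j)
    then show ?case by (intro exI[of _ "G $$ (i, j)"]) (simp add: mat_derivD(3))
  next
    case (add f g)
    then obtain d d' where
      "\<forall>\<gamma>. mat_deriv n \<gamma> G \<longrightarrow> \<gamma> 0 = A \<longrightarrow> ((\<lambda>t. f (\<gamma> t)) has_field_derivative d) (at 0)"
      "\<forall>\<gamma>. mat_deriv n \<gamma> G \<longrightarrow> \<gamma> 0 = A \<longrightarrow> ((\<lambda>t. g (\<gamma> t)) has_field_derivative d') (at 0)" by (elim exE)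
    then show ?case by (intro exI[of _ "d + d'"]) (simp add: DERIV_add)
  next
    case (mult f g)
    then obtain d d' where
      d: "\<forall>\<gamma>. mat_deriv n \<gamma> G \<longrightarrow> \<gamma> 0 = A \<longrightarrow> ((\<lambda>t. f (\<gamma> t)) has_field_derivative d) (at 0)"
      "\<forall>\<gamma>. mat_deriv n \<gamma> G \<longrightarrow> \<gamma> 0 = A \<longrightarrow> ((\<lambda>t. g (\<gamma> t)) has_field_derivative d') (at 0)" by (elim exE)
    show ?case
    proof (intro exI[of _ "d * g A + d' * f A"] allI impI)
      fix \<gamma> assume "mat_deriv n \<gamma> G" "\<gamma> 0 = A"
      then show "((\<lambda>t. f (\<gamma> t) * g (\<gamma> t)) has_field_derivative d * g A + d' * f A) (at 0)"
        using DERIV_mult[of "\<lambda>t. f (\<gamma> t)" d 0 UNIV "\<lambda>t. g (\<gamma> t)" d'] d by simp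
    qed
  qed
  then obtain d where d: "\<forall>\<gamma>. mat_deriv n \<gamma> G \<longrightarrow> \<gamma> 0 = A \<longrightarrow> ((\<lambda>t. g (\<gamma> t)) has_field_derivative d) (at 0)" ..
  have "\<forall>\<gamma>. mat_deriv n \<gamma> G \<longrightarrow> \<gamma> 0 = A \<longrightarrow> ((\<lambda>t. f (\<gamma> t)) has_field_derivative d) (at 0)"
    using d g(2) by (simp add: mat_derivD(1))
  then show thesis by (rule that)
qed

lemma pmap_mat_deriv:
  assumes F: "pmap n F" and \<gamma>: "mat_deriv n \<gamma> G"
  obtains H where "mat_deriv n (\<lambda>t. F (\<gamma> t)) H"
proof -
  have "\<exists>d. ((\<lambda>t. F (\<gamma> t) $$ (i, j)) has_field_derivative d) (at 0)" if "i < n" "j < n" for i j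
    using pfun_deriv_along_curve[OF pmap_entry[OF F that], of G "\<gamma> 0"] \<gamma> by metis
  then obtain d where d: "\<And>i j. i < n \<Longrightarrow> j < n \<Longrightarrow> ((\<lambda>t. F (\<gamma> t) $$ (i, j)) has_field_derivative d i j) (at 0)"
    by metis
  have "mat_deriv n (\<lambda>t. F (\<gamma> t)) (mat n n (\<lambda>(i, j). d i j))"
    using d mat_derivD(1)[OF \<gamma>] pmap_carrier[OF F] by (simp add: mat_deriv_def)
  then show thesis by (rule that)
qed

lemma mat_deriv_unique:
  assumes "mat_deriv n \<gamma> G" "mat_deriv n \<gamma> H" shows "G = H"
proof (rule eq_matI)
  fix i j assume "i < dim_row H" "j < dim_col H"
  then have ij: "i < n" "j < n" using mat_derivD(2)[OF assms(2)] by auto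
  show "G $$ (i, j) = H $$ (i, j)"
    by (rule DERIV_unique[OF mat_derivD(3)[OF assms(1) ij] mat_derivD(3)[OF assms(2) ij]])
qed (use mat_derivD(2)[OF assms(1)] mat_derivD(2)[OF assms(2)] in auto)

section \<open>A polynomial parametrization of the pieces\<close>

text \<open>The coordinates of a piece. A pair with \<open>\<kappa> j < \<kappa> i\<close> carries
  an entry of the base change, one with \<open>\<kappa> i < \<kappa> j\<close> an entry of the
  normal form; the supports are disjoint, so one matrix holds both.\<close>

definition edges :: "nat \<Rightarrow> (nat \<Rightarrow> nat) \<Rightarrow> (nat \<times> nat) set" where
  "edges n \<kappa> = {(i, j). i < j \<and> j < n \<and> \<kappa> i \<noteq> \<kappa> j}"

text \<open>Lower and upper refer to the order of the colours; both parts are strictly upper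
  triangular matrices.\<close>

definition lower_part :: "nat \<Rightarrow> (nat \<Rightarrow> nat) \<Rightarrow> complex mat \<Rightarrow> complex mat" where
  "lower_part n \<kappa> X = mat n n (\<lambda>(i, j). if i < j \<and> \<kappa> j < \<kappa> i then X $$ (i, j) else 0)"

definition upper_part :: "nat \<Rightarrow> (nat \<Rightarrow> nat) \<Rightarrow> complex mat \<Rightarrow> complex mat" where
  "upper_part n \<kappa> X = mat n n (\<lambda>(i, j). if i < j \<and> \<kappa> i < \<kappa> j then X $$ (i, j) else 0)"

definition base_change :: "nat \<Rightarrow> (nat \<Rightarrow> nat) \<Rightarrow> complex mat \<Rightarrow> complex mat" where
  "base_change n \<kappa> X = 1\<^sub>m n + lower_part n \<kappa> X"

definition piece_map :: "nat \<Rightarrow> (nat \<Rightarrow> nat) \<Rightarrow> complex mat \<Rightarrow> complex mat" where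
  "piece_map n \<kappa> X = base_change n \<kappa> X * upper_part n \<kappa> X * adj_mat (base_change n \<kappa> X)"

definition piece :: "nat \<Rightarrow> (nat \<Rightarrow> nat) \<Rightarrow> complex mat set" where
  "piece n \<kappa> = piece_map n \<kappa> ` supp_mat n (edges n \<kappa>)"

lemma finite_edges: "finite (edges n \<kappa>)"
  by (rule finite_subset[of _ "{..<n} \<times> {..<n}"]) (auto simp: edges_def)

lemma lower_part_carrier [simp]: "lower_part n \<kappa> X \<in> carrier_mat n n"
  and upper_part_carrier [simp]: "upper_part n \<kappa> X \<in> carrier_mat n n"
  and base_change_carrier [simp]: "base_change n \<kappa> X \<in> carrier_mat n n"
  by (simp_all add: lower_part_def upper_part_def base_change_def)

lemma base_change_entry:
  "i < n \<Longrightarrow> j < n \<Longrightarrow> base_change n \<kappa> X $$ (i, j) =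
    (if i = j then 1 else if i < j \<and> \<kappa> j < \<kappa> i then X $$ (i, j) else 0)"
  by (simp add: base_change_def lower_part_def)

lemma base_change_par: "base_change n \<kappa> X \<in> par n (\<lambda>i. i)"
  using unitriangular_det[of "base_change n \<kappa> X" n]
  by (auto simp: par_def SL_carrier base_change_entry)

lemma piece_map_conj: "piece_map n \<kappa> X = conj_by n (base_change n \<kappa> X) (upper_part n \<kappa> X)"
  by (simp add: piece_map_def conj_by_adj[OF par_SL[OF base_change_par]])

lemma pfun_if: "(P \<Longrightarrow> pfun n f) \<Longrightarrow> (\<not> P \<Longrightarrow> pfun n g) \<Longrightarrow> pfun n (\<lambda>X. if P then f X else g X)"
  by (cases P) simp_all

lemma pmap_lower_part: "pmap n (lower_part n \<kappa>)" and pmap_upper_part: "pmap n (upper_part n \<kappa>)"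
  by (auto intro!: pmapI pfun_if pfun_coord pfun_const simp: lower_part_def upper_part_def)

lemma pmap_base_change: "pmap n (base_change n \<kappa>)"
  unfolding base_change_def by (intro pmap_add pmap_const pmap_lower_part) simp

lemma pmap_piece_map: "pmap n (piece_map n \<kappa>)"
  unfolding piece_map_def
  by (intro pmap_mult pmap_base_change pmap_upper_part pmap_comp[OF pmap_adj pmap_base_change])

text \<open>The line through two points of S stays in S off the zeros of \<open>q\<close>. The
  restriction of \<open>q\<close> to the line is a polynomial \<open>r\<close>, which serves as the
  denominator of the rational curve.\<close>

lemma irreducible_in_linear:
  assumes "S \<subseteq> carrier_mat n n" "S \<noteq> {}" and "pfun n q" "\<And>X. X \<in> S \<Longrightarrow> q X \<noteq> 0"
    and line: "\<And>A B t. A \<in> S \<Longrightarrow> B \<in> S \<Longrightarrow> q (A + t \<cdot>\<^sub>m (B - A)) \<noteq> 0 \<Longrightarrow> A + t \<cdot>\<^sub>m (B - A) \<in> S"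
  shows "irreducible_in (zariski n) S"
proof (rule irreducible_in_if_rational_curves[OF assms(1,2)])
  fix A B assume AB: "A \<in> S" "B \<in> S"
  then have c: "A \<in> carrier_mat n n" "B \<in> carrier_mat n n" using assms(1) by auto
  define \<gamma> where "\<gamma> t = A + t \<cdot>\<^sub>m (B - A)" for t
  obtain g where g: "poly_fun n g" "\<forall>X\<in>carrier_mat n n. q X = g X" using assms(3) by (rule pfunE)
  have \<gamma>c: "\<gamma> t \<in> carrier_mat n n" for t unfolding \<gamma>_def using c by (intro add_carrier_mat smult_carrier_mat minus_carrier_mat)
  have ent: "\<gamma> t $$ (i, j) * poly 1 t = poly [:A $$ (i, j), B $$ (i, j) - A $$ (i, j):] t" if "i < n" "j < n" for i j t
    using c that by (simp add: \<gamma>_def)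
  obtain N r where "\<forall>t. poly 1 t \<noteq> 0 \<longrightarrow> g (\<gamma> t) * poly 1 t ^ N = poly r t"
    using poly_fun_rational_curve[OF g(1), of 1 \<gamma> "\<lambda>i j. [:A $$ (i, j), B $$ (i, j) - A $$ (i, j):]"] ent by blast
  then have r: "q (\<gamma> t) = poly r t" for t using g(2) \<gamma>c by simp
  have ends: "\<gamma> 0 = A" "\<gamma> 1 = B" using c by (auto simp: \<gamma>_def intro!: eq_matI)
  have P: "\<gamma> t $$ (i, j) * poly r t = poly (r * [:A $$ (i, j), B $$ (i, j) - A $$ (i, j):]) t" if "i < n" "j < n" for i j t
    unfolding poly_mult using ent[OF that, of t] by simp
  show "\<exists>\<gamma> q P. poly q 0 \<noteq> 0 \<and> poly q 1 \<noteq> 0 \<and> \<gamma> 0 = A \<and> \<gamma> 1 = B \<and>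
      (\<forall>t. poly q t \<noteq> 0 \<longrightarrow> \<gamma> t \<in> S \<and> (\<forall>i<n. \<forall>j<n. \<gamma> t $$ (i, j) * poly q t = poly (P i j) t))"
  proof (rule exI[of _ \<gamma>], rule exI[of _ r],
      rule exI[of _ "\<lambda>i j. r * [:A $$ (i, j), B $$ (i, j) - A $$ (i, j):]"], intro conjI allI impI)
    show "poly r 0 \<noteq> 0" "poly r 1 \<noteq> 0" using assms(4)[OF AB(1)] assms(4)[OF AB(2)] r[of 0] r[of 1] ends by simp_all
    show "\<gamma> t \<in> S" if "poly r t \<noteq> 0" for t
      using line[OF AB, of t] that r[of t] unfolding \<gamma>_def by simp
  qed (use ends P in blast)+
qed

lemma supp_mat_line:
  "A \<in> supp_mat n E \<Longrightarrow> B \<in> supp_mat n E \<Longrightarrow> A + t \<cdot>\<^sub>m (B - A) \<in> supp_mat n E"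
  by (auto simp: supp_mat_def)

lemma irreducible_supp_mat_nonvanishing:
  assumes "pfun n q" "X \<in> supp_mat n E" "q X \<noteq> 0"
  shows "irreducible_in (zariski n) {X \<in> supp_mat n E. q X \<noteq> 0}"
proof (rule irreducible_in_linear[OF _ _ assms(1)])
  show "{X \<in> supp_mat n E. q X \<noteq> 0} \<subseteq> carrier_mat n n" by (auto simp: supp_mat_def)
  show "{X \<in> supp_mat n E. q X \<noteq> 0} \<noteq> {}" using assms(2,3) by blast
qed (simp_all add: supp_mat_line)

lemma irreducible_supp_mat: "irreducible_in (zariski n) (supp_mat n E)"
proof -
  have "0\<^sub>m n n \<in> supp_mat n E" by (auto simp: supp_mat_def)
  then show ?thesis using irreducible_supp_mat_nonvanishing[OF pfun_const[of n 1], of "0\<^sub>m n n" E] by simp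
qed

lemma irreducible_piece: "irreducible_in (zariski n) (piece n \<kappa>)"
  unfolding piece_def by (rule irreducible_in_pmap_image[OF irreducible_supp_mat pmap_piece_map])

lemma upper_part_rad: "upper_part n \<kappa> X \<in> rad n (\<lambda>i. i)"
  by (auto simp: upper_part_def rad_def)

lemma piece_map_rad_id: "piece_map n \<kappa> X \<in> rad n (\<lambda>i. i)"
  unfolding piece_map_conj by (rule rad_conj_by[OF base_change_par upper_part_rad])

lemma piece_carrier: "piece n \<kappa> \<subseteq> carrier_mat n n"
  using piece_map_rad_id rad_carrier by (fastforce simp: piece_def)

text \<open>If \<open>\<kappa>\<close> decreases along every block then no entry of \<open>upper_part\<close> lies inside a block.\<close>

lemma piece_map_rad:
  assumes \<beta>: "mono \<beta>" and \<kappa>: "\<forall>i j. i < j \<longrightarrow> j < n \<longrightarrow> \<beta> i = \<beta> j \<longrightarrow> \<kappa> j \<le> \<kappa> i"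
  shows "piece_map n \<kappa> X \<in> rad n \<beta>"
  unfolding piece_map_conj
proof (rule rad_conj_by[OF par_mono_id[OF \<beta> base_change_par]])
  have "upper_part n \<kappa> X $$ (i, j) = 0" if ij: "i < n" "j < n" "\<beta> j \<le> \<beta> i" for i j
  proof (rule ccontr)
    assume "upper_part n \<kappa> X $$ (i, j) \<noteq> 0"
    then have *: "i < j" "\<kappa> i < \<kappa> j" using ij by (auto simp: upper_part_def split: if_splits)
    then have "\<beta> i = \<beta> j" using ij(3) \<beta> by (simp add: mono_def order_antisym)
    then show False using \<kappa> * ij by (meson leD)
  qed
  then show "upper_part n \<kappa> X \<in> rad n \<beta>" by (simp add: rad_def)
qed

lemma in_piece:
  assumes "Y \<in> rad n (\<lambda>i. i)"
  obtains \<kappa> b N where "Y \<in> piece n \<kappa>" "b \<in> carrier (SL n)" "ker_pattern n \<kappa> N" "N \<in> rad n (\<lambda>i. i)" "Y = conj_by n b N"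
proof -
  obtain \<kappa> b N where b: "b \<in> par n (\<lambda>i. i)" "\<forall>i<n. b $$ (i, i) = 1"
    "\<forall>i<n. \<forall>j<n. i \<noteq> j \<longrightarrow> b $$ (i, j) \<noteq> 0 \<longrightarrow> i < j \<and> \<kappa> j < \<kappa> i"
    and N: "ker_pattern n \<kappa> N" "N \<in> rad n (\<lambda>i. i)" "Y = conj_by n b N"
    by (rule normal_form[OF assms])
  note c = par_carrier[OF b(1)] rad_carrier[OF N(2)]
  define X where "X = mat n n (\<lambda>(i, j). if i < j \<and> \<kappa> j < \<kappa> i then b $$ (i, j) else
    if i < j \<and> \<kappa> i < \<kappa> j then N $$ (i, j) else 0)"
  have "X \<in> supp_mat n (edges n \<kappa>)" by (auto simp: X_def supp_mat_def edges_def)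
  moreover have "base_change n \<kappa> X = b"
  proof (rule eq_matI)
    fix i j assume "i < dim_row b" "j < dim_col b"
    then have "i < n" "j < n" using c by auto
    then show "base_change n \<kappa> X $$ (i, j) = b $$ (i, j)"
      using b(2,3) by (auto simp: base_change_entry X_def)
  qed (use c in \<open>simp_all add: carrier_matD[OF base_change_carrier]\<close>)
  moreover have "upper_part n \<kappa> X = N"
  proof (rule eq_matI)
    fix i j assume "i < dim_row N" "j < dim_col N"
    then have ij: "i < n" "j < n" using c by auto
    then have "N $$ (i, j) = 0" if "\<not> (i < j \<and> \<kappa> i < \<kappa> j)"
      using that ker_pattern_entry[OF N(1) ij] N(2) by (cases "i < j") (auto simp: rad_def)
    then show "upper_part n \<kappa> X $$ (i, j) = N $$ (i, j)"
      using ij by (auto simp: upper_part_def X_def)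
  qed (use c in \<open>simp_all add: carrier_matD[OF upper_part_carrier]\<close>)
  ultimately have "Y \<in> piece n \<kappa>" using N(3) unfolding piece_def piece_map_conj by (intro image_eqI[of _ _ X]) simp_all
  then show thesis by (rule that[OF _ par_SL[OF b(1)] N])
qed

section \<open>Semicontinuity of kernels\<close>

definition proj_mat :: "nat \<Rightarrow> (nat \<Rightarrow> bool) \<Rightarrow> complex mat" where
  "proj_mat n P = mat n n (\<lambda>(i, j). if i = j \<and> P j then 1 else 0)"

lemma proj_mat_carrier [simp]: "proj_mat n P \<in> carrier_mat n n"
  by (simp add: proj_mat_def)

lemma ker_pattern_column:
  assumes N: "ker_pattern n \<kappa> N" and ij: "i < n" "j < n" "\<kappa> j \<le> k"
  shows "(N ^\<^sub>m k) $$ (i, j) = 0"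
proof -
  note p = pow_carrier_mat[OF ker_pattern_carrier[OF N], of k]
  have "(N ^\<^sub>m k) *\<^sub>v unit_vec n j = 0\<^sub>v n"
    using ij by (subst ker_patternD[OF N]) auto
  then have "((N ^\<^sub>m k) *\<^sub>v unit_vec n j) $ i = 0" using ij by simp
  then show ?thesis using ij p by (simp add: index_mult_vec_sum[OF p] if_distrib cong: if_cong)
qed

text \<open>The columns of \<open>N ^\<^sub>m k\<close> of colour at most k vanish, and those of
  larger colour are independent. A left inverse on the latter plus the projection to the former is
  the identity. When N varies, the determinant of this sum is a polynomial whose nonvanishing keeps
  the kernel from growing.\<close>

lemma ker_pattern_left_inverse:
  assumes N: "ker_pattern n \<kappa> N"
  shows "\<exists>C\<in>carrier_mat n n. C * N ^\<^sub>m k + proj_mat n (\<lambda>j. \<kappa> j \<le> k) = 1\<^sub>m n"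
proof -
  note p = pow_carrier_mat[OF ker_pattern_carrier[OF N], of k]
  define J where "J = {j. j < n \<and> k < \<kappa> j}"
  have J: "finite J" by (simp add: J_def)
  have "\<exists>L. \<forall>j\<in>J. \<forall>j'\<in>J. (\<Sum>l\<in>{..<n}. L j l * (N ^\<^sub>m k) $$ (l, j')) = (if j = j' then 1 else 0)"
  proof (rule exists_left_inverse[OF _ J])
    fix c assume c: "\<forall>l\<in>{..<n}. (\<Sum>j\<in>J. (N ^\<^sub>m k) $$ (l, j) * c j) = 0"
    define v where "v = vec n (\<lambda>j. if j \<in> J then c j else 0)"
    have v: "v \<in> carrier_vec n" by (simp add: v_def)
    have "(N ^\<^sub>m k) *\<^sub>v v = 0\<^sub>v n"
    proof (rule eq_vecI)
      fix i assume "i < dim_vec (0\<^sub>v n :: complex vec)"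
      then have i: "i < n" by simp
      have "((N ^\<^sub>m k) *\<^sub>v v) $ i = (\<Sum>j<n. (N ^\<^sub>m k) $$ (i, j) * v $ j)" by (rule index_mult_vec_sum[OF p v i])
      also have "\<dots> = (\<Sum>j\<in>J. (N ^\<^sub>m k) $$ (i, j) * c j)"
        by (rule sum.mono_neutral_cong_right) (auto simp: J_def v_def)
      finally show "((N ^\<^sub>m k) *\<^sub>v v) $ i = 0\<^sub>v n $ i" using c i by simp
    qed (use ker_pattern_carrier[OF N] in simp)
    then have "\<forall>j<n. k < \<kappa> j \<longrightarrow> v $ j = 0" using ker_patternD[OF N v] by simp
    then show "\<forall>j\<in>J. c j = 0" by (auto simp: J_def v_def)
  qed simp
  then obtain L where L: "\<forall>j\<in>J. \<forall>j'\<in>J. (\<Sum>l\<in>{..<n}. L j l * (N ^\<^sub>m k) $$ (l, j')) = (if j = j' then 1 else 0)" ..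
  define C where "C = mat n n (\<lambda>(i, l). if i \<in> J then L i l else 0)"
  have C: "C \<in> carrier_mat n n" by (simp add: C_def)
  have "C * N ^\<^sub>m k + proj_mat n (\<lambda>j. \<kappa> j \<le> k) = 1\<^sub>m n"
  proof (rule eq_matI)
    fix i j assume "i < dim_row (1\<^sub>m n :: complex mat)" "j < dim_col (1\<^sub>m n :: complex mat)"
    then have ij: "i < n" "j < n" by auto
    have "(C * N ^\<^sub>m k) $$ (i, j) = (if i \<in> J then (\<Sum>l<n. L i l * (N ^\<^sub>m k) $$ (l, j)) else 0)"
      unfolding index_mult_sum[OF C p ij] by (auto simp: C_def ij intro: sum.cong)
    also have "\<dots> = (if i = j \<and> i \<in> J then 1 else 0)"
    proof (cases "j \<in> J")
      case True
      then show ?thesis using L by auto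
    next
      case False
      then have "(\<Sum>l<n. L i l * (N ^\<^sub>m k) $$ (l, j)) = 0"
        using ker_pattern_column[OF N _ ij(2)] ij by (intro sum.neutral) (simp add: J_def)
      then show ?thesis using False by auto
    qed
    finally have "(C * N ^\<^sub>m k) $$ (i, j) = (if i = j \<and> i \<in> J then 1 else 0)" .
    moreover have "(C * N ^\<^sub>m k + proj_mat n (\<lambda>j. \<kappa> j \<le> k)) $$ (i, j) =
        (C * N ^\<^sub>m k) $$ (i, j) + proj_mat n (\<lambda>j. \<kappa> j \<le> k) $$ (i, j)"
      by (rule index_add_mat(1)) (simp_all add: ij carrier_matD[OF proj_mat_carrier])
    ultimately show "(C * N ^\<^sub>m k + proj_mat n (\<lambda>j. \<kappa> j \<le> k)) $$ (i, j) = 1\<^sub>m n $$ (i, j)"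
      using ij by (auto simp: proj_mat_def J_def)
  qed (simp_all add: carrier_matD[OF proj_mat_carrier])
  with C show ?thesis by blast
qed

lemma ker_pattern_left_inverses:
  assumes "ker_pattern n \<kappa> N"
  obtains C where "\<forall>k. C k \<in> carrier_mat n n" "\<forall>k. C k * N ^\<^sub>m k + proj_mat n (\<lambda>j. \<kappa> j \<le> k) = 1\<^sub>m n"
proof -
  have "\<forall>k. \<exists>C. C \<in> carrier_mat n n \<and> C * N ^\<^sub>m k + proj_mat n (\<lambda>j. \<kappa> j \<le> k) = 1\<^sub>m n"
    using ker_pattern_left_inverse[OF assms] by blast
  from choice[OF this] show thesis using that by blast
qed

lemma kernel_proj_trivial:
  assumes C: "C \<in> carrier_mat n n" and M: "M \<in> carrier_mat n n" and det: "det (C * M + proj_mat n P) \<noteq> 0"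
    and v: "v \<in> carrier_vec n" "M *\<^sub>v v = 0\<^sub>v n" "\<And>i. i < n \<Longrightarrow> P i \<Longrightarrow> v $ i = 0"
  shows "v = 0\<^sub>v n"
proof (rule invertible_mult_vec_zero[OF _ det v(1)])
  show CM: "C * M + proj_mat n P \<in> carrier_mat n n" by simp
  have "(C * M + proj_mat n P) *\<^sub>v v = (C * M) *\<^sub>v v + proj_mat n P *\<^sub>v v"
    by (rule add_mult_distrib_mat_vec[OF mult_carrier_mat[OF C M] proj_mat_carrier v(1)])
  also have "(C * M) *\<^sub>v v = 0\<^sub>v n"
    using assoc_mult_mat_vec[OF C M v(1)] v(2) mult_mat_vec_zero[OF C] by simp
  also have "proj_mat n P *\<^sub>v v = 0\<^sub>v n"
  proof (rule eq_vecI)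
    fix i assume "i < dim_vec (0\<^sub>v n :: complex vec)"
    then have i: "i < n" by simp
    have "(proj_mat n P *\<^sub>v v) $ i = (\<Sum>k<n. if k = i then (if P i then v $ i else 0) else 0)"
      unfolding index_mult_vec_sum[OF proj_mat_carrier v(1) i]
      by (rule sum.cong) (use i in \<open>auto simp: proj_mat_def\<close>)
    then show "(proj_mat n P *\<^sub>v v) $ i = 0\<^sub>v n $ i" using i v(3) by simp
  qed (simp add: proj_mat_def)
  finally show "(C * M + proj_mat n P) *\<^sub>v v = 0\<^sub>v n" by simp
qed

lemma pfun_det_ker_pattern:
  assumes "\<And>k. C k \<in> carrier_mat n n" "pmap n F"
  shows "pfun n (\<lambda>X. \<Prod>k\<le>n. det (C k * F X ^\<^sub>m k + proj_mat n (P k)))"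
proof (rule pfun_prod, rule pfun_det)
  fix k :: nat
  have "pmap n (\<lambda>X. C k * F X ^\<^sub>m k + proj_mat n (P k))"
    by (intro pmap_add pmap_mult pmap_const assms(1) pmap_pow assms(2) proj_mat_carrier)
  then show "pfun n (\<lambda>X. (C k * F X ^\<^sub>m k + proj_mat n (P k)) $$ (i, j))" if "i < n" "j < n" for i j
    using pmap_entry that by blast
qed simp

text \<open>By the condition on its entries N lowers colours, which puts the coordinate spaces into
  the kernels; the determinants exclude any further kernel vector. Powers up to n suffice because
  all colours are at most n.\<close>

lemma ker_pattern_open:
  assumes N: "N \<in> carrier_mat n n" "\<And>i j. i < n \<Longrightarrow> j < n \<Longrightarrow> N $$ (i, j) \<noteq> 0 \<Longrightarrow> \<kappa> i < \<kappa> j"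
    and \<kappa>: "\<And>j. j < n \<Longrightarrow> 0 < \<kappa> j" "\<And>j. j < n \<Longrightarrow> \<kappa> j \<le> n"
    and C: "\<And>k. C k \<in> carrier_mat n n" and det: "(\<Prod>k\<le>n. det (C k * N ^\<^sub>m k + proj_mat n (\<lambda>j. \<kappa> j \<le> k))) \<noteq> 0"
  shows "ker_pattern n \<kappa> N"
  unfolding ker_pattern_def
proof (intro conjI N(1) allI ballI)
  fix k and v :: "complex vec" assume v: "v \<in> carrier_vec n"
  note p = pow_carrier_mat[OF N(1)]
  have ent: "\<kappa> i + k \<le> \<kappa> j" if "i < n" "j < n" "(N ^\<^sub>m k) $$ (i, j) \<noteq> 0" for i j k
    using that
  proof (induction k arbitrary: j)
    case 0
    then show ?case using N by (auto split: if_splits)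
  next
    case (Suc k)
    have "(N ^\<^sub>m k * N) $$ (i, j) = (\<Sum>l<n. (N ^\<^sub>m k) $$ (i, l) * N $$ (l, j))"
      by (rule index_mult_sum[OF p N(1) Suc.prems(1,2)])
    then have "(\<Sum>l<n. (N ^\<^sub>m k) $$ (i, l) * N $$ (l, j)) \<noteq> 0" using Suc.prems(3) by simp
    then obtain l where "l < n" "(N ^\<^sub>m k) $$ (i, l) * N $$ (l, j) \<noteq> 0"
      by (metis (no_types, lifting) lessThan_iff sum.neutral)
    then show ?case using Suc.IH[of l] Suc.prems N(2)[of l j] by auto
  qed
  have zero: "(N ^\<^sub>m k) *\<^sub>v w = 0\<^sub>v n" if w: "w \<in> carrier_vec n" and z: "\<forall>j<n. k < \<kappa> j \<longrightarrow> w $ j = 0" for w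
  proof (rule eq_vecI)
    fix i assume "i < dim_vec (0\<^sub>v n :: complex vec)"
    then have i: "i < n" by simp
    have "((N ^\<^sub>m k) *\<^sub>v w) $ i = (\<Sum>j<n. (N ^\<^sub>m k) $$ (i, j) * w $ j)" by (rule index_mult_vec_sum[OF p w i])
    also have "\<dots> = 0"
    proof (rule sum.neutral, rule ballI)
      fix j assume "j \<in> {..<n}"
      then show "(N ^\<^sub>m k) $$ (i, j) * w $ j = 0"
        using ent[of i j k] \<kappa>(1)[OF i] i z by (cases "k < \<kappa> j") auto
    qed
    finally show "((N ^\<^sub>m k) *\<^sub>v w) $ i = 0\<^sub>v n $ i" using i by simp
  qed (use N(1) in simp)
  show "(N ^\<^sub>m k) *\<^sub>v v = 0\<^sub>v n \<longleftrightarrow> (\<forall>j<n. k < \<kappa> j \<longrightarrow> v $ j = 0)"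
  proof (cases "k \<le> n")
    case False
    then have *: "\<forall>j<n. k < \<kappa> j \<longrightarrow> v $ j = 0" using \<kappa>(2) by force
    then show ?thesis using zero[OF v *] by simp
  next
    case True
    have "\<forall>j<n. k < \<kappa> j \<longrightarrow> v $ j = 0" if Nv: "(N ^\<^sub>m k) *\<^sub>v v = 0\<^sub>v n"
    proof -
      \<comment> \<open>\<open>w\<close> collects the coordinates of \<open>v\<close> of colour at
        most k. It lies in the kernel, hence so does the rest \<open>u\<close>, and the determinant
        forces \<open>u\<close> to vanish.\<close>
      define w where "w = vec n (\<lambda>j. if \<kappa> j \<le> k then v $ j else 0)"
      define u where "u = v + (- 1) \<cdot>\<^sub>v w"
      have c: "w \<in> carrier_vec n" "u \<in> carrier_vec n" using v by (simp_all add: w_def u_def)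
      have ui: "u $ i = (if \<kappa> i \<le> k then 0 else v $ i)" if "i < n" for i
        using v c that by (simp add: u_def w_def)
      have "(N ^\<^sub>m k) *\<^sub>v w = 0\<^sub>v n" by (rule zero[OF c(1)]) (simp add: w_def)
      then have "(N ^\<^sub>m k) *\<^sub>v u = 0\<^sub>v n"
        unfolding u_def mult_mat_vec_diff_smult[OF p v c(1)] Nv by auto
      moreover have "det (C k * N ^\<^sub>m k + proj_mat n (\<lambda>j. \<kappa> j \<le> k)) \<noteq> 0" using det True by auto
      ultimately have "u = 0\<^sub>v n" using kernel_proj_trivial[OF C p _ c(2)] ui by auto
      then show ?thesis using ui by force
    qed
    then show ?thesis using zero[OF v] by blast
  qed
qed

text \<open>The kernel of \<open>Z ^\<^sub>m k\<close> is the image under g of a coordinate space of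
  dimension \<open>card {j. j < n \<and> \<kappa> j \<le> k}\<close>. If this exceeded the number of
  coordinates in \<open>P\<close>, some nonzero kernel vector would vanish on \<open>P\<close>,
  which the determinant forbids.\<close>

lemma ker_pattern_card_le:
  assumes C: "C \<in> carrier_mat n n" and Z: "Z \<in> carrier_mat n n" and det: "det (C * Z ^\<^sub>m k + proj_mat n P) \<noteq> 0"
    and g: "g \<in> carrier_mat n n" "det g \<noteq> 0" and N: "ker_pattern n \<kappa> N" and eq: "Z * g = g * N"
  shows "card {j. j < n \<and> \<kappa> j \<le> k} \<le> card {j. j < n \<and> P j}"
proof (rule ccontr)
  assume "\<not> ?thesis"
  then have lt: "card {j. j < n \<and> P j} < card {j. j < n \<and> \<kappa> j \<le> k}" by simp
  let ?J = "{j. j < n \<and> \<kappa> j \<le> k}"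
  obtain c where c: "\<exists>j\<in>?J. c j \<noteq> 0" "\<forall>i\<in>{j. j < n \<and> P j}. (\<Sum>j\<in>?J. g $$ (i, j) * c j) = 0"
    using exists_nontrivial_solution[OF _ _ lt, of "\<lambda>i j. g $$ (i, j)"] by auto
  define v where "v = vec n (\<lambda>j. if j \<in> ?J then c j else 0)"
  have v: "v \<in> carrier_vec n" by (simp add: v_def)
  have gv: "g *\<^sub>v v \<in> carrier_vec n" using g v by simp
  note Nc = ker_pattern_carrier[OF N]
  have "(N ^\<^sub>m k) *\<^sub>v v = 0\<^sub>v n" by (subst ker_patternD[OF N v]) (simp add: v_def)
  then have "(Z ^\<^sub>m k) *\<^sub>v (g *\<^sub>v v) = 0\<^sub>v n" using intertwine_kernel[OF Z g(1) Nc eq g(2) v] by simp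
  moreover have "(g *\<^sub>v v) $ i = 0" if i: "i < n" "P i" for i
  proof -
    have "(g *\<^sub>v v) $ i = (\<Sum>j<n. g $$ (i, j) * v $ j)" by (rule index_mult_vec_sum[OF g(1) v i(1)])
    also have "\<dots> = (\<Sum>j\<in>?J. g $$ (i, j) * c j)"
      by (rule sum.mono_neutral_cong_right) (auto simp: v_def)
    finally show ?thesis using c(2) i by simp
  qed
  ultimately have "g *\<^sub>v v = 0\<^sub>v n" by (intro kernel_proj_trivial[OF C pow_carrier_mat[OF Z] det gv])
  then have "v = 0\<^sub>v n" by (rule invertible_mult_vec_zero[OF g v])
  then have "\<forall>j<n. v $ j = 0" by simp
  then show False using c(1) by (auto simp: v_def)
qed

text \<open>Upper semicontinuity of kernel dimensions: conjugating back by g and testing with the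
  left inverses for the powers of \<open>N\<close> gives one polynomial \<open>q\<close>. Its values
  are considered at conjugates of patterns because every matrix of \<open>nilradical n\<close> is of
  this form.\<close>

lemma ker_pattern_semicontinuous:
  assumes g: "g \<in> carrier (SL n)" and N: "ker_pattern n \<kappa> N"
  obtains q where "pfun n q" "q (conj_by n g N) \<noteq> 0"
    "\<forall>h N' \<kappa>'. h \<in> carrier (SL n) \<longrightarrow> ker_pattern n \<kappa>' N' \<longrightarrow> q (conj_by n h N') \<noteq> 0 \<longrightarrow>
      (\<forall>k\<le>n. card {j. j < n \<and> \<kappa>' j \<le> k} \<le> card {j. j < n \<and> \<kappa> j \<le> k})"
proof -
  obtain C where C: "\<forall>k. C k \<in> carrier_mat n n" "\<forall>k. C k * N ^\<^sub>m k + proj_mat n (\<lambda>j. \<kappa> j \<le> k) = 1\<^sub>m n"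
    by (rule ker_pattern_left_inverses[OF N])
  define F where "F X = conj_by n (adj_mat g) X" for X
  define q where "q X = (\<Prod>k\<le>n. det (C k * F X ^\<^sub>m k + proj_mat n (\<lambda>j. \<kappa> j \<le> k)))" for X
  note Nc = ker_pattern_carrier[OF N]
  have "pmap n F"
    unfolding F_def conj_by_adj[OF SL_adj(5)[OF g]]
    by (intro pmap_mult pmap_const pmap_id SL_adj(2) g SL_adj(5))
  then have "pfun n q" unfolding q_def using C(1) by (intro pfun_det_ker_pattern) simp
  moreover have "q (conj_by n g N) \<noteq> 0"
    unfolding q_def F_def conj_by_adj_inverse[OF g Nc] using C(2) by simp
  moreover have "card {j. j < n \<and> \<kappa>' j \<le> k} \<le> card {j. j < n \<and> \<kappa> j \<le> k}"
    if h: "h \<in> carrier (SL n)" and N': "ker_pattern n \<kappa>' N'" and q: "q (conj_by n h N') \<noteq> 0" and k: "k \<le> n" for h N' \<kappa>' k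
  proof -
    note N'c = ker_pattern_carrier[OF N']
    define e where "e = adj_mat g * h"
    have e: "e \<in> carrier (SL n)" using SL_adj(5)[OF g] h by (auto simp: e_def SL_carrier det_mult)
    have F: "F (conj_by n h N') = conj_by n e N'"
      unfolding F_def e_def by (rule conj_by_conj_by[OF SL_adj(5)[OF g] h N'c])
    have det: "det (C k * conj_by n e N' ^\<^sub>m k + proj_mat n (\<lambda>j. \<kappa> j \<le> k)) \<noteq> 0"
      using q k by (auto simp: q_def F)
    show ?thesis
      by (rule ker_pattern_card_le[OF _ conj_by_carrier[OF e N'c] det _ _ N' conj_by_mult_eq[OF e N'c]])
        (use C(1) e in \<open>auto simp: SL_carrier\<close>)
  qed
  ultimately show thesis using that[of q] by blast
qed

section \<open>Colour counts as orbit invariants\<close>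

lemma same_counts_permutes:
  fixes \<kappa> \<kappa>' :: "nat \<Rightarrow> nat"
  assumes le: "\<forall>j<n. \<kappa> j \<le> n" "\<forall>j<n. \<kappa>' j \<le> n"
    and cards: "\<forall>k\<le>n. card {j. j < n \<and> \<kappa> j \<le> k} = card {j. j < n \<and> \<kappa>' j \<le> k}"
  obtains \<sigma> where "\<sigma> permutes {..<n}" "\<forall>j<n. \<kappa> j = \<kappa>' (\<sigma> j)"
proof -
  have cnt: "count (image_mset \<kappa> (mset_set {..<n})) k = card {j. j < n \<and> \<kappa> j \<le> k} - (if k = 0 then 0 else card {j. j < n \<and> \<kappa> j \<le> k - 1})"
    for \<kappa> :: "nat \<Rightarrow> nat" and k
  proof -
    have "count (image_mset \<kappa> (mset_set {..<n})) k = card {j. j < n \<and> \<kappa> j = k}"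
      by (simp add: count_image_mset_eq_card_vimage)
    also have "{j. j < n \<and> \<kappa> j = k} = {j. j < n \<and> \<kappa> j \<le> k} - (if k = 0 then {} else {j. j < n \<and> \<kappa> j \<le> k - 1})"
      by auto
    also have "card \<dots> = card {j. j < n \<and> \<kappa> j \<le> k} - card (if k = 0 then {} else {j. j < n \<and> \<kappa> j \<le> k - 1})"
      by (rule card_Diff_subset) auto
    finally show ?thesis by (simp split: if_splits)
  qed
  have "count (image_mset \<kappa> (mset_set {..<n})) k = count (image_mset \<kappa>' (mset_set {..<n})) k" for k
  proof (cases "k \<le> n")
    case True
    then have "k - 1 \<le> n" by simp
    then show ?thesis unfolding cnt using cards True by simp
  next
    case False
    have "{j. j < n \<and> \<kappa> j \<le> l} = {..<n}" "{j. j < n \<and> \<kappa>' j \<le> l} = {..<n}" if "n \<le> l" for l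
      using le that by fastforce+
    then show ?thesis unfolding cnt using False by simp
  qed
  then have "image_mset \<kappa> (mset_set {..<n}) = image_mset \<kappa>' (mset_set {..<n})" by (rule multiset_eqI)
  then obtain p where "p permutes {..<n}" "\<forall>x\<in>{..<n}. \<kappa> x = \<kappa>' (p x)"
    using image_mset_eq_implies_permutes[of "{..<n}" \<kappa> \<kappa>'] by auto
  then show thesis using that by simp
qed

lemma card_edges_permute:
  assumes \<sigma>: "\<sigma> permutes {..<n}" and eq: "\<forall>j<n. \<kappa> j = \<kappa>' (\<sigma> j)"
  shows "card (edges n \<kappa>) = card (edges n \<kappa>')"
proof -
  \<comment> \<open>\<sigma> does not preserve the order i < j, so ordered pairs are counted, two
    for each edge.\<close>
  define S where "S \<kappa> = {(i, j). i < n \<and> j < n \<and> \<kappa> i \<noteq> \<kappa> j}" for \<kappa> :: "nat \<Rightarrow> nat"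
  have dbl: "card (S \<kappa>) = 2 * card (edges n \<kappa>)" for \<kappa> :: "nat \<Rightarrow> nat"
  proof -
    have "S \<kappa> = edges n \<kappa> \<union> prod.swap ` edges n \<kappa>"
    proof (rule Set.set_eqI)
      fix p
      have "p \<in> prod.swap ` edges n \<kappa> \<longleftrightarrow> prod.swap p \<in> edges n \<kappa>" by (metis image_iff swap_swap)
      then show "p \<in> S \<kappa> \<longleftrightarrow> p \<in> edges n \<kappa> \<union> prod.swap ` edges n \<kappa>"
        by (cases p; cases "fst p" "snd p" rule: linorder_cases) (auto simp: S_def edges_def)
    qed
    moreover have "edges n \<kappa> \<inter> prod.swap ` edges n \<kappa> = {}" by (auto simp: edges_def)
    ultimately show ?thesis
      using finite_edges[of n \<kappa>] by (simp add: card_Un_disjoint card_image)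
  qed
  have \<sigma>n: "\<sigma> i < n \<longleftrightarrow> i < n" for i using permutes_in_image[OF \<sigma>, of i] by simp
  have "bij_betw (map_prod \<sigma> \<sigma>) (S \<kappa>) (S \<kappa>')"
  proof (rule bij_betwI')
    fix x y assume "x \<in> S \<kappa>" "y \<in> S \<kappa>"
    show "map_prod \<sigma> \<sigma> x = map_prod \<sigma> \<sigma> y \<longleftrightarrow> x = y"
      using permutes_inj[OF \<sigma>] by (cases x; cases y) (simp add: inj_eq)
  next
    fix x assume "x \<in> S \<kappa>"
    then obtain i j where x: "x = (i, j)" "i < n" "j < n" "\<kappa> i \<noteq> \<kappa> j" unfolding S_def by blast
    then have "\<kappa>' (\<sigma> i) \<noteq> \<kappa>' (\<sigma> j)" using eq[rule_format, of i] eq[rule_format, of j] by simp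
    then show "map_prod \<sigma> \<sigma> x \<in> S \<kappa>'" using x \<sigma>n by (simp add: S_def)
  next
    fix y assume y: "y \<in> S \<kappa>'"
    obtain i where i: "fst y = \<sigma> i" using surjD[OF permutes_surj[OF \<sigma>]] by blast
    obtain j where j: "snd y = \<sigma> j" using surjD[OF permutes_surj[OF \<sigma>]] by blast
    have ij: "y = (\<sigma> i, \<sigma> j)" using i j by (cases y) simp
    then have "i < n" "j < n" "\<kappa>' (\<sigma> i) \<noteq> \<kappa>' (\<sigma> j)" using y \<sigma>n by (simp_all add: S_def)
    then have "(i, j) \<in> S \<kappa>" using eq[rule_format, of i] eq[rule_format, of j] by (simp add: S_def)
    then show "\<exists>x\<in>S \<kappa>. y = map_prod \<sigma> \<sigma> x" using ij by (intro bexI[of _ "(i, j)"]) simp_all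
  qed
  then have "card (S \<kappa>) = card (S \<kappa>')" by (rule bij_betw_same_card)
  then show ?thesis by (simp add: dbl)
qed

section \<open>Pieces of equal dimension\<close>

text \<open>The differential of \<open>piece_map\<close> at N: the commutator of the direction of
  the base change with N, plus the direction of the normal form itself.\<close>

definition piece_tangent :: "nat \<Rightarrow> (nat \<Rightarrow> nat) \<Rightarrow> complex mat \<Rightarrow> complex mat \<Rightarrow> complex mat" where
  "piece_tangent n \<kappa> N Z = lower_part n \<kappa> Z * N + upper_part n \<kappa> Z - N * lower_part n \<kappa> Z"

lemma piece_tangent_carrier: "N \<in> carrier_mat n n \<Longrightarrow> piece_tangent n \<kappa> N Z \<in> carrier_mat n n"
  by (simp add: piece_tangent_def minus_carrier_mat mult_carrier_mat[of _ n n])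

lemma piece_tangent_entry:
  assumes N: "N \<in> carrier_mat n n" and ij: "i < n" "j < n"
  shows "piece_tangent n \<kappa> N Z $$ (i, j) =
    (\<Sum>l<n. lower_part n \<kappa> Z $$ (i, l) * N $$ (l, j)) + upper_part n \<kappa> Z $$ (i, j) -
    (\<Sum>l<n. N $$ (i, l) * lower_part n \<kappa> Z $$ (l, j))"
proof -
  have c: "dim_row (lower_part n \<kappa> Z) = n" "dim_col (lower_part n \<kappa> Z) = n" "dim_row (upper_part n \<kappa> Z) = n"
    "dim_col (upper_part n \<kappa> Z) = n" "dim_row N = n" "dim_col N = n"
    using carrier_matD[OF lower_part_carrier] carrier_matD[OF upper_part_carrier] carrier_matD[OF N] by auto
  have "piece_tangent n \<kappa> N Z $$ (i, j) =
      (lower_part n \<kappa> Z * N) $$ (i, j) + upper_part n \<kappa> Z $$ (i, j) - (N * lower_part n \<kappa> Z) $$ (i, j)"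
    unfolding piece_tangent_def using ij c by (simp del: index_mult_mat(1))
  then show ?thesis
    by (simp only: index_mult_sum[OF lower_part_carrier N ij] index_mult_sum[OF N lower_part_carrier ij])
qed

text \<open>Let L and U be the two parts of Z, so N L = L N + U. By induction on
  \<open>\<kappa> j\<close>, column j of L N involves only columns of L of smaller colour and
  vanishes. So N maps column j of L to column j of U, whose entries have colours below
  \<open>\<kappa> j\<close>. Hence column j of L lies in the kernel of the power
  \<open>\<kappa> j\<close>, while its entries have colours above \<open>\<kappa> j\<close>; so it
  is 0, and then U = 0.\<close>

lemma piece_tangent_injective:
  assumes N: "ker_pattern n \<kappa> N" and zero: "piece_tangent n \<kappa> N Z = 0\<^sub>m n n" and ij: "(i, j) \<in> edges n \<kappa>"
  shows "Z $$ (i, j) = 0"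
proof -
  note Nc = ker_pattern_carrier[OF N]
  have eq: "(\<Sum>l<n. N $$ (i, l) * lower_part n \<kappa> Z $$ (l, j)) =
      (\<Sum>l<n. lower_part n \<kappa> Z $$ (i, l) * N $$ (l, j)) + upper_part n \<kappa> Z $$ (i, j)" if "i < n" "j < n" for i j
    using piece_tangent_entry[OF Nc that, of \<kappa> Z] zero that by simp
  have low: "\<forall>i<n. lower_part n \<kappa> Z $$ (i, j) = 0" if "j < n" for j
    using that
  proof (induction "\<kappa> j" arbitrary: j rule: less_induct)
    case less
    define v where "v = vec n (\<lambda>i. lower_part n \<kappa> Z $$ (i, j))"
    have v: "v \<in> carrier_vec n" by (simp add: v_def)
    have "(\<Sum>l<n. lower_part n \<kappa> Z $$ (i, l) * N $$ (l, j)) = 0" if i: "i < n" for i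
    proof (rule sum.neutral, rule ballI)
      fix l assume l: "l \<in> {..<n}"
      show "lower_part n \<kappa> Z $$ (i, l) * N $$ (l, j) = 0"
      proof (cases "N $$ (l, j) = 0")
        case False
        then have "\<kappa> l < \<kappa> j" using ker_pattern_entry[OF N _ less.prems] l by auto
        then show ?thesis using less.hyps[of l] l i by simp
      qed simp
    qed
    then have Nv: "(N *\<^sub>v v) $ i = upper_part n \<kappa> Z $$ (i, j)" if "i < n" for i
      unfolding index_mult_vec_sum[OF Nc v that] using eq[OF that less.prems] that by (simp add: v_def)
    obtain m where m: "\<kappa> j = Suc m" using ker_pattern_pos[OF N less.prems] by (cases "\<kappa> j") auto
    have Nvc: "N *\<^sub>v v \<in> carrier_vec n" using Nc v by simp
    have "(N ^\<^sub>m m) *\<^sub>v (N *\<^sub>v v) = 0\<^sub>v n"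
      unfolding ker_patternD[OF N Nvc]
    proof (intro allI impI)
      fix i assume "i < n" "m < \<kappa> i"
      then show "(N *\<^sub>v v) $ i = 0" unfolding Nv[OF \<open>i < n\<close>] using m less.prems by (simp add: upper_part_def)
    qed
    then have "(N ^\<^sub>m Suc m) *\<^sub>v v = 0\<^sub>v n"
      using assoc_mult_mat_vec[OF pow_carrier_mat[OF Nc] Nc v, of m] by simp
    then have *: "\<forall>i<n. Suc m < \<kappa> i \<longrightarrow> v $ i = 0" using ker_patternD[OF N v, of "Suc m"] by blast
    show ?case
    proof (intro allI impI)
      fix i assume i: "i < n"
      show "lower_part n \<kappa> Z $$ (i, j) = 0"
        using * i m less.prems by (cases "\<kappa> j < \<kappa> i") (auto simp: v_def lower_part_def)
    qed
  qed
  have ij': "i < j" "i < n" "j < n" "\<kappa> i \<noteq> \<kappa> j" using ij by (auto simp: edges_def)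
  show ?thesis
  proof (cases "\<kappa> j < \<kappa> i")
    case True
    then show ?thesis using low[rule_format, OF ij'(3,2)] ij' by (simp add: lower_part_def)
  next
    case False
    have "upper_part n \<kappa> Z $$ (i, j) = 0" using eq[OF ij'(2,3)] low ij' by simp
    then show ?thesis using False ij' by (auto simp: upper_part_def)
  qed
qed

lemma sum_edges:
  "(\<Sum>p\<in>edges n \<kappa>. F p) = (\<Sum>k<n. \<Sum>l<n. if (k, l) \<in> edges n \<kappa> then F (k, l) else (0 :: complex))"
proof -
  have "(\<Sum>p\<in>edges n \<kappa>. F p) = (\<Sum>p\<in>{..<n} \<times> {..<n}. if p \<in> edges n \<kappa> then F p else 0)"
    by (rule sum.mono_neutral_cong_left) (auto simp: edges_def)
  then show ?thesis by (simp only: sum.cartesian_product case_prod_beta' prod.collapse)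
qed

lemma piece_tangent_linear:
  assumes N: "N \<in> carrier_mat n n"
  obtains A where "\<forall>Z. \<forall>i<n. \<forall>j<n. piece_tangent n \<kappa> N Z $$ (i, j) = (\<Sum>e\<in>edges n \<kappa>. A (i, j) e * Z $$ e)"
proof
  define A where "A = (\<lambda>(i, j) (k, l). (if k = i then (if \<kappa> l < \<kappa> k then N $$ (l, j) else 0) else 0)
     + (if k = i then (if l = j \<and> \<kappa> k < \<kappa> l then 1 else 0) else 0)
     - (if l = j then (if \<kappa> l < \<kappa> k then N $$ (i, k) else 0) else 0))"
  show "\<forall>Z. \<forall>i<n. \<forall>j<n. piece_tangent n \<kappa> N Z $$ (i, j) = (\<Sum>e\<in>edges n \<kappa>. A (i, j) e * Z $$ e)"
  proof (intro allI impI)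
    fix Z i j assume ij: "i < n" "j < n"
    have low: "lower_part n \<kappa> Z $$ (k, l) = (if (k, l) \<in> edges n \<kappa> \<and> \<kappa> l < \<kappa> k then Z $$ (k, l) else 0)" if "k < n" "l < n" for k l
      using that by (auto simp: lower_part_def edges_def)
    have up: "upper_part n \<kappa> Z $$ (i, j) = (if (i, j) \<in> edges n \<kappa> \<and> \<kappa> i < \<kappa> j then Z $$ (i, j) else 0)"
      using ij by (auto simp: upper_part_def edges_def)
    have "(\<Sum>e\<in>edges n \<kappa>. A (i, j) e * Z $$ e) =
      (\<Sum>k<n. \<Sum>l<n. if k = i then (if (k, l) \<in> edges n \<kappa> \<and> \<kappa> l < \<kappa> k then Z $$ (k, l) * N $$ (l, j) else 0) else 0)
      + (\<Sum>k<n. \<Sum>l<n. if k = i then (if l = j then (if (k, l) \<in> edges n \<kappa> \<and> \<kappa> k < \<kappa> l then Z $$ (k, l) else 0) else 0) else 0)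
      - (\<Sum>k<n. \<Sum>l<n. if l = j then (if (k, l) \<in> edges n \<kappa> \<and> \<kappa> l < \<kappa> k then N $$ (i, k) * Z $$ (k, l) else 0) else 0)"
      unfolding sum_edges sum.distrib[symmetric] sum_subtractf[symmetric]
      by (intro sum.cong refl) (auto simp: A_def algebra_simps)
    also have "(\<Sum>k<n. \<Sum>l<n. if k = i then (if (k, l) \<in> edges n \<kappa> \<and> \<kappa> l < \<kappa> k then Z $$ (k, l) * N $$ (l, j) else 0) else 0)
        = (\<Sum>l<n. lower_part n \<kappa> Z $$ (i, l) * N $$ (l, j))"
      by (subst sum.swap) (use ij low in \<open>auto intro!: sum.cong\<close>)
    also have "(\<Sum>k<n. \<Sum>l<n. if k = i then (if l = j then (if (k, l) \<in> edges n \<kappa> \<and> \<kappa> k < \<kappa> l then Z $$ (k, l) else 0) else 0) else 0)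
        = upper_part n \<kappa> Z $$ (i, j)"
      by (subst sum.swap) (use ij up in simp)
    also have "(\<Sum>k<n. \<Sum>l<n. if l = j then (if (k, l) \<in> edges n \<kappa> \<and> \<kappa> l < \<kappa> k then N $$ (i, k) * Z $$ (k, l) else 0) else 0)
        = (\<Sum>k<n. N $$ (i, k) * lower_part n \<kappa> Z $$ (k, j))"
      by (use ij low in \<open>auto intro!: sum.cong\<close>)
    finally show "piece_tangent n \<kappa> N Z $$ (i, j) = (\<Sum>e\<in>edges n \<kappa>. A (i, j) e * Z $$ e)"
      unfolding piece_tangent_entry[OF N ij] by simp
  qed
qed

text \<open>These linear functionals recover the parameters from a tangent vector; they will serve
  as local coordinates of the piece at \<open>N\<close>.\<close>

lemma piece_tangent_left_inverse:
  assumes N: "ker_pattern n \<kappa> N"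
  obtains L where "\<forall>Z. \<forall>e\<in>edges n \<kappa>. (\<Sum>p\<in>{..<n} \<times> {..<n}. L e p * piece_tangent n \<kappa> N Z $$ p) = Z $$ e"
proof -
  note Nc = ker_pattern_carrier[OF N]
  obtain A where A: "\<forall>Z. \<forall>i<n. \<forall>j<n. piece_tangent n \<kappa> N Z $$ (i, j) = (\<Sum>e\<in>edges n \<kappa>. A (i, j) e * Z $$ e)"
    by (rule piece_tangent_linear[OF Nc])
  have "\<exists>L. \<forall>e\<in>edges n \<kappa>. \<forall>e'\<in>edges n \<kappa>. (\<Sum>p\<in>{..<n} \<times> {..<n}. L e p * A p e') = (if e = e' then 1 else 0)"
  proof (rule exists_left_inverse[OF _ finite_edges])
    fix c assume c: "\<forall>p\<in>{..<n} \<times> {..<n}. (\<Sum>e\<in>edges n \<kappa>. A p e * c e) = 0"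
    define Z where "Z = mat n n c"
    have Zc: "Z $$ e = c e" if "e \<in> edges n \<kappa>" for e using that by (auto simp: Z_def edges_def)
    have "piece_tangent n \<kappa> N Z = 0\<^sub>m n n"
    proof (rule eq_matI)
      fix i j assume "i < dim_row (0\<^sub>m n n :: complex mat)" "j < dim_col (0\<^sub>m n n :: complex mat)"
      then have ij: "i < n" "j < n" by auto
      have "piece_tangent n \<kappa> N Z $$ (i, j) = (\<Sum>e\<in>edges n \<kappa>. A (i, j) e * c e)"
        using A ij Zc by simp
      then show "piece_tangent n \<kappa> N Z $$ (i, j) = 0\<^sub>m n n $$ (i, j)" using c ij by simp
    qed (use piece_tangent_carrier[OF Nc] in auto)
    then show "\<forall>e\<in>edges n \<kappa>. c e = 0" using piece_tangent_injective[OF N] Zc by fastforce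
  qed simp
  then obtain L where L: "\<forall>e\<in>edges n \<kappa>. \<forall>e'\<in>edges n \<kappa>. (\<Sum>p\<in>{..<n} \<times> {..<n}. L e p * A p e') = (if e = e' then 1 else 0)" ..
  have "(\<Sum>p\<in>{..<n} \<times> {..<n}. L e p * piece_tangent n \<kappa> N Z $$ p) = Z $$ e" if e: "e \<in> edges n \<kappa>" for Z e
  proof -
    have "(\<Sum>p\<in>{..<n} \<times> {..<n}. L e p * piece_tangent n \<kappa> N Z $$ p)
        = (\<Sum>p\<in>{..<n} \<times> {..<n}. \<Sum>e'\<in>edges n \<kappa>. L e p * A p e' * Z $$ e')"
      by (rule sum.cong) (use A in \<open>auto simp: sum_distrib_left mult.assoc\<close>)
    also have "\<dots> = (\<Sum>e'\<in>edges n \<kappa>. (\<Sum>p\<in>{..<n} \<times> {..<n}. L e p * A p e') * Z $$ e')"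
      by (subst sum.swap) (simp add: sum_distrib_right)
    also have "\<dots> = (\<Sum>e'\<in>edges n \<kappa>. if e' = e then Z $$ e else 0)"
      by (rule sum.cong) (use L e in auto)
    finally show ?thesis using e finite_edges by simp
  qed
  then show thesis using that by blast
qed

lemma add_zero_smult:
  fixes A :: "complex mat"
  assumes A: "A \<in> carrier_mat n m" and B: "B \<in> carrier_mat n m" shows "A + 0 \<cdot>\<^sub>m B = A"
  by (rule eq_matI) (simp_all add: carrier_matD[OF A] carrier_matD[OF B])

lemma piece_map_curve:
  assumes N: "ker_pattern n \<kappa> N" and Nr: "N \<in> rad n (\<lambda>i. i)" and Z: "Z \<in> carrier_mat n n"
  shows "mat_deriv n (\<lambda>t. piece_map n \<kappa> (N + t \<cdot>\<^sub>m Z)) (piece_tangent n \<kappa> N Z)"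
    and "piece_map n \<kappa> N = N"
proof -
  note Nc = ker_pattern_carrier[OF N]
  let ?lo = "lower_part n \<kappa>" and ?up = "upper_part n \<kappa>" and ?bc = "base_change n \<kappa>"
  have N0: "N $$ (i, j) = 0" if "i < n" "j < n" "\<not> (i < j \<and> \<kappa> i < \<kappa> j)" for i j
    using that ker_pattern_entry[OF N that(1,2)] Nr by (cases "i < j") (auto simp: rad_def)
  have loN: "?lo (N + t \<cdot>\<^sub>m Z) = t \<cdot>\<^sub>m ?lo Z" for t
    using N0 Nc Z by (intro eq_matI) (auto simp: lower_part_def)
  have upN: "?up (N + t \<cdot>\<^sub>m Z) = N + t \<cdot>\<^sub>m ?up Z" for t
    using N0 Nc Z by (intro eq_matI) (auto simp: upper_part_def)
  have bcN: "?bc (N + t \<cdot>\<^sub>m Z) = 1\<^sub>m n + t \<cdot>\<^sub>m ?lo Z" for t by (simp add: base_change_def loN)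
  have N00: "N + 0 \<cdot>\<^sub>m Z = N" by (rule add_zero_smult[OF Nc Z])
  have at0: "?up N = N" "?bc N = 1\<^sub>m n" using upN[of 0] bcN[of 0] unfolding N00
    by (simp_all only: add_zero_smult[OF Nc upper_part_carrier] add_zero_smult[OF one_carrier_mat lower_part_carrier])
  have adj1: "adj_mat (1\<^sub>m n) = (1\<^sub>m n :: complex mat)"
  proof -
    have "(1\<^sub>m n :: complex mat) \<in> carrier (SL n)" by (simp add: SL_carrier)
    from SL_adj(2,3)[OF this] show ?thesis by simp
  qed
  show "piece_map n \<kappa> N = N" unfolding piece_map_def at0 adj1 using Nc by simp
  have d1: "mat_deriv n (\<lambda>t. ?bc (N + t \<cdot>\<^sub>m Z)) (?lo Z)"
    unfolding bcN by (rule mat_deriv_line) auto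
  have d2: "mat_deriv n (\<lambda>t. ?up (N + t \<cdot>\<^sub>m Z)) (?up Z)"
    unfolding upN by (rule mat_deriv_line) (use Nc in auto)
  obtain H where d3: "mat_deriv n (\<lambda>t. adj_mat (?bc (N + t \<cdot>\<^sub>m Z))) H"
    by (rule pmap_mat_deriv[OF pmap_adj d1])
  have Hc: "H \<in> carrier_mat n n" by (rule mat_derivD(2)[OF d3])
  \<comment> \<open>The derivative \<open>H\<close> of the inverse is found by differentiating the
    product of the base change with its inverse at t = 0.\<close>
  have "?bc (N + t \<cdot>\<^sub>m Z) * adj_mat (?bc (N + t \<cdot>\<^sub>m Z)) = 1\<^sub>m n" for t
    by (rule SL_adj(3)[OF par_SL[OF base_change_par]])
  then have "mat_deriv n (\<lambda>t. 1\<^sub>m n) (?lo Z * adj_mat (?bc (N + 0 \<cdot>\<^sub>m Z)) + ?bc (N + 0 \<cdot>\<^sub>m Z) * H)"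
    using mat_deriv_mult[OF d1 d3] by simp
  then have "?lo Z * adj_mat (?bc (N + 0 \<cdot>\<^sub>m Z)) + ?bc (N + 0 \<cdot>\<^sub>m Z) * H = 0\<^sub>m n n"
    by (rule mat_deriv_unique) (rule mat_deriv_const, simp)
  then have eq0: "?lo Z + H = 0\<^sub>m n n" using Hc by (simp add: N00 at0 adj1 right_mult_one_mat[OF lower_part_carrier])
  have H: "H $$ (i, j) = - ?lo Z $$ (i, j)" if "i < n" "j < n" for i j
  proof -
    have "(?lo Z + H) $$ (i, j) = 0" unfolding eq0 using that by simp
    then show ?thesis using that Hc by (simp add: eq_neg_iff_add_eq_0 add.commute)
  qed
  have NH: "N * H = - (N * ?lo Z)"
  proof (rule eq_matI)
    fix i j assume "i < dim_row (- (N * ?lo Z))" "j < dim_col (- (N * ?lo Z))"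
    then have ij: "i < n" "j < n" using Nc lower_part_carrier[of n \<kappa> Z] by auto
    have "(N * H) $$ (i, j) = - (\<Sum>l<n. N $$ (i, l) * ?lo Z $$ (l, j))"
      unfolding index_mult_sum[OF Nc Hc ij] using H ij by (simp add: sum_negf)
    also have "\<dots> = - ((N * ?lo Z) $$ (i, j))" by (simp only: index_mult_sum[OF Nc lower_part_carrier ij])
    finally show "(N * H) $$ (i, j) = (- (N * ?lo Z)) $$ (i, j)"
      using ij Nc carrier_matD[OF lower_part_carrier[of n \<kappa> Z]] by (simp del: index_mult_mat(1))
  qed (use Nc Hc carrier_matD[OF lower_part_carrier[of n \<kappa> Z]] in auto)
  have "mat_deriv n (\<lambda>t. piece_map n \<kappa> (N + t \<cdot>\<^sub>m Z))
      ((?lo Z * ?up (N + 0 \<cdot>\<^sub>m Z) + ?bc (N + 0 \<cdot>\<^sub>m Z) * ?up Z) * adj_mat (?bc (N + 0 \<cdot>\<^sub>m Z))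
        + ?bc (N + 0 \<cdot>\<^sub>m Z) * ?up (N + 0 \<cdot>\<^sub>m Z) * H)"
    unfolding piece_map_def by (rule mat_deriv_mult[OF mat_deriv_mult[OF d1 d2] d3])
  moreover have "(?lo Z * ?up (N + 0 \<cdot>\<^sub>m Z) + ?bc (N + 0 \<cdot>\<^sub>m Z) * ?up Z) * adj_mat (?bc (N + 0 \<cdot>\<^sub>m Z))
        + ?bc (N + 0 \<cdot>\<^sub>m Z) * ?up (N + 0 \<cdot>\<^sub>m Z) * H = piece_tangent n \<kappa> N Z"
  proof -
    have c: "?lo Z * N + ?up Z \<in> carrier_mat n n" using upper_part_carrier by (rule add_carrier_mat)
    show ?thesis
      unfolding N00 at0 adj1 piece_tangent_def left_mult_one_mat[OF upper_part_carrier] left_mult_one_mat[OF Nc]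
        right_mult_one_mat[OF c] NH
      by (rule add_uminus_minus_mat[OF c mult_carrier_mat[OF Nc lower_part_carrier]])
  qed
  ultimately show "mat_deriv n (\<lambda>t. piece_map n \<kappa> (N + t \<cdot>\<^sub>m Z)) (piece_tangent n \<kappa> N Z)" by simp
qed

text \<open>If \<open>f\<close> vanishes on the first piece but not on the second, then \<open>f\<close> and the coordinates of
  the first piece are more functions than the second piece has parameters. Cancelling the
  largest power of \<open>f\<close> from a polynomial relation between them leaves a relation between the coordinates
  of the first piece.\<close>

lemma vanishing_on_pieces:
  assumes N: "ker_pattern n \<kappa> N" and Nr: "N \<in> rad n (\<lambda>i. i)"
    and card: "card (edges n \<kappa>) = card (edges n \<kappa>')"
    and closure: "\<And>f. pfun n f \<Longrightarrow> \<forall>Y\<in>piece n \<kappa>'. f Y = 0 \<Longrightarrow> \<forall>Y\<in>piece n \<kappa>. f Y = 0"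
    and f: "pfun n f" and f0: "\<forall>Y\<in>piece n \<kappa>. f Y = 0"
  shows "\<forall>Y\<in>piece n \<kappa>'. f Y = 0"
proof (rule ccontr)
  assume not: "\<not> ?thesis"
  note Nc = ker_pattern_carrier[OF N]
  let ?B = "{..<n} \<times> {..<n}"
  obtain L where L: "\<forall>Z. \<forall>e\<in>edges n \<kappa>. (\<Sum>p\<in>?B. L e p * piece_tangent n \<kappa> N Z $$ p) = Z $$ e"
    by (rule piece_tangent_left_inverse[OF N])
  \<comment> \<open>\<open>Some e\<close> stands for a local coordinate of the first piece at
    \<open>N\<close>, \<open>None\<close> for \<open>f\<close> itself.\<close>
  define g where "g a Y = (case a of None \<Rightarrow> f Y | Some e \<Rightarrow> \<Sum>p\<in>?B. L e p * (Y $$ p - N $$ p))" for a Y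
  have g: "pfun n (g a)" for a
  proof (cases a)
    case None
    then have "g a = f" by (intro ext) (simp add: g_def)
    then show ?thesis using f by simp
  next
    case (Some e)
    have "pfun n (\<lambda>Y. \<Sum>p\<in>?B. L e p * (Y $$ p - N $$ p))"
      by (intro pfun_sum pfun_mult pfun_const pfun_diff) (auto intro: pfun_coord)
    moreover have "g a = (\<lambda>Y. \<Sum>p\<in>?B. L e p * (Y $$ p - N $$ p))" using Some by (intro ext) (simp add: g_def)
    ultimately show ?thesis by simp
  qed
  let ?A = "insert None (Some ` edges n \<kappa>)"
  have A: "finite ?A" "card (edges n \<kappa>') < card ?A"
    using finite_edges[of n \<kappa>] card by (simp_all add: card_image)
  obtain d c where c: "\<exists>k\<in>PiE ?A (\<lambda>_. {..d}). c k \<noteq> (0 :: complex)"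
    and rel: "\<forall>X\<in>supp_mat n (edges n \<kappa>'). (\<Sum>k\<in>PiE ?A (\<lambda>_. {..d}). c k * (\<Prod>a\<in>?A. g a (piece_map n \<kappa>' X) ^ k a)) = 0"
    by (rule algebraically_dependent[OF finite_edges A, of n "\<lambda>a X. g a (piece_map n \<kappa>' X)"])
      (rule pfun_comp[OF g pmap_piece_map])
  let ?K = "PiE ?A (\<lambda>_. {..d})"
  \<comment> \<open>\<open>s\<close> is the least exponent of \<open>f\<close> in the relation, and
    \<open>R\<close> below is the relation divided by \<open>f ^ s\<close>. It vanishes on the
    second piece, which is irreducible and on which \<open>f\<close> is not identically 0.\<close>
  define s where "s = (LEAST s. \<exists>k\<in>?K. c k \<noteq> 0 \<and> k None = s)"
  obtain k1 where "k1 \<in> ?K" "c k1 \<noteq> 0" using c by blast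
  then have "\<exists>k\<in>?K. c k \<noteq> 0 \<and> k None = k1 None" by blast
  from LeastI[of "\<lambda>s. \<exists>k\<in>?K. c k \<noteq> 0 \<and> k None = s", OF this]
  have "\<exists>k\<in>?K. c k \<noteq> 0 \<and> k None = s" unfolding s_def .
  then obtain k0 where k0: "k0 \<in> ?K" "c k0 \<noteq> 0" "k0 None = s" by blast
  have s_le: "s \<le> k None" if "k \<in> ?K" "c k \<noteq> 0" for k
    unfolding s_def by (rule Least_le) (use that in blast)
  define u where "u k Y = (\<Prod>e\<in>edges n \<kappa>. g (Some e) Y ^ k (Some e))" for k Y
  have prodA: "(\<Prod>a\<in>?A. h a) = h None * (\<Prod>e\<in>edges n \<kappa>. h (Some e))" for h :: "(nat \<times> nat) option \<Rightarrow> complex"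
    using finite_edges[of n \<kappa>] by (simp add: prod.reindex)
  define R where "R Y = (\<Sum>k\<in>?K. c k * (f Y ^ (k None - s) * u k Y))" for Y
  have R: "pfun n R"
    unfolding R_def u_def by (intro pfun_sum pfun_mult pfun_const pfun_power f pfun_prod g)
  have "f Y ^ s * R Y = (\<Sum>k\<in>?K. c k * (\<Prod>a\<in>?A. g a Y ^ k a))" for Y
    unfolding R_def sum_distrib_left
  proof (rule sum.cong[OF refl])
    fix k assume k: "k \<in> ?K"
    show "f Y ^ s * (c k * (f Y ^ (k None - s) * u k Y)) = c k * (\<Prod>a\<in>?A. g a Y ^ k a)"
    proof (cases "c k = 0")
      case False
      have "f Y ^ s * f Y ^ (k None - s) = f Y ^ k None" using s_le[OF k False] by (simp flip: power_add)
      moreover have "f Y ^ s * (c k * (f Y ^ (k None - s) * u k Y)) = c k * ((f Y ^ s * f Y ^ (k None - s)) * u k Y)"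
        by (simp add: mult_ac)
      ultimately show ?thesis unfolding prodA by (simp add: g_def u_def)
    qed simp
  qed
  then have "\<And>Y. Y \<in> piece n \<kappa>' \<Longrightarrow> f Y ^ s * R Y = 0" using rel by (auto simp: piece_def)
  from irreducible_in_mult_zero[OF irreducible_piece pfun_power[OF f] R this]
  have "(\<forall>Y\<in>piece n \<kappa>'. f Y ^ s = 0) \<or> (\<forall>Y\<in>piece n \<kappa>'. R Y = 0)" by blast
  then have "\<forall>Y\<in>piece n \<kappa>'. R Y = 0" using not by auto
  then have R0: "\<forall>Y\<in>piece n \<kappa>. R Y = 0" by (rule closure[OF R])
  \<comment> \<open>On the first piece \<open>f\<close> is 0, so only the terms with exponent
    exactly \<open>s\<close> survive in \<open>R\<close>.\<close>
  define c' where "c' k = (if k None = s then c k else 0)" for k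
  have u0: "(\<Sum>k\<in>?K. c' k * u k Y) = 0" if Y: "Y \<in> piece n \<kappa>" for Y
  proof -
    have "R Y = (\<Sum>k\<in>?K. c' k * u k Y)"
      unfolding R_def
    proof (rule sum.cong[OF refl])
      fix k assume k: "k \<in> ?K"
      show "c k * (f Y ^ (k None - s) * u k Y) = c' k * u k Y"
        using s_le[OF k] f0 Y by (cases "c k = 0"; cases "k None = s") (auto simp: c'_def)
    qed
    then show ?thesis using R0 Y by simp
  qed
  have "c' k0 = 0"
  proof (rule no_relation_if_free_tangents[OF A(1) _ k0(1)])
    fix y :: "(nat \<times> nat) option \<Rightarrow> complex"
    define Z where "Z = mat n n (\<lambda>p. if p \<in> edges n \<kappa> then y (Some p) else 0)"
    have Z: "Z \<in> carrier_mat n n" by (simp add: Z_def)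
    have Zs: "N + t \<cdot>\<^sub>m Z \<in> supp_mat n (edges n \<kappa>)" for t
      using Nc ker_pattern_entry[OF N] Nr unfolding supp_mat_def
      by (auto simp: Z_def edges_def rad_def) (metis less_irrefl not_le)
    define Y where "Y t = piece_map n \<kappa> (N + t \<cdot>\<^sub>m Z)" for t
    have YP: "Y t \<in> piece n \<kappa>" for t unfolding Y_def piece_def using Zs by blast
    have N00: "N + 0 \<cdot>\<^sub>m Z = N" by (rule add_zero_smult[OF Nc Z])
    have Y0: "Y 0 = N" by (simp add: Y_def N00 piece_map_curve(2)[OF N Nr Z])
    have Yd: "mat_deriv n Y (piece_tangent n \<kappa> N Z)" unfolding Y_def by (rule piece_map_curve(1)[OF N Nr Z])
    \<comment> \<open>\<open>f\<close> has disappeared from the relation, and every remaining term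
      may carry the same power \<open>s\<close> of the slot \<open>None\<close>. So this slot is
      filled with \<open>t * y None\<close>, which has the prescribed derivative.\<close>
    define u' where "u' a t = (case a of None \<Rightarrow> t * y None | Some e \<Rightarrow> g (Some e) (Y t))" for a t
    have "u' a 0 = 0 \<and> (u' a has_field_derivative y a) (at 0)" if a: "a \<in> ?A" for a
    proof (cases a)
      case None
      then have "u' a = (\<lambda>t. t * y None)" by (auto simp: u'_def)
      then show ?thesis using None by (auto intro!: derivative_eq_intros)
    next
      case (Some e)
      then have e: "e \<in> edges n \<kappa>" using a by auto
      have eq: "u' a = (\<lambda>t. \<Sum>p\<in>?B. L e p * (Y t $$ p - N $$ p))" using Some by (auto simp: u'_def g_def)
      have "((\<lambda>t. \<Sum>p\<in>?B. L e p * (Y t $$ p - N $$ p)) has_field_derivative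
          (\<Sum>p\<in>?B. L e p * piece_tangent n \<kappa> N Z $$ p)) (at 0)"
      proof (rule DERIV_sum)
        fix p assume "p \<in> ?B"
        then obtain i j where p: "p = (i, j)" "i < n" "j < n" by auto
        show "((\<lambda>t. L e p * (Y t $$ p - N $$ p)) has_field_derivative L e p * piece_tangent n \<kappa> N Z $$ p) (at 0)"
          unfolding p(1) using mat_derivD(3)[OF Yd p(2,3)] by (auto intro!: derivative_eq_intros)
      qed
      moreover have "Z $$ e = y a" using e Some by (auto simp: Z_def edges_def)
      ultimately show ?thesis unfolding eq using L e Y0 by simp
    qed
    moreover have "(\<Sum>k\<in>?K. c' k * (\<Prod>a\<in>?A. u' a t ^ k a)) = 0" for t
    proof -
      have "(\<Sum>k\<in>?K. c' k * (\<Prod>a\<in>?A. u' a t ^ k a)) = (\<Sum>k\<in>?K. c' k * u k (Y t) * (t * y None) ^ s)"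
        unfolding prodA by (rule sum.cong) (auto simp: c'_def u'_def u_def)
      also have "\<dots> = 0" using u0[OF YP] by (simp flip: sum_distrib_right)
      finally show ?thesis .
    qed
    ultimately show "\<exists>u. (\<forall>a\<in>?A. u a 0 = 0 \<and> (u a has_field_derivative y a) (at 0)) \<and>
        (\<forall>t. (\<Sum>k\<in>?K. c' k * (\<Prod>a\<in>?A. u a t ^ k a)) = 0)" by blast
  qed
  then show False using k0 by (simp add: c'_def)
qed

section \<open>Orbits and their components\<close>

definition orbit :: "nat \<Rightarrow> complex mat \<Rightarrow> complex mat set" where
  "orbit n X = sweep n (carrier (SL n)) {X}"

lemma orbit_iff: "Y \<in> orbit n X \<longleftrightarrow> (\<exists>g\<in>carrier (SL n). Y = conj_by n g X)"
  by (auto simp: orbit_def sweep_def)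

lemma SL_times: "g \<in> carrier (SL n) \<Longrightarrow> h \<in> carrier (SL n) \<Longrightarrow> g * h \<in> carrier (SL n)"
  by (auto simp: SL_carrier det_mult)

lemma orbit_conj:
  assumes X: "X \<in> carrier_mat n n" and g: "g \<in> carrier (SL n)" and Y: "Y \<in> orbit n X"
  shows "conj_by n g Y \<in> orbit n X"
proof -
  obtain h where h: "h \<in> carrier (SL n)" "Y = conj_by n h X" using Y by (auto simp: orbit_iff)
  show ?thesis unfolding orbit_iff h(2) conj_by_conj_by[OF g h(1) X] using SL_times[OF g h(1)] by blast
qed

lemma orbit_refl: "X \<in> carrier_mat n n \<Longrightarrow> X \<in> orbit n X"
  unfolding orbit_iff by (rule bexI[of _ "1\<^sub>m n"]) (simp_all add: conj_by_one SL_carrier)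

lemma orbit_carrier: "X \<in> carrier_mat n n \<Longrightarrow> Y \<in> orbit n X \<Longrightarrow> Y \<in> carrier_mat n n"
  by (auto simp: orbit_iff conj_by_carrier)

lemma orbit_sym:
  assumes X: "X \<in> carrier_mat n n" and Y: "Y \<in> orbit n X" shows "X \<in> orbit n Y"
proof -
  obtain h where h: "h \<in> carrier (SL n)" "Y = conj_by n h X" using Y by (auto simp: orbit_iff)
  then show ?thesis unfolding orbit_iff using conj_by_adj_inverse(1)[OF h(1) X] SL_adj(5)[OF h(1)] by force
qed

lemma orbit_eq:
  assumes X: "X \<in> carrier_mat n n" and Y: "Y \<in> orbit n X" shows "orbit n Y = orbit n X"
proof -
  have sub: "orbit n B \<subseteq> orbit n A" if "A \<in> carrier_mat n n" "B \<in> orbit n A" for A B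
    using orbit_conj[OF that(1) _ that(2)] by (auto simp: orbit_iff)
  show ?thesis using sub[OF X Y] sub[OF orbit_carrier[OF X Y] orbit_sym[OF X Y]] by blast
qed

lemma similar_imp_orbit:
  assumes n: "n \<ge> 1" and A: "A \<in> carrier_mat n n" and sim: "similar_mat A B" shows "A \<in> orbit n B"
proof -
  obtain m P Q where c: "{A, B, P, Q} \<subseteq> carrier_mat m m" and PQ: "P * Q = 1\<^sub>m m" "Q * P = 1\<^sub>m m" "A = P * B * Q"
    using similar_matD[OF sim] by blast
  have m: "m = n" using A c by auto
  have c: "B \<in> carrier_mat n n" "P \<in> carrier_mat n n" "Q \<in> carrier_mat n n" using c m by auto
  have "A * P = P * B * (Q * P)" unfolding PQ(3) by (rule assoc_mult_mat[OF mult_carrier_mat[OF c(2,1)] c(3,2)])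
  then have AP: "A * P = P * B" using PQ(2) c m by simp
  have "det P * det Q = 1" using det_mult[OF c(2,3)] PQ(1) m by simp
  then have "det P \<noteq> 0" by auto
  then obtain e where e: "det (e \<cdot>\<^sub>m P) = 1" by (rule scale_to_det_one[OF n c(2)])
  have g: "e \<cdot>\<^sub>m P \<in> carrier (SL n)" unfolding SL_carrier using e c(2) by simp
  have "A = conj_by n (e \<cdot>\<^sub>m P) B" by (rule conj_by_eqI(1)[OF g A c(1) intertwine_smult[OF A c(1,2) AP]])
  then show ?thesis unfolding orbit_iff using g by blast
qed

lemma ker_pattern_nilpotent:
  assumes N: "ker_pattern n \<kappa> N" and \<kappa>: "\<forall>j<n. \<kappa> j \<le> n" shows "N ^\<^sub>m n = 0\<^sub>m n n"
  using ker_pattern_column[OF N, of _ _ n] \<kappa> pow_carrier_mat[OF ker_pattern_carrier[OF N], of n] ker_pattern_carrier[OF N]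
  by (intro eq_matI) auto

lemma ker_pattern_conj:
  assumes n: "n \<ge> 1" and N: "ker_pattern n \<kappa> N" and N': "ker_pattern n \<kappa> N'" and \<kappa>: "\<forall>j<n. \<kappa> j \<le> n"
  shows "N \<in> orbit n N'"
proof (rule similar_imp_orbit[OF n ker_pattern_carrier[OF N]])
  note c = ker_pattern_carrier[OF N] ker_pattern_carrier[OF N']
  show "similar_mat N N'"
  proof (rule nilpotent_similar_if_kernels_eq[OF c ker_pattern_nilpotent[OF N \<kappa>] ker_pattern_nilpotent[OF N' \<kappa>]])
    fix m
    show "mat_kernel (N ^\<^sub>m m) = mat_kernel (N' ^\<^sub>m m)"
      unfolding mat_kernel[OF pow_carrier_mat[OF c(1)]] mat_kernel[OF pow_carrier_mat[OF c(2)]]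
      using ker_patternD[OF N] ker_patternD[OF N'] by auto
  qed
qed

lemma ker_pattern_cong:
  assumes "\<forall>j<n. \<kappa> j = \<kappa>' j" "ker_pattern n \<kappa> N" shows "ker_pattern n \<kappa>' N"
  using assms unfolding ker_pattern_def by simp

lemma ker_pattern_orbit:
  assumes n: "n \<ge> 1" and N: "ker_pattern n \<kappa> N" "\<forall>j<n. \<kappa> j \<le> n" and N': "ker_pattern n \<kappa>' N'" "\<forall>j<n. \<kappa>' j \<le> n"
    and cards: "\<forall>k\<le>n. card {j. j < n \<and> \<kappa> j \<le> k} = card {j. j < n \<and> \<kappa>' j \<le> k}"
  shows "N \<in> orbit n N'"
proof -
  note c = ker_pattern_carrier[OF N(1)] ker_pattern_carrier[OF N'(1)]
  obtain \<sigma> where \<sigma>: "\<sigma> permutes {..<n}" "\<forall>j<n. \<kappa> j = \<kappa>' (\<sigma> j)"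
    by (rule same_counts_permutes[OF N(2) N'(2) cards])
  obtain P M where P: "P = mat n n (\<lambda>(i, j). if i = \<sigma> j then 1 else (0 :: complex))" "det P \<noteq> 0"
    and M: "ker_pattern n (\<lambda>j. \<kappa>' (\<sigma> j)) M" and eq: "N' * P = P * M"
    by (rule permute_ker_pattern[OF N'(1) permutes_imp_bij[OF \<sigma>(1)]])
  have Pc: "P \<in> carrier_mat n n" by (simp add: P(1))
  have M': "ker_pattern n \<kappa> M" by (rule ker_pattern_cong[OF _ M]) (use \<sigma>(2) in simp)
  note Mc = ker_pattern_carrier[OF M]
  obtain e where e: "det (e \<cdot>\<^sub>m P) = 1" by (rule scale_to_det_one[OF n Pc P(2)])
  have g: "e \<cdot>\<^sub>m P \<in> carrier (SL n)" unfolding SL_carrier using e Pc by simp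
  have "N' = conj_by n (e \<cdot>\<^sub>m P) M" by (rule conj_by_eqI(1)[OF g c(2) Mc intertwine_smult[OF c(2) Mc Pc eq]])
  then have "N' \<in> orbit n M" unfolding orbit_iff using g by blast
  moreover have "N \<in> orbit n M" by (rule ker_pattern_conj[OF n N(1) M' N(2)])
  ultimately show ?thesis using orbit_eq[OF Mc] by blast
qed

text \<open>A matrix lies in the nonvanishing set of its own test polynomial, so semicontinuity
  applies in both directions.\<close>

lemma orbit_ker_pattern_cards:
  assumes N: "ker_pattern n \<kappa> N" and N': "ker_pattern n \<kappa>' N'" and orb: "N \<in> orbit n N'"
  shows "\<forall>k\<le>n. card {j. j < n \<and> \<kappa> j \<le> k} = card {j. j < n \<and> \<kappa>' j \<le> k}"
proof -
  have le: "\<forall>k\<le>n. card {j. j < n \<and> \<kappa>' j \<le> k} \<le> card {j. j < n \<and> \<kappa> j \<le> k}"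
    if N: "ker_pattern n \<kappa> N" and N': "ker_pattern n \<kappa>' N'" and orb: "N \<in> orbit n N'" for \<kappa> \<kappa>' N N'
  proof -
    have one: "1\<^sub>m n \<in> carrier (SL n)" by (simp add: SL_carrier)
    obtain q where "pfun n q" and q: "q (conj_by n (1\<^sub>m n) N) \<noteq> 0" and
      le: "\<forall>h N' \<kappa>'. h \<in> carrier (SL n) \<longrightarrow> ker_pattern n \<kappa>' N' \<longrightarrow> q (conj_by n h N') \<noteq> 0 \<longrightarrow>
      (\<forall>k\<le>n. card {j. j < n \<and> \<kappa>' j \<le> k} \<le> card {j. j < n \<and> \<kappa> j \<le> k})"
      by (rule ker_pattern_semicontinuous[OF one N])
    obtain h where h: "h \<in> carrier (SL n)" "N = conj_by n h N'" using orb by (auto simp: orbit_iff)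
    have "q N \<noteq> 0" using q conj_by_one[OF ker_pattern_carrier[OF N]] by simp
    then have "q (conj_by n h N') \<noteq> 0" using h(2) by simp
    with le[rule_format, OF h(1) N'] show ?thesis by blast
  qed
  show ?thesis
    using le[OF N N' orb] le[OF N' N orbit_sym[OF ker_pattern_carrier[OF N'] orb]] by (meson order_antisym)
qed

text \<open>The line from A to B keeps the zero pattern but not the determinant. Dividing its first
  row by the determinant restores the latter and gives a rational curve in
  \<open>par n \<beta>\<close>.\<close>

lemma irreducible_par:
  assumes n: "n \<ge> 1" shows "irreducible_in (zariski n) (par n \<beta>)"
proof (rule irreducible_in_if_rational_curves)
  show "par n \<beta> \<subseteq> carrier_mat n n" using par_carrier by blast
  show "par n \<beta> \<noteq> {}" using par_one by blast
  fix A B assume AB: "A \<in> par n \<beta>" "B \<in> par n \<beta>"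
  note c = par_carrier[OF AB(1)] par_carrier[OF AB(2)]
  define M where "M t = A + t \<cdot>\<^sub>m (B - A)" for t
  have Mc: "M t \<in> carrier_mat n n" for t
    unfolding M_def using c by (intro add_carrier_mat smult_carrier_mat minus_carrier_mat)
  define p where "p i j = [:A $$ (i, j), B $$ (i, j) - A $$ (i, j):]" for i j
  have ent: "M t $$ (i, j) = poly (p i j) t" if "i < n" "j < n" for i j t
    using c that by (simp add: M_def p_def)
  have "pfun n det" by (rule pfun_det[of n "\<lambda>X. X" n]) (simp_all add: pfun_coord)
  then obtain g where g: "poly_fun n g" "\<forall>X\<in>carrier_mat n n. det X = g X" by (rule pfunE)
  obtain k q where "\<forall>t. poly 1 t \<noteq> 0 \<longrightarrow> g (M t) * poly 1 t ^ k = poly q t"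
    using poly_fun_rational_curve[OF g(1), of 1 M p] ent by auto
  then have q: "poly q t = det (M t)" for t using g(2) Mc by simp
  define \<gamma> where "\<gamma> t = multrow 0 (1 / poly q t) (M t)" for t
  have \<gamma>c: "\<gamma> t \<in> carrier_mat n n" for t using Mc[of t] by (simp add: \<gamma>_def)
  have \<gamma>ent: "\<gamma> t $$ (i, j) = (if i = 0 then 1 / poly q t else 1) * M t $$ (i, j)" if "i < n" "j < n" for i j t
    using that Mc[of t] by (simp add: \<gamma>_def)
  have ends: "M 0 = A" "M 1 = B" using c by (auto simp: M_def intro!: eq_matI)
  have q01: "poly q 0 = 1" "poly q 1 = 1" using q ends par_SL[OF AB(1)] par_SL[OF AB(2)] by (simp_all add: SL_carrier)
  have \<gamma>01: "\<gamma> 0 = A" "\<gamma> 1 = B"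
    using \<gamma>ent q01 ends c carrier_matD[OF \<gamma>c] by (auto intro!: eq_matI)
  have \<gamma>par: "\<gamma> t \<in> par n \<beta>" if t: "poly q t \<noteq> 0" for t
    unfolding par_def SL_carrier
  proof (intro CollectI conjI allI impI \<gamma>c)
    show "det (\<gamma> t) = 1" unfolding \<gamma>_def using det_multrow[of 0 n "M t" "1 / poly q t"] n Mc t q by simp
    fix i j assume ij: "i < n" "j < n" "\<beta> j < \<beta> i"
    then have "A $$ (i, j) = 0" "B $$ (i, j) = 0" using AB by (simp_all add: par_def)
    then show "\<gamma> t $$ (i, j) = 0" using ij by (simp add: \<gamma>ent ent p_def)
  qed
  have \<gamma>P: "\<gamma> t $$ (i, j) * poly q t = poly (if i = 0 then p i j else p i j * q) t"
    if "poly q t \<noteq> 0" "i < n" "j < n" for t i j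
    using that by (simp add: \<gamma>ent ent)
  show "\<exists>\<gamma> q P. poly q 0 \<noteq> 0 \<and> poly q 1 \<noteq> 0 \<and> \<gamma> 0 = A \<and> \<gamma> 1 = B \<and>
      (\<forall>t. poly q t \<noteq> 0 \<longrightarrow> \<gamma> t \<in> par n \<beta> \<and> (\<forall>i<n. \<forall>j<n. \<gamma> t $$ (i, j) * poly q t = poly (P i j) t))"
    by (rule exI[of _ \<gamma>], rule exI[of _ q], rule exI[of _ "\<lambda>i j. if i = 0 then p i j else p i j * q"])
      (use q01 \<gamma>01 \<gamma>par \<gamma>P in \<open>simp del: poly_mult\<close>)
qed

lemma irreducible_par_sweep:
  assumes n: "n \<ge> 1" and V: "irreducible_in (zariski n) V"
  shows "irreducible_in (zariski n) {conj_by n g v | g v. g \<in> par n \<beta> \<and> v \<in> V}"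
proof -
  have eq: "{conj_by n g v | g v. g \<in> par n \<beta> \<and> v \<in> V} = {g * v * adj_mat g | g v. g \<in> par n \<beta> \<and> v \<in> V}"
    using conj_by_adj[OF par_SL] by metis
  have Vc: "V \<subseteq> carrier_mat n n" using V by (simp add: irreducible_in_def topspace_zariski)
  show ?thesis
    unfolding eq
  proof (rule irreducible_in_sweep[OF irreducible_par[OF n] V])
    show "pmap n (\<lambda>g. g * v * adj_mat g)" if "v \<in> V" for v
      by (intro pmap_mult pmap_id pmap_adj pmap_const) (use that Vc in auto)
    show "pmap n (\<lambda>v. g * v * adj_mat g)" if "g \<in> par n \<beta>" for g
      by (intro pmap_mult pmap_id pmap_const SL_adj(2)[OF par_SL] par_carrier) (rule that)+
  qed
qed

lemma edges_cong: "\<forall>j<n. \<kappa> j = \<kappa>' j \<Longrightarrow> edges n \<kappa> = edges n \<kappa>'"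
  by (auto simp: edges_def)

lemma piece_cong:
  assumes "\<forall>j<n. \<kappa> j = \<kappa>' j" shows "piece n \<kappa> = piece n \<kappa>'"
proof -
  have "lower_part n \<kappa> = lower_part n \<kappa>'" "upper_part n \<kappa> = upper_part n \<kappa>'"
    using assms by (auto simp: lower_part_def upper_part_def intro!: ext eq_matI)
  then have "piece_map n \<kappa> = piece_map n \<kappa>'"
    by (intro ext) (simp add: piece_map_def base_change_def)
  then show ?thesis by (simp add: piece_def edges_cong[OF assms])
qed

text \<open>The component is taken through the normal form \<open>N\<close>, where the differential
  is injective, and reaches X by stability under \<open>par n \<beta>\<close>. The colouring in the
  conclusion records that only finitely many closures occur, which gives the existence of Richardson
  varieties.\<close>

lemma component_through:
  assumes n: "n \<ge> 1" and \<beta>: "mono \<beta>" and X: "X \<in> rad n \<beta>"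
  obtains V \<kappa> where "irreducible_component (zariski n) (orbit n X \<inter> nilradical n) V" "X \<in> V" "V \<subseteq> rad n \<beta>"
    "\<forall>g\<in>par n \<beta>. \<forall>Y\<in>V. conj_by n g Y \<in> V" "\<kappa> \<in> PiE {..<n} (\<lambda>_. {..n})"
    "zariski n closure_of V = zariski n closure_of piece n \<kappa>"
proof -
  note Xc = rad_carrier[OF X]
  obtain g \<kappa> N where g: "g \<in> par n \<beta>" and N: "ker_pattern n \<kappa> N" and N\<beta>: "N \<in> rad n \<beta>"
    and XN: "X = conj_by n g N" and dec: "\<forall>i j. i < j \<longrightarrow> j < n \<longrightarrow> \<beta> i = \<beta> j \<longrightarrow> \<kappa> j \<le> \<kappa> i"
    by (rule block_normal_form[OF n \<beta> X])
  note Nc = ker_pattern_carrier[OF N] and Nr = rad_mono_id[OF \<beta> N\<beta>]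
  have \<kappa>n: "\<forall>j<n. \<kappa> j \<le> n" using ker_pattern_le[OF N rad_pow_n[OF Nr]] by blast
  have orbN: "orbit n X = orbit n N"
    by (rule orbit_eq[OF Nc]) (use XN par_SL[OF g] in \<open>auto simp: orbit_iff\<close>)
  obtain C where C: "\<forall>k. C k \<in> carrier_mat n n" "\<forall>k. C k * N ^\<^sub>m k + proj_mat n (\<lambda>j. \<kappa> j \<le> k) = 1\<^sub>m n"
    by (rule ker_pattern_left_inverses[OF N])
  \<comment> \<open>An open condition on the parameter under which
    \<open>upper_part n \<kappa> Z\<close> again has the kernel pattern \<kappa> and so lies in the
    orbit of \<open>N\<close>.\<close>
  define q where "q Z = (\<Prod>k\<le>n. det (C k * upper_part n \<kappa> Z ^\<^sub>m k + proj_mat n (\<lambda>j. \<kappa> j \<le> k)))" for Z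
  have q: "pfun n q" unfolding q_def by (rule pfun_det_ker_pattern) (use C(1) pmap_upper_part in auto)
  have N0: "N $$ (i, j) = 0" if "i < n" "j < n" "\<not> (i < j \<and> \<kappa> i < \<kappa> j)" for i j
    using that ker_pattern_entry[OF N that(1,2)] Nr by (cases "i < j") (auto simp: rad_def)
  have upN: "upper_part n \<kappa> N = N" using N0 Nc by (intro eq_matI) (auto simp: upper_part_def)
  have Ns: "N \<in> supp_mat n (edges n \<kappa>)" using N0 Nc by (auto simp: supp_mat_def edges_def)
  have qN: "q N \<noteq> 0" unfolding q_def upN using C(2) by simp
  define V0 where "V0 = piece_map n \<kappa> ` {Z \<in> supp_mat n (edges n \<kappa>). q Z \<noteq> 0}"
  have irr0: "irreducible_in (zariski n) V0"
    unfolding V0_def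
    by (rule irreducible_in_pmap_image[OF irreducible_supp_mat_nonvanishing[OF q Ns qN] pmap_piece_map])
  have NV0: "N \<in> V0"
    unfolding V0_def using Ns qN piece_map_curve(2)[OF N Nr Nc] by (intro image_eqI[of _ _ N]) simp_all
  have V0_sub: "V0 \<subseteq> orbit n X \<inter> nilradical n"
  proof
    fix Y assume "Y \<in> V0"
    then obtain Z where Z: "q Z \<noteq> 0" "Y = piece_map n \<kappa> Z" by (auto simp: V0_def)
    have "ker_pattern n \<kappa> (upper_part n \<kappa> Z)"
    proof (rule ker_pattern_open[OF upper_part_carrier])
      show "\<kappa> i < \<kappa> j" if "i < n" "j < n" "upper_part n \<kappa> Z $$ (i, j) \<noteq> 0" for i j
        using that by (auto simp: upper_part_def split: if_splits)
      show "0 < \<kappa> j" if "j < n" for j by (rule ker_pattern_pos[OF N that])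
      show "\<kappa> j \<le> n" if "j < n" for j using \<kappa>n that by blast
      show "C k \<in> carrier_mat n n" for k using C(1) by blast
      show "(\<Prod>k\<le>n. det (C k * upper_part n \<kappa> Z ^\<^sub>m k + proj_mat n (\<lambda>j. \<kappa> j \<le> k))) \<noteq> 0"
        using Z(1) unfolding q_def .
    qed
    then have "upper_part n \<kappa> Z \<in> orbit n N" by (rule ker_pattern_conj[OF n _ N \<kappa>n])
    then have "Y \<in> orbit n N" unfolding Z(2) piece_map_conj by (rule orbit_conj[OF Nc par_SL[OF base_change_par]])
    then show "Y \<in> orbit n X \<inter> nilradical n"
      using piece_map_rad_id Z(2) orbN by (simp add: nilradical_rad)
  qed
  obtain V where V: "irreducible_component (zariski n) (orbit n X \<inter> nilradical n) V" "V0 \<subseteq> V"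
    using irreducible_component_exists[OF irr0 V0_sub] by blast
  have irrV: "irreducible_in (zariski n) V" and V_sub: "V \<subseteq> orbit n X \<inter> nilradical n"
    and V_max: "\<And>W. W \<subseteq> orbit n X \<inter> nilradical n \<Longrightarrow> irreducible_in (zariski n) W \<Longrightarrow> V \<subseteq> W \<Longrightarrow> W = V"
    using V(1) unfolding irreducible_component_def by blast+
  have Vc: "V \<subseteq> carrier_mat n n" using irrV by (simp add: irreducible_in_def topspace_zariski)
  \<comment> \<open>\<open>V0\<close> is dense in the piece: pulled back to the affine parameter
    space, the product of f and \<open>q\<close> vanishes while \<open>q\<close> does not.\<close>
  have van_piece: "\<forall>Y\<in>piece n \<kappa>. f Y = 0" if f: "pfun n f" and f0: "\<forall>Y\<in>V. f Y = 0" for f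
  proof -
    have "(\<forall>Z\<in>supp_mat n (edges n \<kappa>). f (piece_map n \<kappa> Z) = 0) \<or> (\<forall>Z\<in>supp_mat n (edges n \<kappa>). q Z = 0)"
    proof (rule irreducible_in_mult_zero[OF irreducible_supp_mat pfun_comp[OF f pmap_piece_map] q])
      fix Z assume Z: "Z \<in> supp_mat n (edges n \<kappa>)"
      show "f (piece_map n \<kappa> Z) * q Z = 0"
      proof (cases "q Z = 0")
        case False
        then have "piece_map n \<kappa> Z \<in> V" using Z V(2) by (auto simp: V0_def)
        then show ?thesis using f0 by simp
      qed simp
    qed
    then show ?thesis using Ns qN by (auto simp: piece_def)
  qed
  \<comment> \<open>A finite stock of colourings, extensional outside \<open>{..<n}\<close>, with a
    piece through every point of \<open>V\<close>. Colour counts depend only on the orbit, so the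
    number of edges may be fixed.\<close>
  define \<K> where "\<K> = {\<kappa>' \<in> PiE {..<n} (\<lambda>_. {..n}). card (edges n \<kappa>') = card (edges n \<kappa>)}"
  have fin\<K>: "finite \<K>" unfolding \<K>_def by (rule finite_subset[of _ "PiE {..<n} (\<lambda>_. {..n})"]) (auto simp: finite_PiE)
  have cov: "V \<subseteq> \<Union> ((\<lambda>\<kappa>'. zariski n closure_of piece n \<kappa>') ` \<K>)"
  proof
    fix Y assume "Y \<in> V"
    then have Y: "Y \<in> orbit n N" "Y \<in> rad n (\<lambda>i. i)" using V_sub orbN by (auto simp: nilradical_rad)
    obtain \<kappa>1 b N1 where Y1: "Y \<in> piece n \<kappa>1" "b \<in> carrier (SL n)" "ker_pattern n \<kappa>1 N1" "N1 \<in> rad n (\<lambda>i. i)"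
      "Y = conj_by n b N1" by (rule in_piece[OF Y(2)])
    have \<kappa>1n: "\<forall>j<n. \<kappa>1 j \<le> n" using ker_pattern_le[OF Y1(3) rad_pow_n[OF Y1(4)]] by blast
    have "Y \<in> orbit n N1" using Y1 by (auto simp: orbit_iff)
    then have "N1 \<in> orbit n N" using orbit_sym[OF rad_carrier[OF Y1(4)]] orbit_eq[OF Nc Y(1)] by blast
    then obtain \<sigma> where "\<sigma> permutes {..<n}" "\<forall>j<n. \<kappa>1 j = \<kappa> (\<sigma> j)"
      by (rule same_counts_permutes[OF \<kappa>1n \<kappa>n orbit_ker_pattern_cards[OF Y1(3) N]])
    then have card: "card (edges n \<kappa>1) = card (edges n \<kappa>)" by (rule card_edges_permute)
    define \<kappa>2 where "\<kappa>2 = restrict \<kappa>1 {..<n}"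
    have eq: "\<forall>j<n. \<kappa>1 j = \<kappa>2 j" by (simp add: \<kappa>2_def)
    have "\<kappa>2 \<in> PiE {..<n} (\<lambda>_. {..n})" using \<kappa>1n by (auto simp: \<kappa>2_def)
    then have "\<kappa>2 \<in> \<K>" using card edges_cong[OF eq] by (simp add: \<K>_def)
    moreover have "Y \<in> zariski n closure_of piece n \<kappa>2"
      using Y1(1) closure_of_subset[of "piece n \<kappa>2" "zariski n"] piece_carrier[of n \<kappa>2] piece_cong[OF eq]
      by (auto simp: topspace_zariski)
    ultimately show "Y \<in> \<Union> ((\<lambda>\<kappa>'. zariski n closure_of piece n \<kappa>') ` \<K>)" by blast
  qed
  have "\<exists>C\<in>(\<lambda>\<kappa>'. zariski n closure_of piece n \<kappa>') ` \<K>. V \<subseteq> C"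
    by (rule irreducible_in_finite_cover[OF finite_imageI[OF fin\<K>] irrV _ cov]) (use closedin_closure_of in force)
  then obtain \<kappa>' where \<kappa>': "\<kappa>' \<in> \<K>" "V \<subseteq> zariski n closure_of piece n \<kappa>'" by blast
  \<comment> \<open>The piece of \<kappa> lies in the closure of \<open>V\<close>, and
    \<open>V\<close> in that of the piece of \<kappa>'. As both pieces have the same number of
    parameters, a function vanishing on the former vanishes on the latter, hence on
    \<open>V\<close>.\<close>
  have V_van: "f Y = 0" if Y: "Y \<in> V" and f: "pfun n f" and f0: "\<forall>Y\<in>piece n \<kappa>. f Y = 0" for f Y
  proof -
    have "\<forall>Y\<in>piece n \<kappa>'. f Y = 0"
    proof (rule vanishing_on_pieces[OF N Nr _ _ f f0])
      show "card (edges n \<kappa>) = card (edges n \<kappa>')" using \<kappa>'(1) by (simp add: \<K>_def)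
      fix h assume h: "pfun n h" "\<forall>Y\<in>piece n \<kappa>'. h Y = 0"
      have "\<forall>Y\<in>V. h Y = 0" using closure_of_zariski_vanish[OF _ piece_carrier h(1)] h(2) \<kappa>'(2) by blast
      then show "\<forall>Y\<in>piece n \<kappa>. h Y = 0" by (rule van_piece[OF h(1)])
    qed
    then show ?thesis using closure_of_zariski_vanish[OF _ piece_carrier f] \<kappa>'(2) Y by blast
  qed
  have V_clos: "V \<subseteq> zariski n closure_of piece n \<kappa>"
  proof
    fix Y assume Y: "Y \<in> V"
    show "Y \<in> zariski n closure_of piece n \<kappa>"
    proof (rule ccontr)
      assume "Y \<notin> zariski n closure_of piece n \<kappa>"
      then obtain f where f: "pfun n f" "\<And>Y. Y \<in> zariski n closure_of piece n \<kappa> \<Longrightarrow> f Y = 0" "f Y \<noteq> 0"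
        using closedin_zariski_Int_vanishing[OF closedin_closure_of] Y Vc by blast
      have "\<forall>Y\<in>piece n \<kappa>. f Y = 0"
        using f(2) closure_of_subset[of "piece n \<kappa>" "zariski n"] piece_carrier[of n \<kappa>] by (auto simp: topspace_zariski)
      then show False using V_van[OF Y f(1)] f(3) by blast
    qed
  qed
  have clos_V: "piece n \<kappa> \<subseteq> zariski n closure_of V"
  proof
    fix Y assume Y: "Y \<in> piece n \<kappa>"
    show "Y \<in> zariski n closure_of V"
    proof (rule ccontr)
      assume "Y \<notin> zariski n closure_of V"
      then obtain f where f: "pfun n f" "\<And>Y. Y \<in> zariski n closure_of V \<Longrightarrow> f Y = 0" "f Y \<noteq> 0"
        using closedin_zariski_Int_vanishing[OF closedin_closure_of] Y piece_carrier by blast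
      have "\<forall>Y\<in>V. f Y = 0"
        using f(2) closure_of_subset[of V "zariski n"] Vc by (auto simp: topspace_zariski)
      then show False using van_piece[OF f(1)] f(3) Y by blast
    qed
  qed
  have "zariski n closure_of piece n \<kappa> \<subseteq> rad n \<beta>"
    by (rule closure_of_minimal[OF _ closedin_rad]) (use piece_map_rad[OF \<beta> dec] in \<open>auto simp: piece_def\<close>)
  then have V_rad: "V \<subseteq> rad n \<beta>" using V_clos by blast
  have stable: "\<forall>g\<in>par n \<beta>. \<forall>Y\<in>V. conj_by n g Y \<in> V"
  proof -
    \<comment> \<open>The sweep by the irreducible group \<open>par n \<beta>\<close> is
      irreducible. It stays in the orbit and, because \<open>V\<close> lies in
      \<open>rad n \<beta>\<close>, in the nilradical; so maximality of \<open>V\<close> applies to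
      it.\<close>
    define W where "W = {conj_by n g v | g v. g \<in> par n \<beta> \<and> v \<in> V}"
    have "W \<subseteq> orbit n X \<inter> nilradical n"
    proof
      fix Y assume "Y \<in> W"
      then obtain g v where gv: "g \<in> par n \<beta>" "v \<in> V" "Y = conj_by n g v" by (auto simp: W_def)
      then have "Y \<in> rad n (\<lambda>i. i)" using rad_mono_id[OF \<beta> rad_conj_by] V_rad by blast
      moreover have "Y \<in> orbit n X" using gv V_sub orbit_conj[OF Xc par_SL] by blast
      ultimately show "Y \<in> orbit n X \<inter> nilradical n" by (simp add: nilradical_rad)
    qed
    moreover have "irreducible_in (zariski n) W" unfolding W_def by (rule irreducible_par_sweep[OF n irrV])
    moreover have "V \<subseteq> W"
    proof
      fix v assume v: "v \<in> V"
      then have "v = conj_by n (1\<^sub>m n) v" using conj_by_one Vc by auto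
      then show "v \<in> W" using v par_one[of n \<beta>] unfolding W_def by blast
    qed
    ultimately have "W = V" by (rule V_max)
    then show ?thesis unfolding W_def by blast
  qed
  define \<kappa>r where "\<kappa>r = restrict \<kappa> {..<n}"
  have \<kappa>r: "piece n \<kappa> = piece n \<kappa>r" by (rule piece_cong) (simp add: \<kappa>r_def)
  show thesis
  proof (rule that[OF V(1) _ V_rad stable])
    show "X \<in> V" unfolding XN using stable g NV0 V(2) by blast
    show "\<kappa>r \<in> PiE {..<n} (\<lambda>_. {..n})" using \<kappa>n by (auto simp: \<kappa>r_def)
    show "zariski n closure_of V = zariski n closure_of piece n \<kappa>r"
      unfolding \<kappa>r[symmetric]
      by (intro equalityI closure_of_minimal[OF V_clos closedin_closure_of] closure_of_minimal[OF clos_V closedin_closure_of])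
  qed
qed

section \<open>Orbital varieties and the Richardson variety\<close>

lemma nilpotent_orbit_orbit:
  assumes "X \<in> rad n (\<lambda>i. i)" shows "nilpotent_orbit n (orbit n X)"
proof -
  have "X \<in> sl n" using assms by (auto simp: sl_def rad_def trace_def intro!: sum.neutral)
  moreover have "nilpotent_mat n X" using rad_pow_n[OF assms] rad_carrier[OF assms] by (auto simp: nilpotent_mat_def)
  ultimately show ?thesis unfolding nilpotent_orbit_def orbit_def by blast
qed

lemma orbital_varietyE:
  assumes "orbital_variety n V" "X \<in> V"
  shows "irreducible_component (zariski n) (orbit n X \<inter> nilradical n) V" "X \<in> rad n (\<lambda>i. i)"
proof -
  obtain X0 where X0: "X0 \<in> sl n" "irreducible_component (zariski n) (orbit n X0 \<inter> nilradical n) V"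
    using assms(1) unfolding orbital_variety_def nilpotent_orbit_def orbit_def by blast
  have "X0 \<in> carrier_mat n n" using X0 by (simp add: sl_def)
  moreover have X: "X \<in> orbit n X0 \<inter> nilradical n" using X0(2) assms(2) by (auto simp: irreducible_component_def)
  ultimately show "irreducible_component (zariski n) (orbit n X \<inter> nilradical n) V" "X \<in> rad n (\<lambda>i. i)"
    using X0(2) orbit_eq[of X0 n X] by (auto simp: nilradical_rad)
qed

lemma orbital_variety_nonempty: "orbital_variety n V \<Longrightarrow> V \<noteq> {}"
  by (auto simp: orbital_variety_def irreducible_component_def irreducible_in_def)

lemma orbital_variety_subset: "orbital_variety n V \<Longrightarrow> V \<subseteq> rad n (\<lambda>i. i)"
  using orbital_varietyE(2) by blast

lemma rad_supp_mat: "rad n \<beta> = supp_mat n {(i, j). \<beta> i < \<beta> j}"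
  by (auto simp: rad_def supp_mat_def not_less)

text \<open>The open neighbourhood of X given by semicontinuity meets W, because X is in the closure
  of W; so the kernels on W are at most as large as those on V. By symmetry the kernel dimensions
  agree, and with them the orbits.\<close>

lemma dense_orbital_varieties_same_orbit:
  assumes n: "n \<ge> 1" and V: "orbital_variety n V" "zariski n closure_of V = R"
    and W: "orbital_variety n W" "zariski n closure_of W = R" and X: "X \<in> V" and Y: "Y \<in> W"
  shows "orbit n X = orbit n Y"
proof -
  have pat: "\<exists>\<kappa> b N. b \<in> carrier (SL n) \<and> ker_pattern n \<kappa> N \<and> (\<forall>j<n. \<kappa> j \<le> n) \<and> X = conj_by n b N"
    if "X \<in> V" "orbital_variety n V" for X V
  proof -
    have X: "X \<in> rad n (\<lambda>i. i)" using orbital_variety_subset that by blast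
    obtain \<kappa> b N where "b \<in> carrier (SL n)" "ker_pattern n \<kappa> N" "N \<in> rad n (\<lambda>i. i)" "X = conj_by n b N"
      by (rule in_piece[OF X])
    then show ?thesis using ker_pattern_le[OF _ rad_pow_n] by blast
  qed
  obtain \<kappa> b N where N: "b \<in> carrier (SL n)" "ker_pattern n \<kappa> N" "\<forall>j<n. \<kappa> j \<le> n" "X = conj_by n b N"
    using pat[OF X V(1)] by blast
  obtain \<kappa>' b' N' where N': "b' \<in> carrier (SL n)" "ker_pattern n \<kappa>' N'" "\<forall>j<n. \<kappa>' j \<le> n" "Y = conj_by n b' N'"
    using pat[OF Y W(1)] by blast
  have orbN: "orbit n (conj_by n b N) = orbit n N" if "b \<in> carrier (SL n)" "ker_pattern n \<kappa> N" for b N \<kappa>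
    by (rule orbit_eq[OF ker_pattern_carrier[OF that(2)]]) (use that(1) in \<open>auto simp: orbit_iff\<close>)
  have le: "\<forall>k\<le>n. card {j. j < n \<and> \<kappa>' j \<le> k} \<le> card {j. j < n \<and> \<kappa> j \<le> k}"
    if V: "orbital_variety n V" "zariski n closure_of V = R" and W: "orbital_variety n W" "zariski n closure_of W = R"
      and X: "X \<in> V" and Y: "Y \<in> W" and N: "b \<in> carrier (SL n)" "ker_pattern n \<kappa> N" "X = conj_by n b N"
      and N': "b' \<in> carrier (SL n)" "ker_pattern n \<kappa>' N'" "Y = conj_by n b' N'" for V W X Y b b' \<kappa> \<kappa>' N N'
  proof -
    obtain q where q: "pfun n q" "q (conj_by n b N) \<noteq> 0" and
      le: "\<forall>h N' \<kappa>'. h \<in> carrier (SL n) \<longrightarrow> ker_pattern n \<kappa>' N' \<longrightarrow> q (conj_by n h N') \<noteq> 0 \<longrightarrow>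
      (\<forall>k\<le>n. card {j. j < n \<and> \<kappa>' j \<le> k} \<le> card {j. j < n \<and> \<kappa> j \<le> k})"
      by (rule ker_pattern_semicontinuous[OF N(1,2)])
    have c: "V \<subseteq> carrier_mat n n" "W \<subseteq> carrier_mat n n"
      using orbital_variety_subset[OF V(1)] orbital_variety_subset[OF W(1)] rad_carrier by blast+
    have "X \<in> zariski n closure_of W"
      using X closure_of_subset[of V "zariski n"] c V(2) W(2) by (auto simp: topspace_zariski)
    then obtain Y' where Y': "Y' \<in> W" "q Y' \<noteq> 0"
      using closure_of_zariski_vanish[OF _ c(2) q(1)] q(2) N(3) by blast
    obtain \<kappa>1 b1 N1 where N1: "b1 \<in> carrier (SL n)" "ker_pattern n \<kappa>1 N1" "Y' = conj_by n b1 N1"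
      using pat[OF Y'(1) W(1)] by blast
    have "orbit n Y = orbit n Y'"
      using orbital_varietyE(1)[OF W(1) Y] Y'(1) orbit_eq[of Y n Y'] c(2) Y by (auto simp: irreducible_component_def)
    then have "orbit n N1 = orbit n N'" using orbN[OF N1(1,2)] orbN[OF N'(1,2)] N1(3) N'(3) by simp
    then have "N1 \<in> orbit n N'" using orbit_refl[OF ker_pattern_carrier[OF N1(2)]] by blast
    from orbit_ker_pattern_cards[OF N1(2) N'(2) this] show ?thesis
      using le[rule_format, OF N1(1,2)] Y'(2) N1(3) by simp
  qed
  have "\<forall>k\<le>n. card {j. j < n \<and> \<kappa> j \<le> k} = card {j. j < n \<and> \<kappa>' j \<le> k}"
    using le[OF V W X Y N(1,2,4) N'(1,2,4)] le[OF W V Y X N'(1,2,4) N(1,2,4)] by (meson order_antisym)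
  then have "N \<in> orbit n N'" by (rule ker_pattern_orbit[OF n N(2,3) N'(2,3)])
  then have "orbit n N = orbit n N'" by (rule orbit_eq[OF ker_pattern_carrier[OF N'(2)]])
  then show ?thesis using orbN[OF N(1,2)] orbN[OF N'(1,2)] N(4) N'(4) by simp
qed

text \<open>Existence: the irreducible space \<open>rad n \<beta>\<close> is covered by finitely
  many closures of orbital varieties inside it, so one closure is everything. Uniqueness: two dense
  orbital varieties belong to the same orbit, and each equals the intersection \<open>M\<close> of
  that orbit with \<open>rad n \<beta>\<close>, since \<open>M\<close> lies between it and its
  closure and is therefore irreducible.\<close>

lemma richardson_unique_existence:
  assumes n: "n \<ge> 1" and \<beta>: "mono \<beta>"
  shows "\<exists>!V. orbital_variety n V \<and> zariski n closure_of V = rad n \<beta>"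
proof (rule ex_ex1I)
  define \<A> where "\<A> = {zariski n closure_of V | V. orbital_variety n V \<and> V \<subseteq> rad n \<beta> \<and>
    (\<exists>\<kappa>\<in>PiE {..<n} (\<lambda>_. {..n}). zariski n closure_of V = zariski n closure_of piece n \<kappa>)}"
  have "\<A> \<subseteq> (\<lambda>\<kappa>. zariski n closure_of piece n \<kappa>) ` PiE {..<n} (\<lambda>_. {..n})"
    unfolding \<A>_def by blast
  then have fin: "finite \<A>" by (rule finite_subset) (simp add: finite_PiE)
  have cover: "rad n \<beta> \<subseteq> \<Union>\<A>"
  proof
    fix X assume X: "X \<in> rad n \<beta>"
    obtain V \<kappa> where V: "irreducible_component (zariski n) (orbit n X \<inter> nilradical n) V" "X \<in> V" "V \<subseteq> rad n \<beta>"
      "\<forall>g\<in>par n \<beta>. \<forall>Y\<in>V. conj_by n g Y \<in> V" "\<kappa> \<in> PiE {..<n} (\<lambda>_. {..n})"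
      "zariski n closure_of V = zariski n closure_of piece n \<kappa>"
      by (rule component_through[OF n \<beta> X])
    have "orbital_variety n V"
      unfolding orbital_variety_def using V(1) nilpotent_orbit_orbit[OF rad_mono_id[OF \<beta> X]] by blast
    then have "zariski n closure_of V \<in> \<A>" unfolding \<A>_def using V(3,5,6) by blast
    moreover have "V \<subseteq> zariski n closure_of V"
      by (rule closure_of_subset) (use V(3) rad_carrier in \<open>auto simp: topspace_zariski\<close>)
    ultimately show "X \<in> \<Union>\<A>" using V(2) by blast
  qed
  have "\<exists>C\<in>\<A>. rad n \<beta> \<subseteq> C"
    by (rule irreducible_in_finite_cover[of _ "zariski n", OF fin _ _ cover])
      (auto simp: \<A>_def rad_supp_mat irreducible_supp_mat)
  then obtain V where V: "orbital_variety n V" "V \<subseteq> rad n \<beta>" "rad n \<beta> \<subseteq> zariski n closure_of V"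
    unfolding \<A>_def by blast
  have "zariski n closure_of V \<subseteq> rad n \<beta>" by (rule closure_of_minimal[OF V(2) closedin_rad])
  then show "\<exists>V. orbital_variety n V \<and> zariski n closure_of V = rad n \<beta>" using V by blast
next
  fix V W
  assume V: "orbital_variety n V \<and> zariski n closure_of V = rad n \<beta>"
    and W: "orbital_variety n W \<and> zariski n closure_of W = rad n \<beta>"
  obtain X Y where X: "X \<in> V" and Y: "Y \<in> W" using orbital_variety_nonempty V W by blast
  have orb: "orbit n X = orbit n Y"
    using dense_orbital_varieties_same_orbit[OF n _ _ _ _ X Y] V W by blast
  define M where "M = orbit n X \<inter> rad n \<beta>"
  have eqM: "V = M" if V: "orbital_variety n V" "zariski n closure_of V = rad n \<beta>" and X': "X' \<in> V" "orbit n X' = orbit n X" for V X'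
  proof -
    note comp = orbital_varietyE(1)[OF V(1) X'(1)]
    have irr: "irreducible_in (zariski n) V" using comp by (simp add: irreducible_component_def)
    have "V \<subseteq> zariski n closure_of V"
      by (rule closure_of_subset) (use irr in \<open>simp add: irreducible_in_def\<close>)
    then have sub: "V \<subseteq> M" using comp X'(2) V(2) unfolding M_def irreducible_component_def by blast
    moreover have "irreducible_in (zariski n) M"
      by (rule irreducible_in_between[OF irr sub]) (use V(2) in \<open>simp add: M_def\<close>)
    moreover have "M \<subseteq> orbit n X' \<inter> nilradical n"
      using X'(2) rad_mono_id[OF \<beta>] by (auto simp: M_def nilradical_rad)
    ultimately show ?thesis using comp unfolding irreducible_component_def by blast
  qed
  show "V = W" using eqM[of V X] eqM[of W Y] V W X Y orb by simp
qed

section \<open>Lie algebras of parabolic subgroups\<close>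

text \<open>In the Leibniz formula a permutation other than the identity moves at least two points,
  so after one factor is differentiated there remains another off-diagonal entry of the identity
  matrix.\<close>

lemma det_deriv_at_one:
  assumes X: "X \<in> carrier_mat n n"
  shows "((\<lambda>t. det (1\<^sub>m n + t \<cdot>\<^sub>m X)) has_field_derivative trace X) (at 0)"
proof -
  let ?M = "\<lambda>t. 1\<^sub>m n + t \<cdot>\<^sub>m X"
  let ?P = "{p. p permutes {0..<n}}"
  have c: "?M t \<in> carrier_mat n n" for t using X by simp
  have deriv: "((\<lambda>t. \<Prod>i\<in>{0..<n}. ?M t $$ (i, p i)) has_field_derivative
      (\<Sum>i\<in>{0..<n}. X $$ (i, p i) * (\<Prod>j\<in>{0..<n} - {i}. ?M 0 $$ (j, p j)))) (at 0)" if p: "p \<in> ?P" for p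
  proof (rule has_field_derivative_prod)
    fix i assume "i \<in> {0..<n}"
    then have i: "i < n" "p i < n" using p permutes_in_image[of p "{0..<n}" i] by auto
    then show "((\<lambda>t. ?M t $$ (i, p i)) has_field_derivative X $$ (i, p i)) (at 0)"
      by (rule mat_derivD(3)[OF mat_deriv_line[OF one_carrier_mat X]])
  qed
  have summand: "(\<Sum>i\<in>{0..<n}. X $$ (i, p i) * (\<Prod>j\<in>{0..<n} - {i}. ?M 0 $$ (j, p j))) = (if p = id then trace X else 0)"
    if p: "p \<in> ?P" for p
  proof (cases "p = id")
    case True
    have "(\<Prod>j\<in>{0..<n} - {i}. ?M 0 $$ (j, j)) = 1" for i
      by (rule prod.neutral) (use X in auto)
    then show ?thesis using True X by (simp add: trace_def atLeast0LessThan)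
  next
    case False
    have "(\<Prod>j\<in>{0..<n} - {i}. ?M 0 $$ (j, p j)) = 0" if i: "i \<in> {0..<n}" for i
    proof -
      have inj: "inj p" using p by (simp add: permutes_inj)
      obtain k where k: "p k \<noteq> k" using False by (metis eq_id_iff)
      have "\<exists>j. j \<in> {0..<n} \<and> j \<noteq> i \<and> p j \<noteq> j"
      proof (cases "k = i")
        case True
        have "p (p k) \<noteq> p k" using k inj by (simp add: inj_eq)
        moreover have "p k \<in> {0..<n}" using i True p permutes_in_image[of p "{0..<n}"] by simp
        ultimately show ?thesis using k True by blast
      next
        case False
        moreover have "k \<in> {0..<n}" using k p permutes_not_in[of p "{0..<n}" k] by blast
        ultimately show ?thesis using k by blast
      qed
      then obtain j where j: "j \<in> {0..<n}" "j \<noteq> i" "p j \<noteq> j" by blast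
      then have "j < n" "p j < n" using p permutes_in_image[of p "{0..<n}" j] by auto
      then have "?M 0 $$ (j, p j) = 0" using j X by simp
      then show ?thesis using j by (intro prod_zero) auto
    qed
    then show ?thesis using False by (simp add: sum.neutral)
  qed
  have "((\<lambda>t. \<Sum>p\<in>?P. signof p * (\<Prod>i\<in>{0..<n}. ?M t $$ (i, p i))) has_field_derivative
      (\<Sum>p\<in>?P. signof p * (if p = id then trace X else 0))) (at 0)"
  proof (rule DERIV_sum)
    fix p assume p: "p \<in> ?P"
    show "((\<lambda>t. signof p * (\<Prod>i\<in>{0..<n}. ?M t $$ (i, p i))) has_field_derivative
        signof p * (if p = id then trace X else 0)) (at 0)"
      using DERIV_cmult[OF deriv[OF p]] unfolding summand[OF p] .
  qed
  moreover have "(\<Sum>p\<in>?P. signof p * (if p = id then trace X else 0)) = (\<Sum>p\<in>?P. if p = id then trace X else 0)"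
    by (rule sum.cong) (auto simp: sign_id)
  moreover have "\<dots> = trace X" using finite_permutations[of "{0..<n}"] permutes_id[of "{0..<n}"] by simp
  ultimately show ?thesis unfolding det_def'[OF c] by simp
qed

definition par_algebra :: "nat \<Rightarrow> (nat \<Rightarrow> nat) \<Rightarrow> complex mat set" where
  "par_algebra n \<beta> = {X \<in> sl n. \<forall>i<n. \<forall>j<n. \<beta> j < \<beta> i \<longrightarrow> X $$ (i, j) = 0}"

lemma lie_algebraD:
  "X \<in> lie_algebra n H \<Longrightarrow> poly_fun n f \<Longrightarrow> (\<And>h. h \<in> H \<Longrightarrow> f h = 0) \<Longrightarrow>
    ((\<lambda>t. f (1\<^sub>m n + t \<cdot>\<^sub>m X)) has_field_derivative 0) (at 0)"
  by (simp add: lie_algebra_def)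

lemma lie_algebra_carrier: "X \<in> lie_algebra n H \<Longrightarrow> X \<in> carrier_mat n n"
  by (simp add: lie_algebra_def)

lemma lie_algebra_entry:
  assumes X: "X \<in> lie_algebra n H" and ij: "i < n" "j < n" and H: "\<And>h. h \<in> H \<Longrightarrow> h $$ (i, j) = c"
  shows "X $$ (i, j) = 0"
proof -
  note Xc = lie_algebra_carrier[OF X]
  have "poly_fun n (\<lambda>X. X $$ (i, j) + (- c))" by (intro poly_fun.add poly_fun.coord poly_fun.const ij)
  from lie_algebraD[OF X this]
  have "((\<lambda>t. (1\<^sub>m n + t \<cdot>\<^sub>m X) $$ (i, j) + (- c)) has_field_derivative 0) (at 0)" using H by simp
  moreover have "((\<lambda>t. (1\<^sub>m n + t \<cdot>\<^sub>m X) $$ (i, j) + (- c)) has_field_derivative X $$ (i, j) + 0) (at 0)"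
    by (intro DERIV_add DERIV_const mat_derivD(3)[OF mat_deriv_line[OF one_carrier_mat Xc] ij])
  ultimately show ?thesis using DERIV_unique by fastforce
qed

text \<open>One inclusion differentiates the equations of the group. For the other, the line
  \<open>1 + t X\<close> may leave SL_n; dividing its first row by the determinant gives a curve
  that lies in the group near t = 0 and still has velocity X, because the determinant has derivative
  trace X = 0 there. A function vanishing on the group is locally 0 along this curve, and its
  derivative depends only on the velocity.\<close>

lemma lie_algebra_par:
  assumes n: "n \<ge> 1" shows "lie_algebra n (par n \<beta>) = par_algebra n \<beta>"
proof
  show "lie_algebra n (par n \<beta>) \<subseteq> par_algebra n \<beta>"
  proof
    fix X assume X: "X \<in> lie_algebra n (par n \<beta>)"
    note Xc = lie_algebra_carrier[OF X]
    have "X $$ (i, j) = 0" if "i < n" "j < n" "\<beta> j < \<beta> i" for i j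
      by (rule lie_algebra_entry[OF X that(1,2)]) (use that in \<open>simp add: par_def\<close>)
    moreover have "trace X = 0"
    proof -
      have "pfun n det" by (rule pfun_det[of n "\<lambda>X. X" n]) (simp_all add: pfun_coord)
      then obtain f where f: "poly_fun n f" "\<forall>X\<in>carrier_mat n n. det X = f X" by (rule pfunE)
      have "poly_fun n (\<lambda>X. f X + (- 1))" by (intro poly_fun.add poly_fun.const f)
      moreover have "f h + (- 1) = 0" if "h \<in> par n \<beta>" for h
        using f(2) par_carrier[OF that] par_SL[OF that] by (simp add: SL_carrier)
      ultimately have "((\<lambda>t. f (1\<^sub>m n + t \<cdot>\<^sub>m X) + (- 1)) has_field_derivative 0) (at 0)"
        by (rule lie_algebraD[OF X])
      then have "((\<lambda>t. det (1\<^sub>m n + t \<cdot>\<^sub>m X) + (- 1)) has_field_derivative 0) (at 0)" using f(2) Xc by simp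
      moreover have "((\<lambda>t. det (1\<^sub>m n + t \<cdot>\<^sub>m X) + (- 1)) has_field_derivative trace X + 0) (at 0)"
        by (intro DERIV_add DERIV_const det_deriv_at_one Xc)
      ultimately show ?thesis using DERIV_unique by fastforce
    qed
    ultimately show "X \<in> par_algebra n \<beta>" using Xc by (simp add: par_algebra_def sl_def)
  qed
  show "par_algebra n \<beta> \<subseteq> lie_algebra n (par n \<beta>)"
  proof
    fix X assume X: "X \<in> par_algebra n \<beta>"
    then have Xc: "X \<in> carrier_mat n n" and tr: "trace X = 0" by (auto simp: par_algebra_def sl_def)
    define M where "M t = 1\<^sub>m n + t \<cdot>\<^sub>m X" for t
    define \<gamma> where "\<gamma> t = multrow 0 (1 / det (M t)) (M t)" for t
    have Mc: "M t \<in> carrier_mat n n" for t using Xc by (simp add: M_def)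
    have M0: "M 0 = 1\<^sub>m n" unfolding M_def by (rule add_zero_smult[OF one_carrier_mat Xc])
    have Md: "mat_deriv n M X" unfolding M_def by (rule mat_deriv_line[OF one_carrier_mat Xc])
    have dd: "((\<lambda>t. det (M t)) has_field_derivative 0) (at 0)"
      using det_deriv_at_one[OF Xc] tr by (simp add: M_def)
    have \<gamma>ent: "\<gamma> t $$ (i, j) = (if i = 0 then 1 / det (M t) else 1) * M t $$ (i, j)" if "i < n" "j < n" for i j t
      using that Mc[of t] by (simp add: \<gamma>_def)
    have \<gamma>0: "\<gamma> 0 = M 0" using \<gamma>ent[of _ _ 0] Mc[of 0] by (intro eq_matI) (auto simp: M0 \<gamma>_def)
    have \<gamma>d: "mat_deriv n \<gamma> X"
      unfolding mat_deriv_def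
    proof (intro conjI allI impI Xc)
      show "\<gamma> t \<in> carrier_mat n n" for t using Mc[of t] by (simp add: \<gamma>_def)
      fix i j assume ij: "i < n" "j < n"
      have "((\<lambda>t. 1 / det (M t)) has_field_derivative 0) (at 0)"
        by (rule derivative_eq_intros dd | simp add: M0)+
      then have "((\<lambda>t. (if i = 0 then 1 / det (M t) else 1)) has_field_derivative 0) (at 0)" by (cases "i = 0") auto
      from DERIV_mult[OF this mat_derivD(3)[OF Md ij]]
      show "((\<lambda>t. \<gamma> t $$ (i, j)) has_field_derivative X $$ (i, j)) (at 0)"
        unfolding \<gamma>ent[OF ij] by (simp add: M0 split: if_splits)
    qed
    have \<gamma>par: "\<gamma> t \<in> par n \<beta>" if t: "det (M t) \<noteq> 0" for t
      unfolding par_def SL_carrier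
    proof (intro CollectI conjI allI impI)
      show "\<gamma> t \<in> carrier_mat n n" using Mc[of t] by (simp add: \<gamma>_def)
      show "det (\<gamma> t) = 1" unfolding \<gamma>_def using det_multrow[of 0 n "M t" "1 / det (M t)"] n Mc t by simp
      fix i j assume ij: "i < n" "j < n" "\<beta> j < \<beta> i"
      then have "X $$ (i, j) = 0" "i \<noteq> j" using X by (auto simp: par_algebra_def)
      then show "\<gamma> t $$ (i, j) = 0" using ij Xc by (simp add: \<gamma>ent M_def)
    qed
    have "((\<lambda>t. f (1\<^sub>m n + t \<cdot>\<^sub>m X)) has_field_derivative 0) (at 0)"
      if f: "poly_fun n f" "\<forall>h\<in>par n \<beta>. f h = 0" for f
    proof -
      obtain d where d: "\<forall>\<gamma>. mat_deriv n \<gamma> X \<longrightarrow> \<gamma> 0 = M 0 \<longrightarrow> ((\<lambda>t. f (\<gamma> t)) has_field_derivative d) (at 0)"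
        by (rule pfun_deriv_along_curve[OF pfun_poly_fun[OF f(1)]])
      have d1: "((\<lambda>t. f (\<gamma> t)) has_field_derivative d) (at 0)" using d \<gamma>d \<gamma>0 by blast
      have "((\<lambda>t. det (M t)) \<longlongrightarrow> det (M 0)) (at 0)"
        using DERIV_isCont[OF dd] by (simp add: isCont_def)
      then have "eventually (\<lambda>t. det (M t) \<noteq> 0) (at 0)"
        by (rule tendsto_imp_eventually_ne) (simp add: M0)
      then have "eventually (\<lambda>t. f (\<gamma> t) = 0) (nhds 0)"
        using \<gamma>par f(2) M0 by (auto simp: eventually_at_filter elim!: eventually_mono)
      then have "((\<lambda>t. f (\<gamma> t)) has_field_derivative d) (at 0) \<longleftrightarrow> ((\<lambda>t. 0) has_field_derivative d) (at 0)"
        by (intro DERIV_cong_ev) auto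
      then have "d = 0" using d1 DERIV_unique[OF _ DERIV_const] by blast
      moreover have "((\<lambda>t. f (M t)) has_field_derivative d) (at 0)" using d Md by blast
      ultimately show ?thesis by (simp add: M_def)
    qed
    then show "X \<in> lie_algebra n (par n \<beta>)" using Xc by (simp add: lie_algebra_def)
  qed
qed

section \<open>Unipotent radicals\<close>

text \<open>For monotone \<beta> this is the unipotent radical of \<open>par n \<beta>\<close>. As a
  translate of a linear space it is visibly irreducible, with that space as Lie algebra.\<close>

definition uni :: "nat \<Rightarrow> (nat \<Rightarrow> nat) \<Rightarrow> complex mat set" where
  "uni n \<beta> = (\<lambda>X. 1\<^sub>m n + X) ` rad n \<beta>"

lemma uni_carrier: "g \<in> uni n \<beta> \<Longrightarrow> g \<in> carrier_mat n n"
  by (auto simp: uni_def dest: rad_carrier)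

lemma uni_iff:
  "g \<in> uni n \<beta> \<longleftrightarrow> g \<in> carrier_mat n n \<and> (\<forall>i<n. \<forall>j<n. \<beta> j \<le> \<beta> i \<longrightarrow> g $$ (i, j) = (if i = j then 1 else 0))"
proof
  assume "g \<in> uni n \<beta>"
  then obtain X where X: "X \<in> rad n \<beta>" "g = 1\<^sub>m n + X" by (auto simp: uni_def)
  then show "g \<in> carrier_mat n n \<and> (\<forall>i<n. \<forall>j<n. \<beta> j \<le> \<beta> i \<longrightarrow> g $$ (i, j) = (if i = j then 1 else 0))"
    by (auto simp: rad_def)
next
  assume g: "g \<in> carrier_mat n n \<and> (\<forall>i<n. \<forall>j<n. \<beta> j \<le> \<beta> i \<longrightarrow> g $$ (i, j) = (if i = j then 1 else 0))"
  define X where "X = mat n n (\<lambda>(i, j). g $$ (i, j) - (if i = j then 1 else 0))"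
  have "X \<in> rad n \<beta>" using g by (auto simp: X_def rad_def)
  moreover have "g = 1\<^sub>m n + X" using g by (intro eq_matI) (auto simp: X_def)
  ultimately show "g \<in> uni n \<beta>" by (auto simp: uni_def)
qed

lemma rad_add: "X \<in> rad n \<beta> \<Longrightarrow> Y \<in> rad n \<beta> \<Longrightarrow> X + Y \<in> rad n \<beta>"
  by (auto simp: rad_def)

lemma uni_par:
  assumes \<beta>: "mono \<beta>" and g: "g \<in> uni n \<beta>" shows "g \<in> par n (\<lambda>i. i)"
proof -
  have gc: "g \<in> carrier_mat n n" and e: "\<And>i j. i < n \<Longrightarrow> j < n \<Longrightarrow> \<beta> j \<le> \<beta> i \<Longrightarrow> g $$ (i, j) = (if i = j then 1 else 0)"
    using g by (auto simp: uni_iff)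
  have up: "g $$ (i, j) = 0" if "i < n" "j < i" for i j
    using e[of i j] that monoD[OF \<beta>, of j i] by simp
  have "det g = 1" by (rule unitriangular_det[OF gc]) (use e up in auto)
  then show ?thesis using gc up by (auto simp: par_def SL_carrier)
qed

lemma uni_mult:
  assumes \<beta>: "mono \<beta>" and g: "g \<in> uni n \<beta>" and h: "h \<in> uni n \<beta>" shows "g * h \<in> uni n \<beta>"
proof -
  obtain X Y where X: "X \<in> rad n \<beta>" "g = 1\<^sub>m n + X" and Y: "Y \<in> rad n \<beta>" "h = 1\<^sub>m n + Y" using g h by (auto simp: uni_def)
  note gc = uni_carrier[OF g] and Xc = rad_carrier[OF X(1)] and Yc = rad_carrier[OF Y(1)]
  have "g * h = g * 1\<^sub>m n + g * Y" unfolding Y(2) by (rule mult_add_distrib_mat[OF gc one_carrier_mat Yc])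
  also have "g * 1\<^sub>m n = g" by (rule right_mult_one_mat[OF gc])
  also have "g + g * Y = 1\<^sub>m n + X + g * Y" by (rule arg_cong[OF X(2), of "\<lambda>Z. Z + g * Y"])
  also have "\<dots> = 1\<^sub>m n + (X + g * Y)" by (rule assoc_add_mat) (use gc Xc Yc in auto)
  finally have "g * h = 1\<^sub>m n + (X + g * Y)" .
  moreover have "g * Y \<in> rad n \<beta>" by (rule rad_mult_left[OF par_mono_id[OF \<beta> uni_par[OF \<beta> g]] Y(1)])
  ultimately show ?thesis using rad_add[OF X(1)] by (auto simp: uni_def)
qed

lemma uni_conj:
  assumes \<beta>: "mono \<beta>" and p: "p \<in> par n \<beta>" and g: "g \<in> uni n \<beta>" shows "p * g * adj_mat p \<in> uni n \<beta>"
proof -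
  obtain X where X: "X \<in> rad n \<beta>" "g = 1\<^sub>m n + X" using g by (auto simp: uni_def)
  note a = SL_adj[OF par_SL[OF p]] and Xc = rad_carrier[OF X(1)]
  have pX: "p * X \<in> carrier_mat n n" by (rule mult_carrier_mat[OF a(1) Xc])
  have "p * g = p + p * X" unfolding X(2) using mult_add_distrib_mat[OF a(1) one_carrier_mat Xc] a(1) by simp
  then have "p * g * adj_mat p = p * adj_mat p + p * X * adj_mat p"
    using add_mult_distrib_mat[OF a(1) pX a(2)] by simp
  then have "p * g * adj_mat p = 1\<^sub>m n + conj_by n p X" by (simp add: a(3) conj_by_adj[OF par_SL[OF p]])
  then show ?thesis using rad_conj_by[OF p X(1)] by (auto simp: uni_def)
qed

lemma uni_adj:
  assumes \<beta>: "mono \<beta>" and g: "g \<in> uni n \<beta>" shows "adj_mat g \<in> uni n \<beta>"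
proof -
  obtain X where X: "X \<in> rad n \<beta>" "g = 1\<^sub>m n + X" using g by (auto simp: uni_def)
  note gp = par_mono_id[OF \<beta> uni_par[OF \<beta> g]]
  note a = SL_adj[OF par_SL[OF gp]] and Xc = rad_carrier[OF X(1)]
  have aX: "adj_mat g * X \<in> rad n \<beta>" by (rule rad_mult_left[OF par_adj[OF gp] X(1)])
  have "1\<^sub>m n = adj_mat g * (1\<^sub>m n + X)" using a(4) X(2) by simp
  also have "\<dots> = adj_mat g + adj_mat g * X" using mult_add_distrib_mat[OF a(2) one_carrier_mat Xc] a(2) by simp
  finally have eq: "1\<^sub>m n = adj_mat g + adj_mat g * X" .
  show ?thesis
    unfolding uni_iff
  proof (intro conjI a(2) allI impI)
    fix i j assume ij: "i < n" "j < n" "\<beta> j \<le> \<beta> i"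
    have "(adj_mat g * X) $$ (i, j) = 0" using aX ij unfolding rad_def by blast
    moreover have "(adj_mat g + adj_mat g * X) $$ (i, j) = adj_mat g $$ (i, j) + (adj_mat g * X) $$ (i, j)"
      by (rule index_add_mat(1)) (use rad_carrier[OF aX] ij in auto)
    ultimately show "adj_mat g $$ (i, j) = (if i = j then 1 else 0)"
      using arg_cong[OF eq, of "\<lambda>M. M $$ (i, j)"] ij by simp
  qed
qed

lemma subgroup_uni: "mono \<beta> \<Longrightarrow> subgroup (uni n \<beta>) (SL n)"
  by (rule group.subgroupI[OF group_SL])
    (auto simp: uni_mult SL_inv[OF par_SL[OF uni_par]] uni_adj intro: par_SL[OF uni_par] simp: uni_iff[of "1\<^sub>m n"]
      intro!: exI[of _ "1\<^sub>m n"] simp flip: ex_in_conv)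

lemma closedin_uni: "closedin (zariski n) (uni n \<beta>)"
proof -
  let ?A = "{(i, j). i < n \<and> j < n \<and> \<beta> j \<le> \<beta> i}"
  have "uni n \<beta> = {X \<in> carrier_mat n n. \<forall>(i, j)\<in>?A. X $$ (i, j) = (if i = j then 1 else 0)}"
    by (auto simp: uni_iff)
  then show ?thesis using closedin_entries_eq[of ?A n "\<lambda>i j. if i = j then 1 else 0"] by auto
qed

lemma connectedin_uni: "connectedin (zariski n) (uni n \<beta>)"
  unfolding uni_def
  by (intro irreducible_in_imp_connectedin irreducible_in_pmap_image pmap_add pmap_const pmap_id one_carrier_mat)
    (simp add: rad_supp_mat irreducible_supp_mat)

lemma uni_unipotent:
  assumes \<beta>: "mono \<beta>" and g: "g \<in> uni n \<beta>" shows "unipotent_mat n g"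
proof -
  obtain X where X: "X \<in> rad n \<beta>" "g = 1\<^sub>m n + X" using g by (auto simp: uni_def)
  have "g - 1\<^sub>m n = X" unfolding X(2) using rad_carrier[OF X(1)] by (intro eq_matI) auto
  then show ?thesis
    using uni_carrier[OF g] rad_pow_n[OF rad_mono_id[OF \<beta> X(1)]] rad_carrier[OF X(1)]
    by (auto simp: unipotent_mat_def nilpotent_mat_def)
qed

lemma lie_algebra_uni: "lie_algebra n (uni n \<beta>) = rad n \<beta>"
proof
  show "lie_algebra n (uni n \<beta>) \<subseteq> rad n \<beta>"
  proof
    fix X assume X: "X \<in> lie_algebra n (uni n \<beta>)"
    have "X $$ (i, j) = 0" if "i < n" "j < n" "\<beta> j \<le> \<beta> i" for i j
      by (rule lie_algebra_entry[OF X that(1,2), of "if i = j then 1 else 0"]) (use that in \<open>simp add: uni_iff\<close>)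
    then show "X \<in> rad n \<beta>" using lie_algebra_carrier[OF X] by (simp add: rad_def)
  qed
  show "rad n \<beta> \<subseteq> lie_algebra n (uni n \<beta>)"
  proof
    fix X assume X: "X \<in> rad n \<beta>"
    have "1\<^sub>m n + t \<cdot>\<^sub>m X \<in> uni n \<beta>" for t
    proof -
      have "t \<cdot>\<^sub>m X \<in> rad n \<beta>" using X by (auto simp: rad_def)
      then show ?thesis by (auto simp: uni_def)
    qed
    then show "X \<in> lie_algebra n (uni n \<beta>)" using rad_carrier[OF X] by (simp add: lie_algebra_def)
  qed
qed

section \<open>Traces and diagonals of nilpotent matrices\<close>

lemma trace_mult_comm:
  assumes A: "A \<in> carrier_mat n n" and B: "B \<in> carrier_mat n n" shows "trace (A * B) = trace (B * A)"
proof -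
  have tr: "trace (A * B) = (\<Sum>i<n. \<Sum>k<n. A $$ (i, k) * B $$ (k, i))"
    if "A \<in> carrier_mat n n" "B \<in> carrier_mat n n" for A B
    unfolding trace_def using that by (auto intro!: sum.cong index_mult_sum simp del: index_mult_mat(1))
  show ?thesis unfolding tr[OF A B] tr[OF B A] by (subst sum.swap) (simp add: mult.commute)
qed

lemma upper_nilpotent_diag:
  fixes A :: "complex mat"
  assumes A: "A \<in> carrier_mat n n" "\<And>i j. i < n \<Longrightarrow> j < i \<Longrightarrow> A $$ (i, j) = 0" and nil: "A ^\<^sub>m k = 0\<^sub>m n n" and i: "i < n"
  shows "A $$ (i, i) = 0"
proof -
  have "(A ^\<^sub>m k) $$ (i, i) = A $$ (i, i) ^ k \<and> (\<forall>j<i. (A ^\<^sub>m k) $$ (i, j) = 0)" for k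
  proof (induction k)
    case 0
    then show ?case using A i by auto
  next
    case (Suc k)
    have "(A ^\<^sub>m k * A) $$ (i, j) = (if j = i then A $$ (i, i) ^ Suc k else 0)" if j: "j \<le> i" for j
    proof -
      have "(A ^\<^sub>m k * A) $$ (i, j) = (\<Sum>l<n. (A ^\<^sub>m k) $$ (i, l) * A $$ (l, j))"
        by (rule index_mult_sum[OF pow_carrier_mat[OF A(1)] A(1) i]) (use j i in simp)
      also have "\<dots> = (\<Sum>l<n. if l = i then (if j = i then A $$ (i, i) ^ Suc k else 0) else 0)"
      proof (rule sum.cong[OF refl])
        fix l assume "l \<in> {..<n}"
        then show "(A ^\<^sub>m k) $$ (i, l) * A $$ (l, j) = (if l = i then (if j = i then A $$ (i, i) ^ Suc k else 0) else 0)"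
          using Suc A(2)[of l j] j by (cases l i rule: linorder_cases) auto
      qed
      finally show ?thesis using i by simp
    qed
    then show ?case by simp
  qed
  from this[of k] have "A $$ (i, i) ^ k = 0" using nil i by simp
  then show ?thesis by simp
qed

lemma nilpotent_trace:
  assumes "nilpotent_mat n A" shows "trace A = 0"
proof -
  obtain k where A: "A \<in> carrier_mat n n" "A ^\<^sub>m k = 0\<^sub>m n n" using assms by (auto simp: nilpotent_mat_def)
  obtain as where "char_poly A = (\<Prod>a\<leftarrow>as. [:- a, 1:])" using char_poly_factorized[OF A(1)] by auto
  then obtain B where B: "B \<in> carrier_mat n n" "upper_triangular B" "similar_mat A B"
    using schur_decomposition_exists[OF A(1)] by blast
  obtain P Q where PQ: "similar_mat_wit B A P Q" using similar_mat_sym[OF B(3)] unfolding similar_mat_def by blast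
  note w = similar_mat_witD2[OF B(1) PQ]
  have "B ^\<^sub>m k = P * A ^\<^sub>m k * Q" by (rule similar_mat_wit_pow_id[OF PQ])
  also have "\<dots> = 0\<^sub>m n n" unfolding A(2) using w by simp
  finally have Bk: "B ^\<^sub>m k = 0\<^sub>m n n" .
  have "B $$ (i, i) = 0" if "i < n" for i
    by (rule upper_nilpotent_diag[OF B(1) _ Bk that]) (use B in \<open>auto simp: upper_triangular_def\<close>)
  then have "trace B = 0" using B(1) by (simp add: trace_def)
  moreover have "trace B = trace (Q * (P * A))" unfolding w(3) by (rule trace_mult_comm) (use w in auto)
  moreover have "Q * (P * A) = A" using w by (simp add: assoc_mult_mat[symmetric, of Q n n P n A n])
  ultimately show ?thesis by simp
qed

section \<open>Elementary matrices and standard parabolic subgroups\<close>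

text \<open>Matrix positions count from 0, so \<alpha>_k joins the positions k - 1 and k, and a
  block ends between them exactly when k is not in I. Counting these k up to a numbers the block of
  position a.\<close>

definition blk :: "nat set \<Rightarrow> nat \<Rightarrow> nat" where
  "blk I a = card {k. 1 \<le> k \<and> k \<le> a \<and> k \<notin> I}"

lemma blk_less_iff: "blk I b < blk I a \<longleftrightarrow> (\<exists>k. b < k \<and> k \<le> a \<and> k \<notin> I)"
proof
  assume lt: "blk I b < blk I a"
  show "\<exists>k. b < k \<and> k \<le> a \<and> k \<notin> I"
  proof (rule ccontr)
    assume "\<not> ?thesis"
    then have "{k. 1 \<le> k \<and> k \<le> a \<and> k \<notin> I} \<subseteq> {k. 1 \<le> k \<and> k \<le> b \<and> k \<notin> I}" by force
    then have "blk I a \<le> blk I b" unfolding blk_def by (intro card_mono) auto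
    then show False using lt by simp
  qed
next
  assume "\<exists>k. b < k \<and> k \<le> a \<and> k \<notin> I"
  then obtain k where k: "b < k" "k \<le> a" "k \<notin> I" by blast
  have "{k. 1 \<le> k \<and> k \<le> b \<and> k \<notin> I} \<subset> {k. 1 \<le> k \<and> k \<le> a \<and> k \<notin> I}"
  proof (rule psubsetI)
    show "{k. 1 \<le> k \<and> k \<le> b \<and> k \<notin> I} \<subseteq> {k. 1 \<le> k \<and> k \<le> a \<and> k \<notin> I}" using k by force
    have "k \<in> {k. 1 \<le> k \<and> k \<le> a \<and> k \<notin> I}" "k \<notin> {k. 1 \<le> k \<and> k \<le> b \<and> k \<notin> I}" using k by auto
    then show "{k. 1 \<le> k \<and> k \<le> b \<and> k \<notin> I} \<noteq> {k. 1 \<le> k \<and> k \<le> a \<and> k \<notin> I}" by blast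
  qed
  then show "blk I b < blk I a" unfolding blk_def by (intro psubset_card_mono) auto
qed

lemma mono_blk: "mono (blk I)"
  unfolding mono_def blk_def by (auto intro!: card_mono)

lemma blk_eq_iff: "b \<le> a \<Longrightarrow> blk I b = blk I a \<longleftrightarrow> (\<forall>k. b < k \<longrightarrow> k \<le> a \<longrightarrow> k \<in> I)"
  using blk_less_iff[of I b a] monoD[OF mono_blk, of b a I] by (auto simp: le_less)

lemma blk_singleton_less: "i \<ge> 1 \<Longrightarrow> blk {i} b < blk {i} a \<longleftrightarrow> b < a \<and> \<not> (a = i \<and> b = i - 1)"
proof -
  assume i: "i \<ge> 1"
  have "(\<exists>k. b < k \<and> k \<le> a \<and> k \<noteq> i) \<longleftrightarrow> b < a \<and> \<not> (a = i \<and> b = i - 1)"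
  proof
    assume "\<exists>k. b < k \<and> k \<le> a \<and> k \<noteq> i" then show "b < a \<and> \<not> (a = i \<and> b = i - 1)" using i by auto
  next
    assume *: "b < a \<and> \<not> (a = i \<and> b = i - 1)"
    show "\<exists>k. b < k \<and> k \<le> a \<and> k \<noteq> i"
    proof (cases "a = i")
      case True
      then show ?thesis using * i by (intro exI[of _ "Suc b"]) auto
    next
      case False
      then show ?thesis using * by (intro exI[of _ a]) auto
    qed
  qed
  then show ?thesis by (simp add: blk_less_iff)
qed

lemma par_blk_mono: assumes "I \<subseteq> J" shows "par n (blk I) \<subseteq> par n (blk J)"
proof -
  have "blk I j < blk I i" if "blk J j < blk J i" for i j
    using that assms unfolding blk_less_iff by blast
  then show ?thesis unfolding par_def by blast
qed

lemma borel_subset_par: "borel_group n \<subseteq> par n (blk I)"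
  unfolding borel_group_par using par_mono_id[OF mono_blk] by blast

section \<open>Elementary matrices\<close>

definition transvection :: "nat \<Rightarrow> nat \<Rightarrow> nat \<Rightarrow> complex \<Rightarrow> complex mat" where
  "transvection n p q c = mat n n (\<lambda>(i, j). if i = j then 1 else if i = p \<and> j = q then c else 0)"

lemma transvection_carrier [simp]: "transvection n p q c \<in> carrier_mat n n"
  by (simp add: transvection_def)

lemma transvection_SL: "p \<noteq> q \<Longrightarrow> transvection n p q c \<in> carrier (SL n)"
proof -
  assume pq: "p \<noteq> q"
  then have "transvection n p q c = addrow_mat n c p q" by (intro eq_matI) (auto simp: transvection_def)
  then show ?thesis using det_addrow_mat[OF pq, of n c] by (simp add: SL_carrier)
qed

lemma mult_transvection_entry:
  assumes X: "X \<in> carrier_mat n n" and pq: "p < n" "p \<noteq> q" and ij: "i < n" "j < n"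
  shows "(X * transvection n p q c) $$ (i, j) = X $$ (i, j) + (if j = q then c * X $$ (i, p) else 0)"
proof -
  have "(X * transvection n p q c) $$ (i, j) = (\<Sum>k<n. (if k = j then X $$ (i, j) else 0) + (if k = p then (if j = q then c * X $$ (i, p) else 0) else 0))"
    unfolding index_mult_sum[OF X transvection_carrier ij] by (rule sum.cong) (use pq ij in \<open>auto simp: transvection_def\<close>)
  then show ?thesis using ij pq by (simp add: sum.distrib)
qed

lemma transvection_mult_entry:
  assumes X: "X \<in> carrier_mat n n" and pq: "q < n" "p \<noteq> q" and ij: "i < n" "j < n"
  shows "(transvection n p q c * X) $$ (i, j) = X $$ (i, j) + (if i = p then c * X $$ (q, j) else 0)"
proof -
  have "(transvection n p q c * X) $$ (i, j) = (\<Sum>k<n. (if k = i then X $$ (i, j) else 0) + (if k = q then (if i = p then c * X $$ (q, j) else 0) else 0))"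
    unfolding index_mult_sum[OF transvection_carrier X ij] by (rule sum.cong) (use pq ij in \<open>auto simp: transvection_def\<close>)
  then show ?thesis using ij pq by (simp add: sum.distrib)
qed

lemma transvection_entry:
  "i < n \<Longrightarrow> j < n \<Longrightarrow> transvection n p q c $$ (i, j) = (if i = j then 1 else if i = p \<and> j = q then c else 0)"
  by (simp add: transvection_def)

lemma transvection_adj:
  assumes pq: "p < n" "q < n" "p \<noteq> q" shows "adj_mat (transvection n p q c) = transvection n p q (- c)"
proof -
  note a = SL_adj[OF transvection_SL[OF pq(3)], of n c]
  have "transvection n p q c * transvection n p q (- c) = 1\<^sub>m n"
  proof (rule eq_matI)
    fix i j assume "i < dim_row (1\<^sub>m n :: complex mat)" "j < dim_col (1\<^sub>m n :: complex mat)"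
    then show "(transvection n p q c * transvection n p q (- c)) $$ (i, j) = 1\<^sub>m n $$ (i, j)"
      using pq by (simp add: mult_transvection_entry transvection_entry del: index_mult_mat(1))
  qed (simp_all add: carrier_matD[OF transvection_carrier])
  then have "adj_mat (transvection n p q c) * (transvection n p q c * transvection n p q (- c)) = adj_mat (transvection n p q c)" using a by simp
  moreover have "adj_mat (transvection n p q c) * (transvection n p q c * transvection n p q (- c)) = transvection n p q (- c)"
    using a by (simp add: assoc_mult_mat[symmetric, OF a(2,1) transvection_carrier] left_mult_one_mat[OF transvection_carrier])
  ultimately show ?thesis by simp
qed

lemma transvection_conj_entry:
  assumes X: "X \<in> carrier_mat n n" and pq: "p < n" "q < n" "p \<noteq> q" and ij: "i < n" "j < n"
  shows "conj_by n (transvection n p q 1) X $$ (i, j) = X $$ (i, j) + (if i = p then X $$ (q, j) else 0)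
    - (if j = q then X $$ (i, p) + (if i = p then X $$ (q, p) else 0) else 0)"
proof -
  have "conj_by n (transvection n p q 1) X = transvection n p q 1 * X * transvection n p q (- 1)"
    by (simp add: conj_by_adj[OF transvection_SL[OF pq(3)]] transvection_adj[OF pq])
  then show ?thesis
    using pq ij by (simp add: mult_transvection_entry[OF mult_carrier_mat[OF transvection_carrier X]] transvection_mult_entry[OF X] del: index_mult_mat(1))
qed

text \<open>The Steinberg relation: a commutator of elementary matrices sharing the middle index m
  is elementary again.\<close>

lemma transvection_commutator:
  assumes "a < n" "m < n" "b < n" "a \<noteq> m" "m \<noteq> b" "a \<noteq> b"
  shows "transvection n a m 1 * transvection n m b c * transvection n a m (- 1) * transvection n m b (- c) = transvection n a b c"
proof (rule eq_matI)
  note c = mult_carrier_mat[OF transvection_carrier transvection_carrier]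
  fix i j assume "i < dim_row (transvection n a b c)" "j < dim_col (transvection n a b c)"
  then have "i < n" "j < n" by (simp_all add: transvection_def)
  then show "(transvection n a m 1 * transvection n m b c * transvection n a m (- 1) * transvection n m b (- c)) $$ (i, j) = transvection n a b c $$ (i, j)"
    using assms by (simp add: mult_transvection_entry[OF mult_carrier_mat[OF c transvection_carrier]] mult_transvection_entry[OF c]
        mult_transvection_entry[OF transvection_carrier] transvection_entry del: index_mult_mat(1))
qed (simp_all add: carrier_matD[OF transvection_carrier])

lemma transvection_par:
  assumes "p \<noteq> q" "\<beta> p \<le> \<beta> q" shows "transvection n p q c \<in> par n \<beta>"
  using assms transvection_SL[OF assms(1)] by (auto simp: par_def transvection_entry)

text \<open>Elementary matrices above the diagonal lie in the Borel subgroup. Below it, the one at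
  (a, b) is the commutator of those at (a, a - 1) and (a - 1, b), by induction on a - b.\<close>

lemma transvection_in_subgroup:
  assumes H: "subgroup H (SL n)" and borel: "borel_group n \<subseteq> H" and simple: "\<And>i. i \<in> I \<Longrightarrow> i < n \<Longrightarrow> transvection n i (i - 1) 1 \<in> H"
    and I: "\<And>i. i \<in> I \<Longrightarrow> i \<ge> 1" and ab: "a < n" "b < n" "a \<noteq> b" "blk I a = blk I b"
  shows "transvection n a b 1 \<in> H"
proof (cases "a < b")
  case True
  then have "transvection n a b 1 \<in> par n (\<lambda>i. i)" by (intro transvection_par) auto
  then show ?thesis using borel by (auto simp: borel_group_par)
next
  case False
  then have "b < a" using ab by simp
  then show ?thesis using ab(1,4)
  proof (induction "a - b" arbitrary: a rule: less_induct)
    case less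
    have I': "\<forall>k. b < k \<longrightarrow> k \<le> a \<longrightarrow> k \<in> I" using blk_eq_iff[of b a I] less.prems by simp
    then have aI: "a \<in> I" using less.prems by auto
    have inv: "transvection n p q (- 1) \<in> H" if "transvection n p q 1 \<in> H" "p < n" "q < n" "p \<noteq> q" for p q
      using subgroup.m_inv_closed[OF H that(1)] SL_inv[OF transvection_SL[OF that(4)]] transvection_adj[OF that(2-4)] by simp
    show ?case
    proof (cases "b = a - 1")
      case True
      then show ?thesis using simple[OF aI] less.prems by simp
    next
      case False
      define m where "m = a - 1"
      have m: "b < m" "m < a" "m < n" using False less.prems by (auto simp: m_def)
      have "blk I m = blk I b" using blk_eq_iff[of b m I] I' m by simp
      then have mb: "transvection n m b 1 \<in> H" using less.hyps[of m] m by simp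
      have am: "transvection n a m 1 \<in> H" using simple[OF aI] less.prems by (simp add: m_def)
      have "transvection n a m 1 * transvection n m b 1 * transvection n a m (- 1) * transvection n m b (- 1) \<in> H"
        using subgroup.m_closed[OF H] am mb inv[OF am] inv[OF mb] m less.prems ab(2) by simp
      then show ?thesis using transvection_commutator[of a n m b 1] m less.prems ab(2) by simp
    qed
  qed
qed

section \<open>The nilradical of a parabolic subgroup\<close>

text \<open>Traces of nilpotent matrices vanish, so the trace form vanishes on the matrices g - 1
  with g in U. Evaluated at X = g - 1 and its conjugate by 1 + e_ab, with a and b in one block, the
  form gives minus the square of the entry (b, a) of X. So X has no off-diagonal entries inside
  blocks; it is then upper triangular and nilpotent, which makes its diagonal 0.\<close>

lemma unipotent_normal_subset_uni:
  assumes \<beta>: "mono \<beta>" and Hp: "H \<subseteq> par n \<beta>"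
    and el: "\<And>a b. a < n \<Longrightarrow> b < n \<Longrightarrow> a \<noteq> b \<Longrightarrow> \<beta> a = \<beta> b \<Longrightarrow> transvection n a b 1 \<in> H"
    and UH: "U \<subseteq> H" and mult: "\<And>g h. g \<in> U \<Longrightarrow> h \<in> U \<Longrightarrow> g * h \<in> U"
    and conj: "\<And>p g. p \<in> H \<Longrightarrow> g \<in> U \<Longrightarrow> p * g * adj_mat p \<in> U"
    and unip: "\<And>g. g \<in> U \<Longrightarrow> unipotent_mat n g"
  shows "U \<subseteq> uni n \<beta>"
proof
  fix g assume g: "g \<in> U"
  have gp: "g \<in> par n \<beta>" using g UH Hp by auto
  note gc = par_carrier[OF gp]
  define X where "X = g - 1\<^sub>m n"
  have Xc: "X \<in> carrier_mat n n" by (simp add: X_def minus_carrier_mat)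
  have gX: "g = 1\<^sub>m n + X" using gc by (intro eq_matI) (auto simp: X_def)
  have Xe: "X $$ (i, j) = g $$ (i, j) - (if i = j then 1 else 0)" if "i < n" "j < n" for i j
    using that gc by (simp add: X_def)
  have nilX: "nilpotent_mat n X" using unip[OF g] by (simp add: unipotent_mat_def X_def)
  text \<open>\<open>tr (g h - 1) = tr (g - 1) + tr (h - 1) + tr ((g - 1) (h - 1))\<close>, where all but the last trace vanish.\<close>
  have tr0: "trace (X * Y) = 0" if h: "1\<^sub>m n + Y \<in> U" and Y: "Y \<in> carrier_mat n n" for Y
  proof -
    have nil: "nilpotent_mat n (Z)" if "1\<^sub>m n + Z \<in> U" "Z \<in> carrier_mat n n" for Z
    proof -
      have "1\<^sub>m n + Z - 1\<^sub>m n = Z" using that(2) by (intro eq_matI) auto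
      then show ?thesis using unip[OF that(1)] by (simp add: unipotent_mat_def)
    qed
    have XY: "X * Y \<in> carrier_mat n n" using Xc Y by simp
    have "g * (1\<^sub>m n + Y) = 1\<^sub>m n + (X + Y + X * Y)"
    proof -
      have "g * (1\<^sub>m n + Y) = g * 1\<^sub>m n + g * Y" by (rule mult_add_distrib_mat[OF gc one_carrier_mat Y])
      also have "g * Y = 1\<^sub>m n * Y + X * Y" unfolding gX by (rule add_mult_distrib_mat[OF one_carrier_mat Xc Y])
      finally have "g * (1\<^sub>m n + Y) = g + (Y + X * Y)" using gc Y by simp
      then show ?thesis unfolding gX using Xc Y XY by (intro eq_matI) (auto simp del: index_mult_mat(1))
    qed
    then have "1\<^sub>m n + (X + Y + X * Y) \<in> U" using mult[OF g h] by simp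
    then have "nilpotent_mat n (X + Y + X * Y)" by (rule nil) (use Xc Y XY in auto)
    then have "trace (X + Y + X * Y) = 0" by (rule nilpotent_trace)
    moreover have "trace (X + Y + X * Y) = trace X + trace Y + trace (X * Y)"
      unfolding trace_def using Xc Y XY by (simp add: sum.distrib del: index_mult_mat(1))
    ultimately show ?thesis using nilpotent_trace[OF nilX] nilpotent_trace[OF nil[OF h Y]] by simp
  qed
  have off: "X $$ (b, a) = 0" if ab: "a < n" "b < n" "a \<noteq> b" "\<beta> a = \<beta> b" for a b
  proof -
    let ?E = "transvection n a b 1" and ?F = "transvection n a b (- 1)"
    have E: "?E \<in> H" by (rule el[OF ab])
    note ESL = transvection_SL[OF ab(3), of n 1]
    have Yc: "conj_by n ?E X \<in> carrier_mat n n" by (rule conj_by_carrier[OF ESL Xc])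
    have EX: "?E * X \<in> carrier_mat n n" by (rule mult_carrier_mat[OF transvection_carrier Xc])
    have "?E * g = ?E + ?E * X" unfolding gX using mult_add_distrib_mat[OF transvection_carrier one_carrier_mat Xc] by (simp add: right_mult_one_mat[OF transvection_carrier])
    then have "?E * g * adj_mat ?E = ?E * adj_mat ?E + ?E * X * adj_mat ?E"
      using add_mult_distrib_mat[OF transvection_carrier EX SL_adj(2)[OF ESL]] by simp
    then have "?E * g * adj_mat ?E = 1\<^sub>m n + conj_by n ?E X" by (simp add: SL_adj(3)[OF ESL] conj_by_adj[OF ESL])
    then have "1\<^sub>m n + conj_by n ?E X \<in> U" using conj[OF E g] by simp
    then have "trace (X * conj_by n ?E X) = 0" by (rule tr0[OF _ Yc])
    moreover have "X * conj_by n ?E X = (X * ?E) * (X * ?F)"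
    proof -
      have "conj_by n ?E X = ?E * (X * ?F)"
        unfolding conj_by_adj[OF ESL] transvection_adj[OF ab(1-3)] by (rule assoc_mult_mat[OF transvection_carrier Xc transvection_carrier])
      then show ?thesis
        using assoc_mult_mat[OF Xc transvection_carrier mult_carrier_mat[OF Xc transvection_carrier], of a b 1 a b "- 1"] by simp
    qed
    ultimately have tr: "trace ((X * ?E) * (X * ?F)) = 0" by simp
    have trsum: "trace (A * B) = (\<Sum>i<n. \<Sum>k<n. A $$ (i, k) * B $$ (k, i))"
      if "A \<in> carrier_mat n n" "B \<in> carrier_mat n n" for A B
      unfolding trace_def using that by (auto intro!: sum.cong index_mult_sum simp del: index_mult_mat(1))
    \<comment> \<open>\<open>W\<close> is X e_ab. The two sums linear in \<open>W\<close> cancel by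
      cyclicity of the trace, and the quadratic one is the square of entry (b, a).\<close>
    define W where "W i k = (if k = b then X $$ (i, a) else 0)" for i k
    have "trace ((X * ?E) * (X * ?F)) = (\<Sum>i<n. \<Sum>k<n. (X $$ (i, k) + W i k) * (X $$ (k, i) - W k i))"
      unfolding trsum[OF mult_carrier_mat[OF Xc transvection_carrier] mult_carrier_mat[OF Xc transvection_carrier]]
      by (intro sum.cong refl) (use ab in \<open>simp add: mult_transvection_entry[OF Xc] W_def del: index_mult_mat(1)\<close>)
    also have "\<dots> = (\<Sum>i<n. \<Sum>k<n. X $$ (i, k) * X $$ (k, i)) - (\<Sum>i<n. \<Sum>k<n. X $$ (i, k) * W k i)
        + (\<Sum>i<n. \<Sum>k<n. W i k * X $$ (k, i)) - (\<Sum>i<n. \<Sum>k<n. W i k * W k i)"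
      by (simp add: algebra_simps sum.distrib sum_subtractf)
    also have "(\<Sum>i<n. \<Sum>k<n. W i k * X $$ (k, i)) = (\<Sum>i<n. \<Sum>k<n. X $$ (i, k) * W k i)"
      by (subst sum.swap) (simp add: mult.commute)
    also have "(\<Sum>i<n. \<Sum>k<n. W i k * W k i) = (\<Sum>i<n. \<Sum>k<n. if k = b then (if i = b then X $$ (b, a) * X $$ (b, a) else 0) else 0)"
      by (intro sum.cong refl) (auto simp: W_def)
    also have "\<dots> = X $$ (b, a) * X $$ (b, a)" using ab by simp
    also have "(\<Sum>i<n. \<Sum>k<n. X $$ (i, k) * X $$ (k, i)) = trace (X * X)" by (rule trsum[OF Xc Xc, symmetric])
    also have "trace (X * X) = 0" by (rule tr0[OF _ Xc]) (use g gX in simp)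
    finally show ?thesis using tr by simp
  qed
  have low: "X $$ (i, j) = 0" if "i < n" "j < n" "\<beta> j \<le> \<beta> i" "i \<noteq> j" for i j
  proof (cases "\<beta> j < \<beta> i")
    case True
    then show ?thesis using gp that Xe by (simp add: par_def)
  next
    case False
    then show ?thesis using off[of j i] that by simp
  qed
  obtain k where k: "X ^\<^sub>m k = 0\<^sub>m n n" using nilX by (auto simp: nilpotent_mat_def)
  have diag: "X $$ (i, i) = 0" if "i < n" for i
  proof (rule upper_nilpotent_diag[OF Xc _ k that])
    show "X $$ (i, j) = 0" if "i < n" "j < i" for i j
      using low[of i j] that monoD[OF \<beta>, of j i] by simp
  qed
  have "X \<in> rad n \<beta>"
    unfolding rad_def
  proof (intro CollectI conjI allI impI Xc)
    fix i j assume "i < n" "j < n" "\<beta> j \<le> \<beta> i"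
    then show "X $$ (i, j) = 0" using low[of i j] diag[of i] by (cases "i = j") simp_all
  qed
  then show "g \<in> uni n \<beta>" using gX by (auto simp: uni_def)
qed

lemma SL_restrict_mult: "g \<otimes>\<^bsub>(SL n)\<lparr>carrier := H\<rparr>\<^esub> h = g * h"
  by (simp add: SL_def)

text \<open>Stated for every group between the Borel subgroup and \<open>par n \<beta>\<close> that
  contains the elementary matrices inside blocks, so that it applies directly to a group given by
  generators. \<open>GREATEST\<close> refers to inclusion.\<close>

lemma unipotent_radical_eq:
  assumes \<beta>: "mono \<beta>" and H: "subgroup H (SL n)" and Hp: "H \<subseteq> par n \<beta>" and borel: "borel_group n \<subseteq> H"
    and el: "\<And>a b. a < n \<Longrightarrow> b < n \<Longrightarrow> a \<noteq> b \<Longrightarrow> \<beta> a = \<beta> b \<Longrightarrow> transvection n a b 1 \<in> H"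
  shows "unipotent_radical n H = uni n \<beta>"
  unfolding unipotent_radical_def
proof (rule Greatest_equality)
  have grp: "group ((SL n)\<lparr>carrier := H\<rparr>)" by (rule group.subgroup_imp_group[OF group_SL H])
  have inv: "inv\<^bsub>(SL n)\<lparr>carrier := H\<rparr>\<^esub> p = adj_mat p" if "p \<in> H" for p
    using group.m_inv_consistent[OF group_SL H that] SL_inv[OF par_SL, of p n \<beta>] Hp that by auto
  have uH: "uni n \<beta> \<subseteq> H" using uni_par[OF \<beta>] borel by (auto simp: borel_group_par)
  show "uni n \<beta> \<lhd> (SL n)\<lparr>carrier := H\<rparr> \<and> closedin (zariski n) (uni n \<beta>) \<and> connectedin (zariski n) (uni n \<beta>) \<and>
      (\<forall>g\<in>uni n \<beta>. unipotent_mat n g)"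
  proof (intro conjI closedin_uni connectedin_uni ballI uni_unipotent[OF \<beta>])
    show "uni n \<beta> \<lhd> (SL n)\<lparr>carrier := H\<rparr>"
      unfolding group.normal_inv_iff[OF grp]
    proof (intro conjI ballI)
      show "subgroup (uni n \<beta>) ((SL n)\<lparr>carrier := H\<rparr>)"
        by (rule group.subgroup_incl[OF group_SL subgroup_uni[OF \<beta>] H uH])
      fix p g assume p: "p \<in> carrier ((SL n)\<lparr>carrier := H\<rparr>)" and g: "g \<in> uni n \<beta>"
      then have p': "p \<in> H" by simp
      have "p * g * adj_mat p \<in> uni n \<beta>" using uni_conj[OF \<beta> _ g] p' Hp by blast
      then show "p \<otimes>\<^bsub>(SL n)\<lparr>carrier := H\<rparr>\<^esub> g \<otimes>\<^bsub>(SL n)\<lparr>carrier := H\<rparr>\<^esub> inv\<^bsub>(SL n)\<lparr>carrier := H\<rparr>\<^esub> p \<in> uni n \<beta>"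
        unfolding inv[OF p'] SL_restrict_mult .
    qed
  qed
  fix U assume U: "U \<lhd> (SL n)\<lparr>carrier := H\<rparr> \<and> closedin (zariski n) U \<and> connectedin (zariski n) U \<and> (\<forall>g\<in>U. unipotent_mat n g)"
  then have sub: "subgroup U ((SL n)\<lparr>carrier := H\<rparr>)"
    and nor: "\<And>p g. p \<in> H \<Longrightarrow> g \<in> U \<Longrightarrow> p \<otimes>\<^bsub>(SL n)\<lparr>carrier := H\<rparr>\<^esub> g \<otimes>\<^bsub>(SL n)\<lparr>carrier := H\<rparr>\<^esub> inv\<^bsub>(SL n)\<lparr>carrier := H\<rparr>\<^esub> p \<in> U"
    unfolding group.normal_inv_iff[OF grp] by auto
  show "U \<subseteq> uni n \<beta>"
  proof (rule unipotent_normal_subset_uni[OF \<beta> Hp el])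
    show "U \<subseteq> H" using subgroup.subset[OF sub] by simp
    show "g * h \<in> U" if "g \<in> U" "h \<in> U" for g h
      using subgroup.m_closed[OF sub that] unfolding SL_restrict_mult .
    show "p * g * adj_mat p \<in> U" if "p \<in> H" "g \<in> U" for p g
      using nor[OF that] unfolding inv[OF that(1)] SL_restrict_mult .
    show "unipotent_mat n g" if "g \<in> U" for g using U that by blast
  qed
qed

section \<open>Minimal parabolic subgroups\<close>

lemma par_algebra_singleton:
  assumes i: "i \<in> simple_roots n"
  shows "par_algebra n (blk {i}) = {X + Y | X Y. X \<in> borel_algebra n \<and> Y \<in> neg_root_space n i}"
proof -
  have i1: "1 \<le> i" "i < n" using i by (auto simp: simple_roots_def)
  show ?thesis
  proof (intro equalityI subsetI)
    fix Z assume Z: "Z \<in> par_algebra n (blk {i})"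
    then have Zc: "Z \<in> carrier_mat n n" and tr: "trace Z = 0" by (auto simp: par_algebra_def sl_def)
    have Z0: "Z $$ (a, b) = 0" if "a < n" "b < a" "\<not> (a = i \<and> b = i - 1)" for a b
      using Z that blk_singleton_less[OF i1(1), of b a] by (simp add: par_algebra_def)
    define Y where "Y = Z $$ (i, i - 1) \<cdot>\<^sub>m unit_mat n (i + 1) i"
    define X where "X = mat n n (\<lambda>(a, b). if a = i \<and> b = i - 1 then 0 else Z $$ (a, b))"
    have "trace X = trace Z" unfolding trace_def using Zc i1 by (intro sum.cong) (auto simp: X_def)
    then have "X \<in> borel_algebra n"
      using tr Z0 by (auto simp: borel_algebra_def sl_def X_def upper_triangular_def)
    moreover have "Y \<in> neg_root_space n i" by (auto simp: Y_def neg_root_space_def)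
    moreover have "Z = X + Y" using Zc i1 by (intro eq_matI) (auto simp: X_def Y_def unit_mat_def)
    ultimately show "Z \<in> {X + Y | X Y. X \<in> borel_algebra n \<and> Y \<in> neg_root_space n i}" by blast
  next
    fix Z assume "Z \<in> {X + Y | X Y. X \<in> borel_algebra n \<and> Y \<in> neg_root_space n i}"
    then obtain X c where X: "X \<in> borel_algebra n" and Z: "Z = X + c \<cdot>\<^sub>m unit_mat n (i + 1) i"
      by (auto simp: neg_root_space_def)
    have Xc: "X \<in> carrier_mat n n" "trace X = 0" "upper_triangular X" using X by (auto simp: borel_algebra_def sl_def)
    have uc: "unit_mat n (i + 1) i \<in> carrier_mat n n" by (simp add: unit_mat_def)
    have ent: "Z $$ (a, b) = X $$ (a, b) + (if a = i \<and> b = i - 1 then c else 0)" if "a < n" "b < n" for a b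
      using that Xc(1) uc by (simp add: Z unit_mat_def)
    have Zc: "Z \<in> carrier_mat n n" using Xc uc by (simp add: Z)
    have "trace Z = trace X"
      unfolding trace_def using Zc Xc(1) ent i1 by (intro sum.cong) auto
    moreover have "Z $$ (a, b) = 0" if "a < n" "b < n" "blk {i} b < blk {i} a" for a b
      using ent[OF that(1,2)] that blk_singleton_less[OF i1(1), of b a] Xc by (auto simp: upper_triangular_def)
    ultimately show "Z \<in> par_algebra n (blk {i})" using Zc Xc(2) by (simp add: par_algebra_def sl_def)
  qed
qed

text \<open>If \<open>f\<close> vanishes on P, so does its composition with conjugation by g; the
  derivative of the latter along X is that of \<open>f\<close> along the conjugate of X.\<close>

lemma lie_algebra_conj_stable:
  assumes P: "subgroup P (SL n)" and g: "g \<in> P" and X: "X \<in> lie_algebra n P"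
  shows "conj_by n g X \<in> lie_algebra n P"
proof -
  have gSL: "g \<in> carrier (SL n)" using subgroup.subset[OF P] g by blast
  note a = SL_adj[OF gSL] and Xc = lie_algebra_carrier[OF X]
  note gX = conj_by_carrier[OF gSL Xc]
  have "((\<lambda>t. f (1\<^sub>m n + t \<cdot>\<^sub>m conj_by n g X)) has_field_derivative 0) (at 0)"
    if f: "poly_fun n f" "\<forall>h\<in>P. f h = 0" for f
  proof -
    have "pfun n (\<lambda>Y. f (g * Y * adj_mat g))"
      by (rule pfun_comp[OF pfun_poly_fun[OF f(1)]]) (intro pmap_mult pmap_const pmap_id a)
    then obtain f' where f': "poly_fun n f'" "\<forall>Y\<in>carrier_mat n n. f (g * Y * adj_mat g) = f' Y" by (rule pfunE)
    have "f' h = 0" if h: "h \<in> P" for h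
    proof -
      have "inv\<^bsub>SL n\<^esub> g \<in> P" by (rule subgroup.m_inv_closed[OF P g])
      then have "g * h * adj_mat g \<in> P"
        using subgroup.m_closed[OF P subgroup.m_closed[OF P g h]] SL_inv[OF gSL] by simp
      moreover have "h \<in> carrier_mat n n" using subgroup.subset[OF P] h by (auto simp: SL_carrier)
      ultimately show ?thesis using f(2) f'(2) by metis
    qed
    then have d: "((\<lambda>t. f' (1\<^sub>m n + t \<cdot>\<^sub>m X)) has_field_derivative 0) (at 0)" by (rule lie_algebraD[OF X f'(1)])
    have "f' (1\<^sub>m n + t \<cdot>\<^sub>m X) = f (1\<^sub>m n + t \<cdot>\<^sub>m conj_by n g X)" for t
    proof -
      have tX: "t \<cdot>\<^sub>m X \<in> carrier_mat n n" "g * (t \<cdot>\<^sub>m X) \<in> carrier_mat n n" using Xc a by auto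
      have "g * (1\<^sub>m n + t \<cdot>\<^sub>m X) = g + g * (t \<cdot>\<^sub>m X)"
        using mult_add_distrib_mat[OF a(1) one_carrier_mat tX(1)] a(1) by simp
      then have "g * (1\<^sub>m n + t \<cdot>\<^sub>m X) * adj_mat g = g * adj_mat g + g * (t \<cdot>\<^sub>m X) * adj_mat g"
        using add_mult_distrib_mat[OF a(1) tX(2) a(2)] by simp
      also have "g * (t \<cdot>\<^sub>m X) * adj_mat g = t \<cdot>\<^sub>m conj_by n g X"
        unfolding conj_by_adj[OF gSL] mult_smult_distrib[OF a(1) Xc]
        by (rule mult_smult_assoc_mat[OF mult_carrier_mat[OF a(1) Xc] a(2)])
      finally have eq: "g * (1\<^sub>m n + t \<cdot>\<^sub>m X) * adj_mat g = 1\<^sub>m n + t \<cdot>\<^sub>m conj_by n g X" unfolding a(3) .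
      have "1\<^sub>m n + t \<cdot>\<^sub>m X \<in> carrier_mat n n" using Xc by simp
      from bspec[OF f'(2) this] show ?thesis unfolding eq by simp
    qed
    then show ?thesis using d by simp
  qed
  then show ?thesis using gX by (simp add: lie_algebra_def)
qed

text \<open>If \<open>g\<^sub>a\<^sub>b \<noteq> 0\<close> with \<open>a\<close> in a later block than \<open>b\<close>, then conjugating the matrices
  \<open>e\<^sub>c\<^sub>a\<close> by \<open>g\<^sup>-\<^sup>1\<close> shows that \<open>g\<^sup>-\<^sup>1\<close> maps the flag space of \<open>a\<close> into the smaller one of \<open>b\<close>.\<close>

lemma normalizer_par_algebra:
  assumes n: "n \<ge> 1" and g: "g \<in> carrier (SL n)"
    and stable: "\<And>X. X \<in> par_algebra n \<beta> \<Longrightarrow> adj_mat g * X * g \<in> par_algebra n \<beta>"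
  shows "g \<in> par n \<beta>"
  unfolding par_def
proof (intro CollectI conjI allI impI g)
  fix a b assume ab: "a < n" "b < n" "\<beta> b < \<beta> a"
  note s = SL_adj[OF g]
  let ?h = "adj_mat g"
  show "g $$ (a, b) = 0"
  proof (rule ccontr)
    assume nz: "g $$ (a, b) \<noteq> 0"
    have hk: "?h $$ (k, c) = 0" if k: "k < n" "\<beta> b < \<beta> k" and c: "c < n" "\<beta> c \<le> \<beta> a" for k c
    proof -
      \<comment> \<open>The matrix e_ca has trace 1 when c = a, so a multiple of the identity is
        subtracted. This changes entry (k, b) of the conjugate by a multiple of an off-diagonal
        entry of the identity, that is, by 0.\<close>
      define s where "s = (if c = a then 1 / of_nat n else (0 :: complex))"
      define Z where "Z = mat n n (\<lambda>(i, j). (if i = c \<and> j = a then 1 else 0) - (if i = j then s else 0))"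
      have Zc: "Z \<in> carrier_mat n n" by (simp add: Z_def)
      have "trace Z = (\<Sum>i<n. if i = a then (if c = a then 1 else 0) else 0) - (\<Sum>i<n. s)"
        unfolding sum_subtractf[symmetric] trace_def using Zc by (intro sum.cong) (auto simp: Z_def)
      also have "\<dots> = 0" using n ab by (auto simp: s_def)
      finally have "Z \<in> par_algebra n \<beta>" using c Zc by (auto simp: par_algebra_def sl_def Z_def)
      then have zero: "(?h * Z * g) $$ (k, b) = 0" using stable k ab by (simp add: par_algebra_def)
      have hZ: "(?h * Z) $$ (k, j) = (if j = a then ?h $$ (k, c) else 0) - s * ?h $$ (k, j)" if j: "j < n" for j
      proof -
        have "(?h * Z) $$ (k, j) = (\<Sum>l<n. (if l = c then (if j = a then ?h $$ (k, c) else 0) else 0) - (if l = j then s * ?h $$ (k, j) else 0))"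
          unfolding index_mult_sum[OF SL_adj(2)[OF g] Zc k(1) j]
          by (rule sum.cong) (use j in \<open>auto simp: Z_def algebra_simps\<close>)
        then show ?thesis using c j by (simp add: sum_subtractf)
      qed
      have "(?h * Z * g) $$ (k, b) = (\<Sum>j<n. (?h * Z) $$ (k, j) * g $$ (j, b))"
        by (rule index_mult_sum[OF mult_carrier_mat[OF SL_adj(2)[OF g] Zc] SL_adj(1)[OF g] k(1) ab(2)])
      also have "\<dots> = (\<Sum>j<n. (if j = a then ?h $$ (k, c) * g $$ (a, b) else 0) - s * (?h $$ (k, j) * g $$ (j, b)))"
        by (rule sum.cong) (auto simp: hZ algebra_simps)
      also have "\<dots> = ?h $$ (k, c) * g $$ (a, b) - s * (?h * g) $$ (k, b)"
        unfolding index_mult_sum[OF SL_adj(2)[OF g] SL_adj(1)[OF g] k(1) ab(2)]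
        using ab by (simp add: sum_subtractf sum_distrib_left)
      also have "(?h * g) $$ (k, b) = 0" using SL_adj(4)[OF g] k ab by auto
      finally show ?thesis using zero nz by simp
    qed
    define J where "J = {j. j < n \<and> \<beta> j \<le> \<beta> b}"
    define J' where "J' = {j. j < n \<and> \<beta> j \<le> \<beta> a}"
    have "J \<subset> J'"
    proof (rule psubsetI)
      show "J \<subseteq> J'" using ab by (auto simp: J_def J'_def)
      have "a \<in> J'" "a \<notin> J" using ab by (auto simp: J_def J'_def)
      then show "J \<noteq> J'" by blast
    qed
    then have lt: "card J < card J'" by (intro psubset_card_mono) (simp add: J'_def)
    obtain x where x: "\<exists>j\<in>J'. x j \<noteq> 0" "\<forall>k\<in>J. (\<Sum>j\<in>J'. ?h $$ (k, j) * x j) = 0"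
      using exists_nontrivial_solution[OF _ _ lt, of "\<lambda>k j. ?h $$ (k, j)"] by (auto simp: J_def J'_def)
    define v where "v = vec n (\<lambda>j. if j \<in> J' then x j else 0)"
    have v: "v \<in> carrier_vec n" by (simp add: v_def)
    have "?h *\<^sub>v v = 0\<^sub>v n"
    proof (rule eq_vecI)
      fix k assume "k < dim_vec (0\<^sub>v n :: complex vec)"
      then have k: "k < n" by simp
      have "(?h *\<^sub>v v) $ k = (\<Sum>j<n. ?h $$ (k, j) * v $ j)" by (rule index_mult_vec_sum[OF s(2) v k])
      also have "\<dots> = (\<Sum>j\<in>J'. ?h $$ (k, j) * x j)"
        by (rule sum.mono_neutral_cong_right) (auto simp: J'_def v_def)
      also have "\<dots> = 0"
      proof (cases "k \<in> J")
        case False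
        then show ?thesis using hk[of k] k by (intro sum.neutral) (simp add: J_def J'_def)
      qed (use x in blast)
      finally show "(?h *\<^sub>v v) $ k = 0\<^sub>v n $ k" using k by simp
    qed (use s in simp)
    then have "v = 0\<^sub>v n" using invertible_mult_vec_zero[OF s(2) _ v] s(5) by (simp add: SL_carrier)
    then have "\<forall>j<n. v $ j = 0" by simp
    then show False using x(1) by (auto simp: v_def J'_def)
  qed
qed

text \<open>P normalizes its own Lie algebra and hence lies in \<open>par n (blk {i})\<close>. It
  also contains an element with nonzero entry (i, i - 1), and the Borel subgroup together with one
  such element generates all of \<open>par n (blk {i})\<close>.\<close>

lemma minimal_parabolic_unique:
  assumes i: "i \<in> simple_roots n" and P: "standard_parabolic n P"
    and lie: "lie_algebra n P = par_algebra n (blk {i})"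
  shows "P = par n (blk {i})"
proof
  have i1: "1 \<le> i" "i < n" using i by (auto simp: simple_roots_def)
  then have n: "n \<ge> 1" by simp
  have sub: "subgroup P (SL n)" and borel: "borel_group n \<subseteq> P" using P by (auto simp: standard_parabolic_def)
  have PSL: "g \<in> carrier (SL n)" if "g \<in> P" for g using subgroup.subset[OF sub] that by blast
  let ?\<beta> = "blk {i}"
  have adjP: "adj_mat g \<in> P" if "g \<in> P" for g
    using subgroup.m_inv_closed[OF sub that] SL_inv[OF PSL[OF that]] by simp
  have adj_adj: "adj_mat (adj_mat g) = g" if g: "g \<in> P" for g
  proof -
    note a = SL_adj[OF PSL[OF g]] and a' = SL_adj[OF SL_adj(5)[OF PSL[OF g]]]
    have "g * (adj_mat g * adj_mat (adj_mat g)) = g * adj_mat g * adj_mat (adj_mat g)"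
      by (rule assoc_mult_mat[symmetric, OF a(1,2) a'(2)])
    then show ?thesis using a a' by simp
  qed
  show le: "P \<subseteq> par n ?\<beta>"
  proof
    fix g assume g: "g \<in> P"
    show "g \<in> par n ?\<beta>"
    proof (rule normalizer_par_algebra[OF n PSL[OF g]])
      fix X assume "X \<in> par_algebra n ?\<beta>"
      then have "conj_by n (adj_mat g) X \<in> par_algebra n ?\<beta>"
        using lie_algebra_conj_stable[OF sub adjP[OF g]] lie by simp
      then show "adj_mat g * X * g \<in> par_algebra n ?\<beta>"
        by (simp add: conj_by_adj[OF PSL[OF adjP[OF g]]] adj_adj[OF g])
    qed
  qed
  define p where "p = i - 1"
  have p: "p < i" "p < n" "p \<noteq> i" "Suc p = i" using i1 by (auto simp: p_def)
  have less: "?\<beta> b < ?\<beta> a \<longleftrightarrow> b < a \<and> \<not> (a = i \<and> b = p)" for a b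
    using blk_singleton_less[OF i1(1)] by (simp add: p_def)
  \<comment> \<open>If this entry vanished on all of P, it would vanish on the Lie algebra, which
    contains e_ip.\<close>
  have "\<exists>h\<in>P. h $$ (i, p) \<noteq> 0"
  proof (rule ccontr)
    assume "\<not> ?thesis"
    then have P0: "\<And>h. h \<in> P \<Longrightarrow> h $$ (i, p) = 0" by blast
    define X where "X = mat n n (\<lambda>(a, b). if a = i \<and> b = p then 1 else (0 :: complex))"
    have "trace X = 0" using p by (auto simp: trace_def X_def intro!: sum.neutral)
    then have "X \<in> lie_algebra n P" using less unfolding lie by (auto simp: par_algebra_def sl_def X_def)
    from lie_algebra_entry[OF this i1(2) p(2) P0] show False using i1 p by (simp add: X_def)
  qed
  then obtain h where h: "h \<in> P" "h $$ (i, p) \<noteq> 0" by blast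
  have borelI: "g \<in> P" if g: "g \<in> par n ?\<beta>" "g $$ (i, p) = 0" for g
  proof -
    have "g $$ (a, b) = 0" if "a < n" "b < n" "b < a" for a b
      using g that less[of b a] by (auto simp: par_def)
    then have "g \<in> borel_group n" using par_SL[OF g(1)] by (simp add: borel_group_par par_def)
    then show ?thesis using borel by blast
  qed
  show "par n ?\<beta> \<subseteq> P"
  proof
    fix g assume g: "g \<in> par n ?\<beta>"
    show "g \<in> P"
    proof (cases "g $$ (i, p) = 0")
      case True
      then show ?thesis by (rule borelI[OF g])
    next
      case False
      text \<open>A column operation makes the \<open>i\<close>-th rows of \<open>g\<close> and \<open>h\<close> proportional within the block;
        then \<open>g h\<^sup>-\<^sup>1\<close> is upper triangular.\<close>
      define x where "x = g $$ (i, i) / g $$ (i, p) - h $$ (i, i) / h $$ (i, p)"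
      define k where "k = h * transvection n p i x"
      define m where "m = g $$ (i, p) / h $$ (i, p)"
      have tB: "transvection n p i x \<in> borel_group n" unfolding borel_group_par by (rule transvection_par) (use p in auto)
      have kP: "k \<in> P" unfolding k_def using subgroup.m_closed[OF sub h(1)] tB borel by auto
      then have kp: "k \<in> par n ?\<beta>" using le by blast
      note hc = SL_adj(1)[OF PSL[OF h(1)]] and gc = par_carrier[OF g]
      note ka = SL_adj[OF PSL[OF kP]]
      have kent: "k $$ (i, b) = h $$ (i, b) + (if b = i then x * h $$ (i, p) else 0)" if "b < n" for b
        unfolding k_def by (rule mult_transvection_entry[OF hc p(2,3) i1(2) that])
      have kip: "g $$ (i, p) = m * k $$ (i, p)" using kent[OF p(2)] p h(2) by (simp add: m_def)
      have kii: "g $$ (i, i) = m * k $$ (i, i)" using kent[OF i1(2)] h(2) False by (simp add: m_def x_def field_simps)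
      define z where "z = g * adj_mat k"
      have zp: "z \<in> par n ?\<beta>" unfolding z_def by (rule par_mult[OF g par_adj[OF kp]])
      have "z $$ (i, p) = (\<Sum>l<n. g $$ (i, l) * adj_mat k $$ (l, p))"
        unfolding z_def by (rule index_mult_sum[OF gc ka(2) i1(2) p(2)])
      also have "\<dots> = (\<Sum>l<n. m * (k $$ (i, l) * adj_mat k $$ (l, p)))"
      proof (rule sum.cong[OF refl])
        fix l assume "l \<in> {..<n}"
        then have l: "l < n" by simp
        show "g $$ (i, l) * adj_mat k $$ (l, p) = m * (k $$ (i, l) * adj_mat k $$ (l, p))"
        proof (cases "l < p")
          case True
          then have "?\<beta> l < ?\<beta> i" using less p by simp
          then show ?thesis using g kp l i1 by (simp add: par_def)
        next
          case False
          show ?thesis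
          proof (cases "l = p \<or> l = i")
            case True
            then show ?thesis using kip kii by auto
          next
            case False
            then have "?\<beta> p < ?\<beta> l" using \<open>\<not> l < p\<close> less by auto
            then show ?thesis using par_adj[OF kp] l p by (simp add: par_def)
          qed
        qed
      qed
      also have "\<dots> = m * (k * adj_mat k) $$ (i, p)"
        unfolding index_mult_sum[OF ka(1,2) i1(2) p(2)] by (simp add: sum_distrib_left)
      also have "\<dots> = 0" using ka(3) p i1 by simp
      finally have "z \<in> P" by (rule borelI[OF zp])
      then have "z * k \<in> P" using subgroup.m_closed[OF sub _ kP] by simp
      moreover have "z * k = g"
        unfolding z_def using assoc_mult_mat[OF gc ka(2,1)] ka(4) gc by simp
      ultimately show ?thesis by simp
    qed
  qed
qed

lemma min_parabolic_eq:
  assumes i: "i \<in> simple_roots n" shows "min_parabolic n i = par n (blk {i})"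
  unfolding min_parabolic_def
proof (rule the_equality)
  have n: "n \<ge> 1" using i by (auto simp: simple_roots_def)
  show "standard_parabolic n (par n (blk {i})) \<and>
      lie_algebra n (par n (blk {i})) = {X + Y | X Y. X \<in> borel_algebra n \<and> Y \<in> neg_root_space n i}"
    unfolding standard_parabolic_def lie_algebra_par[OF n] par_algebra_singleton[OF i]
    using subgroup_par closedin_par borel_subset_par by blast
  show "P = par n (blk {i})" if "standard_parabolic n P \<and>
      lie_algebra n P = {X + Y | X Y. X \<in> borel_algebra n \<and> Y \<in> neg_root_space n i}" for P
    using minimal_parabolic_unique[OF i, of P] that unfolding par_algebra_singleton[OF i] by blast
qed

lemma transvection_min_parabolic:
  assumes "i \<in> simple_roots n" shows "transvection n i (i - 1) 1 \<in> min_parabolic n i"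
proof -
  have i1: "1 \<le> i" "i < n" using assms by (auto simp: simple_roots_def)
  have "blk {i} i \<le> blk {i} (i - 1)" using blk_singleton_less[OF i1(1), of "i - 1" i] by simp
  then show ?thesis unfolding min_parabolic_eq[OF assms] using i1 by (intro transvection_par) auto
qed

text \<open>The generated group lies between the Borel subgroup and \<open>par n (blk I)\<close> and
  contains the elementary matrices inside the blocks; this determines its unipotent radical.\<close>

lemma parabolic_nilradical_eq:
  assumes I: "I \<subseteq> simple_roots n" shows "parabolic_nilradical n I = rad n (blk I)"
proof -
  let ?K = "borel_group n \<union> (\<Union>i\<in>I. min_parabolic n i)"
  have K: "?K \<subseteq> par n (blk I)"
  proof
    fix g assume "g \<in> ?K"
    then consider "g \<in> borel_group n" | i where "i \<in> I" "g \<in> min_parabolic n i" by blast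
    then show "g \<in> par n (blk I)"
    proof cases
      case 1
      then show ?thesis using borel_subset_par by blast
    next
      case 2
      then show ?thesis using par_blk_mono[of "{i}" I n] min_parabolic_eq[of i n] I by auto
    qed
  qed
  then have KSL: "?K \<subseteq> carrier (SL n)" using par_SL by blast
  have H: "subgroup (parabolic n I) (SL n)"
    unfolding parabolic_def by (rule group.generate_is_subgroup[OF group_SL KSL])
  have Hp: "parabolic n I \<subseteq> par n (blk I)"
    unfolding parabolic_def by (rule group.generate_subgroup_incl[OF group_SL K subgroup_par])
  have KH: "?K \<subseteq> parabolic n I" unfolding parabolic_def by (auto intro: generate.incl)
  have "unipotent_radical n (parabolic n I) = uni n (blk I)"
  proof (rule unipotent_radical_eq[OF mono_blk H Hp])
    show borel: "borel_group n \<subseteq> parabolic n I" using KH by blast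
    fix a b assume ab: "a < n" "b < n" "a \<noteq> b" "blk I a = blk I b"
    show "transvection n a b 1 \<in> parabolic n I"
    proof (rule transvection_in_subgroup[OF H borel _ _ ab])
      show "transvection n i (i - 1) 1 \<in> parabolic n I" if "i \<in> I" "i < n" for i
        using transvection_min_parabolic[of i n] that I KH by blast
      show "1 \<le> i" if "i \<in> I" for i using that I by (auto simp: simple_roots_def)
    qed
  qed
  then show ?thesis by (simp add: parabolic_nilradical_def lie_algebra_uni)
qed

section \<open>Orbital varieties in the nilradical\<close>

text \<open>V is stable under conjugation by 1 + e_(b,b-1) for b in I; the proof is by induction on
  b - a. For a = b - 1 the conjugate of X has -X_ab at (b, a), where matrices of
  \<open>nilradical n\<close> are 0. For a < b - 1 it has X_(a,b-1) - X_ab at (a, b-1), and both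
  this entry and X_(a,b-1) vanish by induction.\<close>

lemma orbital_variety_subset_rad:
  assumes I: "I \<subseteq> simple_roots n" and V: "orbital_variety n V" and tau: "I \<subseteq> tau n V"
  shows "V \<subseteq> rad n (blk I)"
proof
  have Vr: "V \<subseteq> rad n (\<lambda>i. i)" by (rule orbital_variety_subset[OF V])
  have conj: "conj_by n (transvection n i (i - 1) 1) X \<in> V" if "i \<in> I" "X \<in> V" for i X
  proof -
    have "sweep n (min_parabolic n i) V = V" using tau that by (auto simp: tau_def)
    then show ?thesis using transvection_min_parabolic[of i n] I that unfolding sweep_def by blast
  qed
  have zero: "X $$ (a, b) = 0" if "X \<in> V" "a < b" "b < n" "blk I a = blk I b" for a b X
    using that
  proof (induction "b - a" arbitrary: b X rule: less_induct)
    case less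
    have I': "\<forall>k. a < k \<longrightarrow> k \<le> b \<longrightarrow> k \<in> I" using blk_eq_iff[of a b I] less.prems by simp
    then have bI: "b \<in> I" using less.prems by auto
    define q where "q = b - 1"
    have q: "q < b" "q < n" "a \<le> q" "b \<noteq> q" using less.prems by (auto simp: q_def)
    note Xr = subsetD[OF Vr less.prems(1)]
    define Y where "Y = conj_by n (transvection n b q 1) X"
    have Y: "Y \<in> V" unfolding Y_def q_def by (rule conj[OF bI less.prems(1)])
    note Yr = subsetD[OF Vr Y]
    show ?case
    proof (cases "q = a")
      case True
      have "Y $$ (b, a) = X $$ (b, a) + X $$ (a, a) - (X $$ (b, b) + X $$ (a, b))"
        unfolding Y_def using transvection_conj_entry[OF rad_carrier[OF Xr] less.prems(3) q(2,4), of b a] less.prems True by simp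
      moreover have "Y $$ (b, a) = 0" "X $$ (b, a) = 0" "X $$ (a, a) = 0" "X $$ (b, b) = 0"
        using Xr Yr less.prems by (simp_all add: rad_def)
      ultimately show ?thesis by simp
    next
      case False
      have blk: "blk I a = blk I q" using blk_eq_iff[of a q I] I' q by simp
      have "Y $$ (a, q) = X $$ (a, q) - X $$ (a, b)"
        unfolding Y_def using transvection_conj_entry[OF rad_carrier[OF Xr] less.prems(3) q(2,4), of a q] less.prems q by simp
      moreover have "Y $$ (a, q) = 0" "X $$ (a, q) = 0"
        using less.hyps[of q Y] less.hyps[of q X] Y less.prems q False blk by simp_all
      ultimately show ?thesis by simp
    qed
  qed
  fix X assume X: "X \<in> V"
  note Xr = subsetD[OF Vr X]
  show "X \<in> rad n (blk I)"
    unfolding rad_def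
  proof (intro CollectI conjI allI impI rad_carrier[OF Xr])
    fix i j assume ij: "i < n" "j < n" "blk I j \<le> blk I i"
    show "X $$ (i, j) = 0"
    proof (cases "i < j")
      case True
      then have "blk I i = blk I j" using ij monoD[OF mono_blk, of i j I] by simp
      then show ?thesis using zero[OF X True ij(2)] by simp
    next
      case False
      then show ?thesis using Xr ij by (simp add: rad_def)
    qed
  qed
qed

theorem theorem2p1:
  fixes n :: nat and I :: "nat set"
  assumes "n \<ge> 1" and "I \<subseteq> simple_roots n"
  shows "zariski n closure_of (richardson n I) = \<Union> {V. orbital_variety n V \<and> I \<subseteq> tau n V}"
proof -
  have "orbital_variety n (richardson n I) \<and> zariski n closure_of (richardson n I) = rad n (blk I)"
    unfolding richardson_def parabolic_nilradical_eq[OF assms(2)]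
    by (rule theI'[OF richardson_unique_existence[OF assms(1) mono_blk]])
  moreover have "rad n (blk I) = \<Union> {V. orbital_variety n V \<and> I \<subseteq> tau n V}"
  proof
    show "\<Union> {V. orbital_variety n V \<and> I \<subseteq> tau n V} \<subseteq> rad n (blk I)"
      using orbital_variety_subset_rad[OF assms(2)] by blast
    show "rad n (blk I) \<subseteq> \<Union> {V. orbital_variety n V \<and> I \<subseteq> tau n V}"
    proof
      fix X assume X: "X \<in> rad n (blk I)"
      obtain V \<kappa> where V: "irreducible_component (zariski n) (orbit n X \<inter> nilradical n) V" "X \<in> V" "V \<subseteq> rad n (blk I)"
        "\<forall>g\<in>par n (blk I). \<forall>Y\<in>V. conj_by n g Y \<in> V" "\<kappa> \<in> PiE {..<n} (\<lambda>_. {..n})"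
        "zariski n closure_of V = zariski n closure_of piece n \<kappa>"
        by (rule component_through[OF assms(1) mono_blk X])
      have orb: "orbital_variety n V"
        unfolding orbital_variety_def using V(1) nilpotent_orbit_orbit[OF rad_mono_id[OF mono_blk X]] by blast
      have "sweep n (min_parabolic n i) V = V" if i: "i \<in> I" for i
      proof
        have "min_parabolic n i \<subseteq> par n (blk I)"
          using min_parabolic_eq[of i n] par_blk_mono[of "{i}" I n] i assms(2) by auto
        then show "sweep n (min_parabolic n i) V \<subseteq> V" using V(4) by (auto simp: sweep_def)
        have one: "1\<^sub>m n \<in> min_parabolic n i" using min_parabolic_eq[of i n] par_one i assms(2) by auto
        show "V \<subseteq> sweep n (min_parabolic n i) V"
        proof
          fix Y assume Y: "Y \<in> V"
          then have "Y = conj_by n (1\<^sub>m n) Y" using V(3) rad_carrier conj_by_one by force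
          then show "Y \<in> sweep n (min_parabolic n i) V" unfolding sweep_def using one Y by blast
        qed
      qed
      then have "I \<subseteq> tau n V" using assms(2) by (auto simp: tau_def)
      then show "X \<in> \<Union> {V. orbital_variety n V \<and> I \<subseteq> tau n V}" using orb V(2) by blast
    qed
  qed
  ultimately show ?thesis by simp
qed

end
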